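(* Let $w$ be a weight structure on a triangulated category $\mathcal C$, let $A$ be an abelian category, and fix $j>0$, $k\in\mathbb Z$. I. Let $F:\mathcal C\to A$ be a covariant functor. Then the assignments $F_1=F_1^{kj}:X\mapsto\mathrm{Im}(F(w_{\le k+j}X)\to F(w_{\le k}X))$ and $F_2=F_2^{kj}:X\mapsto\mathrm{Im}(F(w_{\ge k+j}X)\to F(w_{\ge k}X))$ define functors $\mathcal C\to A$ that do not depend (up to a canonical isomorphism) on the choice of weight decompositions. Besides, there exist natural transformations $F_2\to F\to F_1$. II. Let $F:\mathcal C\to A$ be a homological (covariant) functor and let $j=1$. Then: 1. $F_1$ and $F_2$ are also homological. 2. The natural transformations $F_2\to F\to F_1$ extend canonically to a complex of functors $\dots\to F_1\circ[-1]\to F_2\to F\to F_1\to F_2\circ[1]\to\dots$ that is long exact when applied to any $X\in\mathrm{Obj}\,\mathcal C$. III. Let $F:\mathcal C\to A$ be a contravariant functor. 1. The assignments $F_1=F_1^{kj}:X\mapsto\mathrm{Im}(F(w_{\le k}X)\to F(w_{\le k+j}X))$ and $F_2=F_2^{kj}:X\mapsto\mathrm{Im}(F(w_{\ge k}X)\to F(w_{\ge k+j}X))$ define contravariant functors $\mathcal C\to A$ that do not depend (up to a canonical isomorphism) on the choice of weight decompositions. There exist natural transformations $F_1\to F\to F_2$. 2. If $F$ is cohomological and $j=1$, then $F_1,F_2$ are cohomological also; the transformations $F_1\to F\to F_2$ extend canonically to a long exact sequence of functors $\dots\to F_2\circ[1]\to F_1\to F\to F_2\to F_1\circ[-1]\to\dots$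 (i.e. the sequence is exact when applied to any $X\in\mathrm{Obj}\,\mathcal C$).
   Context: For classes of objects, $D\perp E$ means $\mathcal C(X,Y)=0$ for all $X\in D$, $Y\in E$. A weight structure $w$ on a triangulated category $\mathcal C$ is a pair of subclasses $\mathcal C^{w\le 0},\mathcal C^{w\ge 0}\subset\mathrm{Obj}\,\mathcal C$ such that: (i) both are additive and Karoubi-closed in $\mathcal C$ (contain all retracts of their objects); (ii) $\mathcal C^{w\ge 0}\subset \mathcal C^{w\ge 0}[1]$ and $\mathcal C^{w\le 0}[1]\subset \mathcal C^{w\le 0}$; (iii) $\mathcal C^{w\ge 0}\perp\mathcal C^{w\le 0}[1]$; (iv) for every $X$ there is a distinguished triangle $B[-1]\to X\to A\to B$ with $A\in\mathcal C^{w\le 0}$, $B\in\mathcal C^{w\ge 0}$ (a weight decomposition of $X$). For every $X\in \mathrm{Obj}\,\mathcal C$ and $i\in\mathbb Z$ choose a weight decomposition $X[i]\to X^{w\le i}\to X^{w\ge i+1}\to X[i+1]$ of $X[i]$ (with $X^{w\le i}\in\mathcal C^{w\le 0}$, $X^{w\ge i+1}\in\mathcal C^{w\ge 0}$) and put $w_{\le i}X=X^{w\le i}[-i]$, $w_{\ge i}X=X^{w\ge i}[-i]$; there are distinguished triangles $w_{\ge i+1}X\to X\to w_{\le i}X$. For $l<m$ there are unique morphisms $w_{\le m}X\to w_{\le l}X$ and $w_{\ge m+1}X\to w_{\ge l+1}X$ that together with $\mathrm{id}_X$ form a morphism of these triangles; these are the connecting morphisms used in the statement. Homological (resp. cohomological)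 functors are covariant (resp. contravariant) additive functors sending distinguished triangles to long exact sequences. *)

theory Defs
  imports "HOL-Algebra.Group"
begin

section \<open>Categories and functors\<close>

record ('o, 'm) category =
  Ob :: "'o set"
  Ar :: "'m set"
  Dom :: "'m \<Rightarrow> 'o"
  Cod :: "'m \<Rightarrow> 'o"
  Ident :: "'o \<Rightarrow> 'm"
  Comp :: "'m \<Rightarrow> 'm \<Rightarrow> 'm"  (infixr "\<cdot>\<index>" 70)

definition Hom :: "('o, 'm, 'z) category_scheme \<Rightarrow> 'o \<Rightarrow> 'o \<Rightarrow> 'm set" where
  "Hom C X Y = {f \<in> Ar C. Dom C f = X \<and> Cod C f = Y}"

locale category =
  fixes C :: "('o, 'm, 'z) category_scheme" (structure)
  assumes Dom_Ob: "f \<in> Ar C \<Longrightarrow> Dom C f \<in> Ob C"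
    and Cod_Ob: "f \<in> Ar C \<Longrightarrow> Cod C f \<in> Ob C"
    and Id_Hom: "X \<in> Ob C \<Longrightarrow> Ident C X \<in> Hom C X X"
    and Comp_Hom: "\<lbrakk>f \<in> Hom C X Y; g \<in> Hom C Y Z\<rbrakk> \<Longrightarrow> g \<cdot> f \<in> Hom C X Z"
    and Comp_Id_right: "f \<in> Hom C X Y \<Longrightarrow> f \<cdot> Ident C X = f"
    and Comp_Id_left: "f \<in> Hom C X Y \<Longrightarrow> Ident C Y \<cdot> f = f"
    and Comp_assoc: "\<lbrakk>f \<in> Hom C X Y; g \<in> Hom C Y Z; h \<in> Hom C Z W\<rbrakk>
      \<Longrightarrow> (h \<cdot> g) \<cdot> f = h \<cdot> (g \<cdot> f)"

definition is_iso :: "('o, 'm, 'z) category_scheme \<Rightarrow> 'm \<Rightarrow> bool" where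
  "is_iso C f \<longleftrightarrow> f \<in> Ar C \<and> (\<exists>g \<in> Hom C (Cod C f) (Dom C f).
     g \<cdot>\<^bsub>C\<^esub> f = Ident C (Dom C f) \<and> f \<cdot>\<^bsub>C\<^esub> g = Ident C (Cod C f))"

definition is_mono :: "('o, 'm, 'z) category_scheme \<Rightarrow> 'm \<Rightarrow> bool" where
  "is_mono C f \<longleftrightarrow> f \<in> Ar C \<and> (\<forall>W g h. g \<in> Hom C W (Dom C f) \<longrightarrow> h \<in> Hom C W (Dom C f)
     \<longrightarrow> f \<cdot>\<^bsub>C\<^esub> g = f \<cdot>\<^bsub>C\<^esub> h \<longrightarrow> g = h)"

definition is_epi :: "('o, 'm, 'z) category_scheme \<Rightarrow> 'm \<Rightarrow> bool" where
  "is_epi C f \<longleftrightarrow> f \<in> Ar C \<and> (\<forall>W g h. g \<in> Hom C (Cod C f) W \<longrightarrow> h \<in> Hom C (Cod C f) W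
     \<longrightarrow> g \<cdot>\<^bsub>C\<^esub> f = h \<cdot>\<^bsub>C\<^esub> f \<longrightarrow> g = h)"

record ('o, 'm, 'p, 'n) cfunctor =
  FO :: "'o \<Rightarrow> 'p"
  FA :: "'m \<Rightarrow> 'n"

definition is_functor ::
  "('o, 'm, 'y) category_scheme \<Rightarrow> ('p, 'n, 'z) category_scheme \<Rightarrow> ('o, 'm, 'p, 'n) cfunctor \<Rightarrow> bool"
  where
  "is_functor C A F \<longleftrightarrow>
     (\<forall>X \<in> Ob C. FO F X \<in> Ob A \<and> FA F (Ident C X) = Ident A (FO F X)) \<and>
     (\<forall>X Y. \<forall>f \<in> Hom C X Y. FA F f \<in> Hom A (FO F X) (FO F Y)) \<and>
     (\<forall>X Y Z. \<forall>f \<in> Hom C X Y. \<forall>g \<in> Hom C Y Z. FA F (g \<cdot>\<^bsub>C\<^esub> f) = FA F g \<cdot>\<^bsub>A\<^esub> FA F f)"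

definition comp_functor ::
  "('p, 'n, 'q, 'l) cfunctor \<Rightarrow> ('o, 'm, 'p, 'n) cfunctor \<Rightarrow> ('o, 'm, 'q, 'l) cfunctor" where
  "comp_functor G F = \<lparr>FO = FO G \<circ> FO F, FA = FA G \<circ> FA F\<rparr>"

definition nat_trans ::
  "('o, 'm, 'y) category_scheme \<Rightarrow> ('p, 'n, 'z) category_scheme
    \<Rightarrow> ('o, 'm, 'p, 'n) cfunctor \<Rightarrow> ('o, 'm, 'p, 'n) cfunctor \<Rightarrow> ('o \<Rightarrow> 'n) \<Rightarrow> bool" where
  "nat_trans C A F G \<eta> \<longleftrightarrow>
     (\<forall>X \<in> Ob C. \<eta> X \<in> Hom A (FO F X) (FO G X)) \<and>
     (\<forall>X Y. \<forall>f \<in> Hom C X Y. \<eta> Y \<cdot>\<^bsub>A\<^esub> FA F f = FA G f \<cdot>\<^bsub>A\<^esub> \<eta> X)"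

definition nat_iso ::
  "('o, 'm, 'y) category_scheme \<Rightarrow> ('p, 'n, 'z) category_scheme
    \<Rightarrow> ('o, 'm, 'p, 'n) cfunctor \<Rightarrow> ('o, 'm, 'p, 'n) cfunctor \<Rightarrow> ('o \<Rightarrow> 'n) \<Rightarrow> bool" where
  "nat_iso C A F G \<eta> \<longleftrightarrow> nat_trans C A F G \<eta> \<and> (\<forall>X \<in> Ob C. is_iso A (\<eta> X))"

section \<open>Additive and abelian categories\<close>

record ('o, 'm) precategory = "('o, 'm) category" +
  Zer :: "'o \<Rightarrow> 'o \<Rightarrow> 'm"
  Add :: "'m \<Rightarrow> 'm \<Rightarrow> 'm"  (infixl "\<oplus>\<index>" 65)

definition hom_group :: "('o, 'm, 'z) precategory_scheme \<Rightarrow> 'o \<Rightarrow> 'o \<Rightarrow> 'm monoid" where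
  "hom_group C X Y = \<lparr>carrier = Hom C X Y, monoid.mult = Add C, one = Zer C X Y\<rparr>"

definition neg :: "('o, 'm, 'z) precategory_scheme \<Rightarrow> 'm \<Rightarrow> 'm" where
  "neg C f = inv\<^bsub>hom_group C (Dom C f) (Cod C f)\<^esub> f"

text \<open>Contravariant functors \<open>C \<rightarrow> A\<close> are covariant functors on the opposite category.\<close>

definition opp :: "('o, 'm, 'z) precategory_scheme \<Rightarrow> ('o, 'm) precategory" where
  "opp C = \<lparr>Ob = Ob C, Ar = Ar C, Dom = Cod C, Cod = Dom C, Ident = Ident C,
     Comp = (\<lambda>g f. f \<cdot>\<^bsub>C\<^esub> g), Zer = (\<lambda>X Y. Zer C Y X), Add = Add C\<rparr>"

locale preadditive_category = category C
  for C :: "('o, 'm, 'z) precategory_scheme" (structure) +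
  assumes hom_comm_group: "\<lbrakk>X \<in> Ob C; Y \<in> Ob C\<rbrakk> \<Longrightarrow> comm_group (hom_group C X Y)"
    and Comp_Add_right: "\<lbrakk>f \<in> Hom C X Y; f' \<in> Hom C X Y; g \<in> Hom C Y Z\<rbrakk>
      \<Longrightarrow> g \<cdot> (f \<oplus> f') = (g \<cdot> f) \<oplus> (g \<cdot> f')"
    and Comp_Add_left: "\<lbrakk>f \<in> Hom C X Y; g \<in> Hom C Y Z; g' \<in> Hom C Y Z\<rbrakk>
      \<Longrightarrow> (g \<oplus> g') \<cdot> f = (g \<cdot> f) \<oplus> (g' \<cdot> f)"

definition zero_object :: "('o, 'm, 'z) category_scheme \<Rightarrow> 'o \<Rightarrow> bool" where
  "zero_object C Z \<longleftrightarrow> Z \<in> Ob C \<and>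
     (\<forall>X \<in> Ob C. (\<exists>!f. f \<in> Hom C X Z) \<and> (\<exists>!f. f \<in> Hom C Z X))"

definition biproduct ::
  "('o, 'm, 'z) precategory_scheme \<Rightarrow> 'o \<Rightarrow> 'o \<Rightarrow> 'o \<Rightarrow> 'm \<Rightarrow> 'm \<Rightarrow> 'm \<Rightarrow> 'm \<Rightarrow> bool" where
  "biproduct C X Y P i\<^sub>1 i\<^sub>2 p\<^sub>1 p\<^sub>2 \<longleftrightarrow>
     i\<^sub>1 \<in> Hom C X P \<and> i\<^sub>2 \<in> Hom C Y P \<and> p\<^sub>1 \<in> Hom C P X \<and> p\<^sub>2 \<in> Hom C P Y \<and>
     p\<^sub>1 \<cdot>\<^bsub>C\<^esub> i\<^sub>1 = Ident C X \<and> p\<^sub>2 \<cdot>\<^bsub>C\<^esub> i\<^sub>2 = Ident C Y \<and>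
     p\<^sub>2 \<cdot>\<^bsub>C\<^esub> i\<^sub>1 = Zer C X Y \<and> p\<^sub>1 \<cdot>\<^bsub>C\<^esub> i\<^sub>2 = Zer C Y X \<and>
     (i\<^sub>1 \<cdot>\<^bsub>C\<^esub> p\<^sub>1) \<oplus>\<^bsub>C\<^esub> (i\<^sub>2 \<cdot>\<^bsub>C\<^esub> p\<^sub>2) = Ident C P"

locale additive_category = preadditive_category +
  assumes ex_zero_object: "\<exists>Z. zero_object C Z"
    and ex_biproduct: "\<lbrakk>X \<in> Ob C; Y \<in> Ob C\<rbrakk> \<Longrightarrow> \<exists>P i\<^sub>1 i\<^sub>2 p\<^sub>1 p\<^sub>2. biproduct C X Y P i\<^sub>1 i\<^sub>2 p\<^sub>1 p\<^sub>2"

definition additive_functor ::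
  "('o, 'm, 'y) precategory_scheme \<Rightarrow> ('p, 'n, 'z) precategory_scheme
    \<Rightarrow> ('o, 'm, 'p, 'n) cfunctor \<Rightarrow> bool" where
  "additive_functor C A F \<longleftrightarrow> is_functor C A F \<and>
     (\<forall>X Y. \<forall>f \<in> Hom C X Y. \<forall>g \<in> Hom C X Y. FA F (f \<oplus>\<^bsub>C\<^esub> g) = FA F f \<oplus>\<^bsub>A\<^esub> FA F g)"

definition is_kernel :: "('o, 'm, 'z) precategory_scheme \<Rightarrow> 'm \<Rightarrow> 'm \<Rightarrow> bool" where
  "is_kernel C f m \<longleftrightarrow> f \<in> Ar C \<and> m \<in> Ar C \<and> Cod C m = Dom C f \<and>
     f \<cdot>\<^bsub>C\<^esub> m = Zer C (Dom C m) (Cod C f) \<and>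
     (\<forall>W. \<forall>h \<in> Hom C W (Dom C f). f \<cdot>\<^bsub>C\<^esub> h = Zer C W (Cod C f)
        \<longrightarrow> (\<exists>!u. u \<in> Hom C W (Dom C m) \<and> m \<cdot>\<^bsub>C\<^esub> u = h))"

definition is_cokernel :: "('o, 'm, 'z) precategory_scheme \<Rightarrow> 'm \<Rightarrow> 'm \<Rightarrow> bool" where
  "is_cokernel C f q \<longleftrightarrow> f \<in> Ar C \<and> q \<in> Ar C \<and> Dom C q = Cod C f \<and>
     q \<cdot>\<^bsub>C\<^esub> f = Zer C (Dom C f) (Cod C q) \<and>
     (\<forall>W. \<forall>h \<in> Hom C (Cod C f) W. h \<cdot>\<^bsub>C\<^esub> f = Zer C (Dom C f) W
        \<longrightarrow> (\<exists>!u. u \<in> Hom C (Cod C q) W \<and> u \<cdot>\<^bsub>C\<^esub> q = h))"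

locale abelian_category = additive_category +
  assumes ex_kernel: "f \<in> Ar C \<Longrightarrow> \<exists>m. is_kernel C f m"
    and ex_cokernel: "f \<in> Ar C \<Longrightarrow> \<exists>q. is_cokernel C f q"
    and mono_normal: "is_mono C m \<Longrightarrow> \<exists>f. is_kernel C f m"
    and epi_normal: "is_epi C q \<Longrightarrow> \<exists>f. is_cokernel C f q"

definition is_image :: "('o, 'm, 'z) precategory_scheme \<Rightarrow> 'm \<Rightarrow> 'm \<Rightarrow> bool" where
  "is_image C f m \<longleftrightarrow> (\<exists>q. is_cokernel C f q \<and> is_kernel C q m)"

text \<open>\<open>image_incl A f\<close> is the inclusion of the image of \<open>f\<close>, a monomorphism into \<open>Cod A f\<close>; the image as an
  object is \<open>Dom A (image_incl A f)\<close>.\<close>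

definition image_incl :: "('o, 'm, 'z) precategory_scheme \<Rightarrow> 'm \<Rightarrow> 'm" where
  "image_incl C f = (SOME m. is_image C f m)"

definition exact :: "('o, 'm, 'z) precategory_scheme \<Rightarrow> 'm \<Rightarrow> 'm \<Rightarrow> bool" where
  "exact C f g \<longleftrightarrow> (\<exists>m. is_image C f m \<and> is_kernel C g m)"

text \<open>Exactness of \<open>\<dots> \<rightarrow> \<cdot> \<midarrow>a n\<rightarrow> \<cdot> \<midarrow>b n\<rightarrow> \<cdot> \<midarrow>c n\<rightarrow> \<cdot> \<midarrow>a (n + 1)\<rightarrow> \<cdot> \<rightarrow> \<dots>\<close>\<close>

definition long_exact ::
  "('o, 'm, 'z) precategory_scheme \<Rightarrow> (int \<Rightarrow> 'm) \<Rightarrow> (int \<Rightarrow> 'm) \<Rightarrow> (int \<Rightarrow> 'm) \<Rightarrow> bool" where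
  "long_exact A a b c \<longleftrightarrow>
     (\<forall>n. exact A (a n) (b n) \<and> exact A (b n) (c n) \<and> exact A (c n) (a (n + 1)))"

section \<open>Triangulated categories\<close>

text \<open>The shift is an automorphism of the category, so that \<open>X[i]\<close> makes sense on the nose for all
  integers \<open>i\<close>. A distinguished triangle \<open>X \<midarrow>f\<rightarrow> Y \<midarrow>g\<rightarrow> Z \<midarrow>h\<rightarrow> X[1]\<close> is recorded as \<open>(f, g, h)\<close>.\<close>

record ('o, 'm) tricategory = "('o, 'm) precategory" +
  Shift :: "('o, 'm, 'o, 'm) cfunctor"
  Dist :: "('m \<times> 'm \<times> 'm) set"

definition sh_ob :: "('o, 'm, 'z) tricategory_scheme \<Rightarrow> int \<Rightarrow> 'o \<Rightarrow> 'o" where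
  "sh_ob C i = (if 0 \<le> i then FO (Shift C) ^^ nat i
     else inv_into (Ob C) (FO (Shift C)) ^^ nat (- i))"

definition sh_ar :: "('o, 'm, 'z) tricategory_scheme \<Rightarrow> int \<Rightarrow> 'm \<Rightarrow> 'm" where
  "sh_ar C i = (if 0 \<le> i then FA (Shift C) ^^ nat i
     else inv_into (Ar C) (FA (Shift C)) ^^ nat (- i))"

definition sh :: "('o, 'm, 'z) tricategory_scheme \<Rightarrow> int \<Rightarrow> ('o, 'm, 'o, 'm) cfunctor" where
  "sh C i = \<lparr>FO = sh_ob C i, FA = sh_ar C i\<rparr>"

definition triangle ::
  "('o, 'm, 'z) tricategory_scheme \<Rightarrow> 'o \<Rightarrow> 'o \<Rightarrow> 'o \<Rightarrow> 'm \<times> 'm \<times> 'm \<Rightarrow> bool" where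
  "triangle C X Y Z = (\<lambda>(f, g, h). f \<in> Hom C X Y \<and> g \<in> Hom C Y Z \<and> h \<in> Hom C Z (sh_ob C 1 X))"

definition tri_mor ::
  "('o, 'm, 'z) tricategory_scheme \<Rightarrow> 'm \<times> 'm \<times> 'm \<Rightarrow> 'm \<times> 'm \<times> 'm \<Rightarrow> 'm \<Rightarrow> 'm \<Rightarrow> 'm \<Rightarrow> bool" where
  "tri_mor C = (\<lambda>(f, g, h) (f', g', h') a b c.
     a \<in> Hom C (Dom C f) (Dom C f') \<and> b \<in> Hom C (Cod C f) (Cod C f') \<and>
     c \<in> Hom C (Cod C g) (Cod C g') \<and>
     b \<cdot>\<^bsub>C\<^esub> f = f' \<cdot>\<^bsub>C\<^esub> a \<and> c \<cdot>\<^bsub>C\<^esub> g = g' \<cdot>\<^bsub>C\<^esub> b \<and> sh_ar C 1 a \<cdot>\<^bsub>C\<^esub> h = h' \<cdot>\<^bsub>C\<^esub> c)"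

locale triangulated_category = additive_category C
  for C :: "('o, 'm, 'z) tricategory_scheme" (structure) +
  assumes Shift_additive: "additive_functor C C (Shift C)"
    and Shift_bij_Ob: "bij_betw (FO (Shift C)) (Ob C) (Ob C)"
    and Shift_bij_Ar: "bij_betw (FA (Shift C)) (Ar C) (Ar C)"
    and Dist_triangle: "t \<in> Dist C \<Longrightarrow> \<exists>X Y Z. triangle C X Y Z t"
    and TR1_Id: "\<lbrakk>X \<in> Ob C; zero_object C Z\<rbrakk>
      \<Longrightarrow> (Ident C X, Zer C X Z, Zer C Z (sh_ob C 1 X)) \<in> Dist C"
    and TR1_iso: "\<lbrakk>t \<in> Dist C; triangle C X Y Z t'; tri_mor C t t' a b c;
        is_iso C a; is_iso C b; is_iso C c\<rbrakk> \<Longrightarrow> t' \<in> Dist C"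
    and TR1_cone: "f \<in> Ar C \<Longrightarrow> \<exists>g h. (f, g, h) \<in> Dist C"
    and TR2: "triangle C X Y Z (f, g, h)
      \<Longrightarrow> (f, g, h) \<in> Dist C \<longleftrightarrow> (g, h, neg C (sh_ar C 1 f)) \<in> Dist C"
    and TR3: "\<lbrakk>(f, g, h) \<in> Dist C; (f', g', h') \<in> Dist C;
        a \<in> Hom C (Dom C f) (Dom C f'); b \<in> Hom C (Cod C f) (Cod C f'); b \<cdot> f = f' \<cdot> a\<rbrakk>
      \<Longrightarrow> \<exists>c. tri_mor C (f, g, h) (f', g', h') a b c"
    and TR4: "\<lbrakk>f \<in> Hom C X Y; g \<in> Hom C Y Z; (f, i, i') \<in> Dist C; (g, j, j') \<in> Dist C;
        (g \<cdot> f, l, l') \<in> Dist C\<rbrakk>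
      \<Longrightarrow> \<exists>u v. tri_mor C (f, i, i') (g \<cdot> f, l, l') (Ident C X) g u \<and>
                tri_mor C (g \<cdot> f, l, l') (g, j, j') f (Ident C Z) v \<and>
                (u, v, sh_ar C 1 i \<cdot> j') \<in> Dist C"

definition homological ::
  "('o, 'm, 'y) tricategory_scheme \<Rightarrow> ('p, 'n, 'z) precategory_scheme
    \<Rightarrow> ('o, 'm, 'p, 'n) cfunctor \<Rightarrow> bool" where
  "homological C A F \<longleftrightarrow> additive_functor C A F \<and>
     (\<forall>(f, g, h) \<in> Dist C. long_exact A
        (\<lambda>n. FA F (sh_ar C n f)) (\<lambda>n. FA F (sh_ar C n g)) (\<lambda>n. FA F (sh_ar C n h)))"

text \<open>For a triangle \<open>X \<rightarrow> Y \<rightarrow> Z \<rightarrow> X[1]\<close> the sequence is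
  \<open>\<dots> \<rightarrow> F(Z[-n]) \<rightarrow> F(Y[-n]) \<rightarrow> F(X[-n]) \<rightarrow> F(Z[-n-1]) \<rightarrow> \<dots>\<close>.\<close>

definition cohomological ::
  "('o, 'm, 'y) tricategory_scheme \<Rightarrow> ('p, 'n, 'z) precategory_scheme
    \<Rightarrow> ('o, 'm, 'p, 'n) cfunctor \<Rightarrow> bool" where
  "cohomological C A F \<longleftrightarrow> additive_functor (opp C) A F \<and>
     (\<forall>(f, g, h) \<in> Dist C. long_exact A
        (\<lambda>n. FA F (sh_ar C (- n) g)) (\<lambda>n. FA F (sh_ar C (- n) f)) (\<lambda>n. FA F (sh_ar C (- n - 1) h)))"

section \<open>Weight structures\<close>

definition additive_class :: "('o, 'm, 'z) precategory_scheme \<Rightarrow> 'o set \<Rightarrow> bool" where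
  "additive_class C D \<longleftrightarrow> D \<subseteq> Ob C \<and> (\<forall>Z. zero_object C Z \<longrightarrow> Z \<in> D) \<and>
     (\<forall>X \<in> D. \<forall>Y \<in> D. \<forall>P i\<^sub>1 i\<^sub>2 p\<^sub>1 p\<^sub>2. biproduct C X Y P i\<^sub>1 i\<^sub>2 p\<^sub>1 p\<^sub>2 \<longrightarrow> P \<in> D)"

definition Karoubi_closed :: "('o, 'm, 'z) category_scheme \<Rightarrow> 'o set \<Rightarrow> bool" where
  "Karoubi_closed C D \<longleftrightarrow>
     (\<forall>Y \<in> D. \<forall>X \<in> Ob C. \<forall>i \<in> Hom C X Y. \<forall>p \<in> Hom C Y X. p \<cdot>\<^bsub>C\<^esub> i = Ident C X \<longrightarrow> X \<in> D)"

definition orthogonal :: "('o, 'm, 'z) precategory_scheme \<Rightarrow> 'o set \<Rightarrow> 'o set \<Rightarrow> bool" where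
  "orthogonal C D E \<longleftrightarrow> (\<forall>X \<in> D. \<forall>Y \<in> E. Hom C X Y = {Zer C X Y})"

text \<open>\<open>L\<close> stands for \<open>C\<^sup>w\<^sup>\<le>\<^sup>0\<close> and \<open>G\<close> for \<open>C\<^sup>w\<^sup>\<ge>\<^sup>0\<close>.\<close>

definition weight_structure :: "('o, 'm, 'z) tricategory_scheme \<Rightarrow> 'o set \<Rightarrow> 'o set \<Rightarrow> bool" where
  "weight_structure C L G \<longleftrightarrow>
     additive_class C L \<and> additive_class C G \<and> Karoubi_closed C L \<and> Karoubi_closed C G \<and>
     G \<subseteq> sh_ob C 1 ` G \<and> sh_ob C 1 ` L \<subseteq> L \<and>
     orthogonal C G (sh_ob C 1 ` L) \<and>
     (\<forall>X \<in> Ob C. \<exists>A \<in> L. \<exists>B \<in> G. \<exists>t \<in> Dist C. triangle C (sh_ob C (-1) B) X A t)"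

text \<open>A choice, for all \<open>X\<close> and \<open>i\<close>, of a weight decomposition
  \<open>X[i] \<midarrow>wda i X\<rightarrow> Xle i X \<midarrow>wdb i X\<rightarrow> Xge (i + 1) X \<midarrow>wdc i X\<rightarrow> X[i + 1]\<close> of \<open>X[i]\<close>.\<close>

record ('o, 'm) wchoice =
  Xle :: "int \<Rightarrow> 'o \<Rightarrow> 'o"
  Xge :: "int \<Rightarrow> 'o \<Rightarrow> 'o"
  wda :: "int \<Rightarrow> 'o \<Rightarrow> 'm"
  wdb :: "int \<Rightarrow> 'o \<Rightarrow> 'm"
  wdc :: "int \<Rightarrow> 'o \<Rightarrow> 'm"

definition weight_choice ::
  "('o, 'm, 'z) tricategory_scheme \<Rightarrow> 'o set \<Rightarrow> 'o set \<Rightarrow> ('o, 'm) wchoice \<Rightarrow> bool" where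
  "weight_choice C L G D \<longleftrightarrow> (\<forall>X \<in> Ob C. \<forall>i.
     Xle D i X \<in> L \<and> Xge D (i + 1) X \<in> G \<and>
     triangle C (sh_ob C i X) (Xle D i X) (Xge D (i + 1) X) (wda D i X, wdb D i X, wdc D i X) \<and>
     (wda D i X, wdb D i X, wdc D i X) \<in> Dist C)"

definition w_le :: "('o, 'm, 'z) tricategory_scheme \<Rightarrow> ('o, 'm) wchoice \<Rightarrow> int \<Rightarrow> 'o \<Rightarrow> 'o" where
  "w_le C D i X = sh_ob C (- i) (Xle D i X)"

definition w_ge :: "('o, 'm, 'z) tricategory_scheme \<Rightarrow> ('o, 'm) wchoice \<Rightarrow> int \<Rightarrow> 'o \<Rightarrow> 'o" where
  "w_ge C D i X = sh_ob C (- i) (Xge D i X)"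

text \<open>The triangle \<open>w_ge (i + 1) X \<midarrow>w_in (i + 1) X\<rightarrow> X \<midarrow>w_pr i X\<rightarrow> w_le i X \<midarrow>w_bd i X\<rightarrow> (w_ge (i + 1) X)[1]\<close>:
  shifting a distinguished triangle \<open>(a, b, c)\<close> by \<open>-i\<close> gives the distinguished triangle
  \<open>(a[-i], b[-i], (-1)\<^sup>i c[-i])\<close>, and rotating backwards turns the last map into
  \<open>(-1)\<^sup>i\<^sup>+\<^sup>1 c[-i-1]\<close> in first position.\<close>

definition w_pr :: "('o, 'm, 'z) tricategory_scheme \<Rightarrow> ('o, 'm) wchoice \<Rightarrow> int \<Rightarrow> 'o \<Rightarrow> 'm" where
  "w_pr C D i X = sh_ar C (- i) (wda D i X)"

definition w_bd :: "('o, 'm, 'z) tricategory_scheme \<Rightarrow> ('o, 'm) wchoice \<Rightarrow> int \<Rightarrow> 'o \<Rightarrow> 'm" where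
  "w_bd C D i X = sh_ar C (- i) (wdb D i X)"

definition w_in :: "('o, 'm, 'z) tricategory_scheme \<Rightarrow> ('o, 'm) wchoice \<Rightarrow> int \<Rightarrow> 'o \<Rightarrow> 'm" where
  "w_in C D i X =
     (let c = sh_ar C (- i) (wdc D (i - 1) X) in if even i then c else neg C c)"

definition w_tri ::
  "('o, 'm, 'z) tricategory_scheme \<Rightarrow> ('o, 'm) wchoice \<Rightarrow> int \<Rightarrow> 'o \<Rightarrow> 'm \<times> 'm \<times> 'm" where
  "w_tri C D i X = (w_in C D (i + 1) X, w_pr C D i X, w_bd C D i X)"

text \<open>The connecting morphisms \<open>w_ge (m + 1) X \<rightarrow> w_ge (l + 1) X\<close> and \<open>w_le m X \<rightarrow> w_le l X\<close> for
  \<open>l < m\<close>.\<close>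

definition w_conn ::
  "('o, 'm, 'z) tricategory_scheme \<Rightarrow> ('o, 'm) wchoice \<Rightarrow> int \<Rightarrow> int \<Rightarrow> 'o \<Rightarrow> 'm \<times> 'm" where
  "w_conn C D m l X = (THE (d, c). tri_mor C (w_tri C D m X) (w_tri C D l X) d (Ident C X) c)"

definition conn_ge ::
  "('o, 'm, 'z) tricategory_scheme \<Rightarrow> ('o, 'm) wchoice \<Rightarrow> int \<Rightarrow> int \<Rightarrow> 'o \<Rightarrow> 'm" where
  "conn_ge C D m l X = fst (w_conn C D (m - 1) (l - 1) X)"

definition conn_le ::
  "('o, 'm, 'z) tricategory_scheme \<Rightarrow> ('o, 'm) wchoice \<Rightarrow> int \<Rightarrow> int \<Rightarrow> 'o \<Rightarrow> 'm" where
  "conn_le C D m l X = snd (w_conn C D m l X)"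

section \<open>The functors \<open>F\<^sub>1\<close> and \<open>F\<^sub>2\<close>\<close>

text \<open>Inclusions of the images. They serve both variances, as \<open>FA F\<close> reverses arrows for
  contravariant \<open>F\<close>: the ambient object of \<open>F1_im\<close> is \<open>F(w_le k X)\<close> for covariant \<open>F\<close> and
  \<open>F(w_le (k + j) X)\<close> for contravariant \<open>F\<close>, and likewise for \<open>F2_im\<close>.\<close>

definition F1_im ::
  "('o, 'm, 'y) tricategory_scheme \<Rightarrow> ('p, 'n, 'z) precategory_scheme \<Rightarrow> ('o, 'm, 'p, 'n) cfunctor
    \<Rightarrow> int \<Rightarrow> int \<Rightarrow> ('o, 'm) wchoice \<Rightarrow> 'o \<Rightarrow> 'n" where
  "F1_im C A F k j D X = image_incl A (FA F (conn_le C D (k + j) k X))"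

definition F2_im ::
  "('o, 'm, 'y) tricategory_scheme \<Rightarrow> ('p, 'n, 'z) precategory_scheme \<Rightarrow> ('o, 'm, 'p, 'n) cfunctor
    \<Rightarrow> int \<Rightarrow> int \<Rightarrow> ('o, 'm) wchoice \<Rightarrow> 'o \<Rightarrow> 'n" where
  "F2_im C A F k j D X = image_incl A (FA F (conn_ge C D (k + j) k X))"

text \<open>Extensions of \<open>g : X \<rightarrow> Y\<close> to the pieces of weight decompositions; \<open>D\<close> is used for \<open>X\<close> and
  \<open>D'\<close> for \<open>Y\<close>. Such extensions are not unique, but the maps induced on images are.\<close>

definition le_ext ::
  "('o, 'm, 'z) tricategory_scheme \<Rightarrow> ('o, 'm) wchoice \<Rightarrow> ('o, 'm) wchoice \<Rightarrow> int \<Rightarrow> 'm \<Rightarrow> 'm \<Rightarrow> bool"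
  where
  "le_ext C D D' i g b \<longleftrightarrow> b \<in> Hom C (w_le C D i (Dom C g)) (w_le C D' i (Cod C g)) \<and>
     b \<cdot>\<^bsub>C\<^esub> w_pr C D i (Dom C g) = w_pr C D' i (Cod C g) \<cdot>\<^bsub>C\<^esub> g"

definition ge_ext ::
  "('o, 'm, 'z) tricategory_scheme \<Rightarrow> ('o, 'm) wchoice \<Rightarrow> ('o, 'm) wchoice \<Rightarrow> int \<Rightarrow> 'm \<Rightarrow> 'm \<Rightarrow> bool"
  where
  "ge_ext C D D' i g b \<longleftrightarrow> b \<in> Hom C (w_ge C D i (Dom C g)) (w_ge C D' i (Cod C g)) \<and>
     w_in C D' i (Cod C g) \<cdot>\<^bsub>C\<^esub> b = g \<cdot>\<^bsub>C\<^esub> w_in C D i (Dom C g)"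

text \<open>Maps \<open>(w_ge (i + 1) X)[1] \<rightarrow> w_ge i (X[1])\<close> over \<open>X[1]\<close>, comparing two pieces of weight
  decompositions of \<open>X[1]\<close>\<close>

definition sh_ext :: "('o, 'm, 'z) tricategory_scheme \<Rightarrow> ('o, 'm) wchoice \<Rightarrow> int \<Rightarrow> 'o \<Rightarrow> 'm \<Rightarrow> bool"
  where
  "sh_ext C D i X u \<longleftrightarrow>
     u \<in> Hom C (sh_ob C 1 (w_ge C D (i + 1) X)) (w_ge C D i (sh_ob C 1 X)) \<and>
     w_in C D i (sh_ob C 1 X) \<cdot>\<^bsub>C\<^esub> u = sh_ar C 1 (w_in C D (i + 1) X)"

definition factors :: "('o, 'm, 'z) category_scheme \<Rightarrow> 'm \<Rightarrow> 'm \<Rightarrow> 'm \<Rightarrow> bool" where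
  "factors A h m u \<longleftrightarrow> u \<in> Hom A (Dom A h) (Dom A m) \<and> m \<cdot>\<^bsub>A\<^esub> u = h"

subsection \<open>Covariant \<open>F\<close>\<close>

definition F1_rel ::
  "('o, 'm, 'y) tricategory_scheme \<Rightarrow> ('p, 'n, 'z) precategory_scheme \<Rightarrow> ('o, 'm, 'p, 'n) cfunctor
    \<Rightarrow> int \<Rightarrow> int \<Rightarrow> ('o, 'm) wchoice \<Rightarrow> ('o, 'm) wchoice \<Rightarrow> 'm \<Rightarrow> 'n \<Rightarrow> bool" where
  "F1_rel C A F k j D D' g u \<longleftrightarrow> (\<exists>b. le_ext C D D' k g b \<and>
     factors A (FA F b \<cdot>\<^bsub>A\<^esub> F1_im C A F k j D (Dom C g)) (F1_im C A F k j D' (Cod C g)) u)"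

definition F2_rel ::
  "('o, 'm, 'y) tricategory_scheme \<Rightarrow> ('p, 'n, 'z) precategory_scheme \<Rightarrow> ('o, 'm, 'p, 'n) cfunctor
    \<Rightarrow> int \<Rightarrow> int \<Rightarrow> ('o, 'm) wchoice \<Rightarrow> ('o, 'm) wchoice \<Rightarrow> 'm \<Rightarrow> 'n \<Rightarrow> bool" where
  "F2_rel C A F k j D D' g u \<longleftrightarrow> (\<exists>b. ge_ext C D D' k g b \<and>
     factors A (FA F b \<cdot>\<^bsub>A\<^esub> F2_im C A F k j D (Dom C g)) (F2_im C A F k j D' (Cod C g)) u)"

text \<open>With \<open>D = D'\<close> these are the actions of \<open>F\<^sub>1\<close> and \<open>F\<^sub>2\<close> on morphisms; with \<open>g\<close> an identity they
  are the comparison maps between the functors for two choices.\<close>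

definition F1_map ::
  "('o, 'm, 'y) tricategory_scheme \<Rightarrow> ('p, 'n, 'z) precategory_scheme \<Rightarrow> ('o, 'm, 'p, 'n) cfunctor
    \<Rightarrow> int \<Rightarrow> int \<Rightarrow> ('o, 'm) wchoice \<Rightarrow> ('o, 'm) wchoice \<Rightarrow> 'm \<Rightarrow> 'n" where
  "F1_map C A F k j D D' g = (THE u. F1_rel C A F k j D D' g u)"

definition F2_map ::
  "('o, 'm, 'y) tricategory_scheme \<Rightarrow> ('p, 'n, 'z) precategory_scheme \<Rightarrow> ('o, 'm, 'p, 'n) cfunctor
    \<Rightarrow> int \<Rightarrow> int \<Rightarrow> ('o, 'm) wchoice \<Rightarrow> ('o, 'm) wchoice \<Rightarrow> 'm \<Rightarrow> 'n" where
  "F2_map C A F k j D D' g = (THE u. F2_rel C A F k j D D' g u)"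

definition F1_fun ::
  "('o, 'm, 'y) tricategory_scheme \<Rightarrow> ('p, 'n, 'z) precategory_scheme \<Rightarrow> ('o, 'm, 'p, 'n) cfunctor
    \<Rightarrow> int \<Rightarrow> int \<Rightarrow> ('o, 'm) wchoice \<Rightarrow> ('o, 'm, 'p, 'n) cfunctor" where
  "F1_fun C A F k j D =
     \<lparr>FO = \<lambda>X. Dom A (F1_im C A F k j D X), FA = F1_map C A F k j D D\<rparr>"

definition F2_fun ::
  "('o, 'm, 'y) tricategory_scheme \<Rightarrow> ('p, 'n, 'z) precategory_scheme \<Rightarrow> ('o, 'm, 'p, 'n) cfunctor
    \<Rightarrow> int \<Rightarrow> int \<Rightarrow> ('o, 'm) wchoice \<Rightarrow> ('o, 'm, 'p, 'n) cfunctor" where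
  "F2_fun C A F k j D =
     \<lparr>FO = \<lambda>X. Dom A (F2_im C A F k j D X), FA = F2_map C A F k j D D\<rparr>"

text \<open>The transformations \<open>F\<^sub>2 \<rightarrow> F \<rightarrow> F\<^sub>1\<close>\<close>

definition F2_to ::
  "('o, 'm, 'y) tricategory_scheme \<Rightarrow> ('p, 'n, 'z) precategory_scheme \<Rightarrow> ('o, 'm, 'p, 'n) cfunctor
    \<Rightarrow> int \<Rightarrow> int \<Rightarrow> ('o, 'm) wchoice \<Rightarrow> 'o \<Rightarrow> 'n" where
  "F2_to C A F k j D X = FA F (w_in C D k X) \<cdot>\<^bsub>A\<^esub> F2_im C A F k j D X"

definition to_F1_rel ::
  "('o, 'm, 'y) tricategory_scheme \<Rightarrow> ('p, 'n, 'z) precategory_scheme \<Rightarrow> ('o, 'm, 'p, 'n) cfunctor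
    \<Rightarrow> int \<Rightarrow> int \<Rightarrow> ('o, 'm) wchoice \<Rightarrow> 'o \<Rightarrow> 'n \<Rightarrow> bool" where
  "to_F1_rel C A F k j D X u \<longleftrightarrow> factors A (FA F (w_pr C D k X)) (F1_im C A F k j D X) u"

definition to_F1 ::
  "('o, 'm, 'y) tricategory_scheme \<Rightarrow> ('p, 'n, 'z) precategory_scheme \<Rightarrow> ('o, 'm, 'p, 'n) cfunctor
    \<Rightarrow> int \<Rightarrow> int \<Rightarrow> ('o, 'm) wchoice \<Rightarrow> 'o \<Rightarrow> 'n" where
  "to_F1 C A F k j D X = (THE u. to_F1_rel C A F k j D X u)"

text \<open>The connecting transformation \<open>F\<^sub>1 \<rightarrow> F\<^sub>2 \<circ> [1]\<close> is induced by
  \<open>w_le k X \<rightarrow> (w_ge (k + 1) X)[1] \<rightarrow> w_ge k (X[1])\<close>.\<close>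

definition delta_rel ::
  "('o, 'm, 'y) tricategory_scheme \<Rightarrow> ('p, 'n, 'z) precategory_scheme \<Rightarrow> ('o, 'm, 'p, 'n) cfunctor
    \<Rightarrow> int \<Rightarrow> int \<Rightarrow> ('o, 'm) wchoice \<Rightarrow> 'o \<Rightarrow> 'n \<Rightarrow> bool" where
  "delta_rel C A F k j D X v \<longleftrightarrow> (\<exists>u. sh_ext C D k X u \<and>
     factors A (FA F (u \<cdot>\<^bsub>C\<^esub> w_bd C D k X) \<cdot>\<^bsub>A\<^esub> F1_im C A F k j D X)
       (F2_im C A F k j D (sh_ob C 1 X)) v)"

definition delta ::
  "('o, 'm, 'y) tricategory_scheme \<Rightarrow> ('p, 'n, 'z) precategory_scheme \<Rightarrow> ('o, 'm, 'p, 'n) cfunctor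
    \<Rightarrow> int \<Rightarrow> int \<Rightarrow> ('o, 'm) wchoice \<Rightarrow> 'o \<Rightarrow> 'n" where
  "delta C A F k j D X = (THE v. delta_rel C A F k j D X v)"

subsection \<open>Contravariant \<open>F\<close>\<close>

text \<open>For \<open>g : X \<rightarrow> Y\<close> the induced maps go from the image for \<open>Y\<close> and \<open>D'\<close> to the image for \<open>X\<close>
  and \<open>D\<close>.\<close>

definition coF1_rel ::
  "('o, 'm, 'y) tricategory_scheme \<Rightarrow> ('p, 'n, 'z) precategory_scheme \<Rightarrow> ('o, 'm, 'p, 'n) cfunctor
    \<Rightarrow> int \<Rightarrow> int \<Rightarrow> ('o, 'm) wchoice \<Rightarrow> ('o, 'm) wchoice \<Rightarrow> 'm \<Rightarrow> 'n \<Rightarrow> bool" where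
  "coF1_rel C A F k j D D' g u \<longleftrightarrow> (\<exists>b. le_ext C D D' (k + j) g b \<and>
     factors A (FA F b \<cdot>\<^bsub>A\<^esub> F1_im C A F k j D' (Cod C g)) (F1_im C A F k j D (Dom C g)) u)"

definition coF2_rel ::
  "('o, 'm, 'y) tricategory_scheme \<Rightarrow> ('p, 'n, 'z) precategory_scheme \<Rightarrow> ('o, 'm, 'p, 'n) cfunctor
    \<Rightarrow> int \<Rightarrow> int \<Rightarrow> ('o, 'm) wchoice \<Rightarrow> ('o, 'm) wchoice \<Rightarrow> 'm \<Rightarrow> 'n \<Rightarrow> bool" where
  "coF2_rel C A F k j D D' g u \<longleftrightarrow> (\<exists>b. ge_ext C D D' (k + j) g b \<and>
     factors A (FA F b \<cdot>\<^bsub>A\<^esub> F2_im C A F k j D' (Cod C g)) (F2_im C A F k j D (Dom C g)) u)"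

definition coF1_map ::
  "('o, 'm, 'y) tricategory_scheme \<Rightarrow> ('p, 'n, 'z) precategory_scheme \<Rightarrow> ('o, 'm, 'p, 'n) cfunctor
    \<Rightarrow> int \<Rightarrow> int \<Rightarrow> ('o, 'm) wchoice \<Rightarrow> ('o, 'm) wchoice \<Rightarrow> 'm \<Rightarrow> 'n" where
  "coF1_map C A F k j D D' g = (THE u. coF1_rel C A F k j D D' g u)"

definition coF2_map ::
  "('o, 'm, 'y) tricategory_scheme \<Rightarrow> ('p, 'n, 'z) precategory_scheme \<Rightarrow> ('o, 'm, 'p, 'n) cfunctor
    \<Rightarrow> int \<Rightarrow> int \<Rightarrow> ('o, 'm) wchoice \<Rightarrow> ('o, 'm) wchoice \<Rightarrow> 'm \<Rightarrow> 'n" where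
  "coF2_map C A F k j D D' g = (THE u. coF2_rel C A F k j D D' g u)"

definition coF1_fun ::
  "('o, 'm, 'y) tricategory_scheme \<Rightarrow> ('p, 'n, 'z) precategory_scheme \<Rightarrow> ('o, 'm, 'p, 'n) cfunctor
    \<Rightarrow> int \<Rightarrow> int \<Rightarrow> ('o, 'm) wchoice \<Rightarrow> ('o, 'm, 'p, 'n) cfunctor" where
  "coF1_fun C A F k j D =
     \<lparr>FO = \<lambda>X. Dom A (F1_im C A F k j D X), FA = coF1_map C A F k j D D\<rparr>"

definition coF2_fun ::
  "('o, 'm, 'y) tricategory_scheme \<Rightarrow> ('p, 'n, 'z) precategory_scheme \<Rightarrow> ('o, 'm, 'p, 'n) cfunctor
    \<Rightarrow> int \<Rightarrow> int \<Rightarrow> ('o, 'm) wchoice \<Rightarrow> ('o, 'm, 'p, 'n) cfunctor" where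
  "coF2_fun C A F k j D =
     \<lparr>FO = \<lambda>X. Dom A (F2_im C A F k j D X), FA = coF2_map C A F k j D D\<rparr>"

text \<open>The transformations \<open>F\<^sub>1 \<rightarrow> F \<rightarrow> F\<^sub>2\<close>\<close>

definition coF1_to ::
  "('o, 'm, 'y) tricategory_scheme \<Rightarrow> ('p, 'n, 'z) precategory_scheme \<Rightarrow> ('o, 'm, 'p, 'n) cfunctor
    \<Rightarrow> int \<Rightarrow> int \<Rightarrow> ('o, 'm) wchoice \<Rightarrow> 'o \<Rightarrow> 'n" where
  "coF1_to C A F k j D X = FA F (w_pr C D (k + j) X) \<cdot>\<^bsub>A\<^esub> F1_im C A F k j D X"

definition to_coF2_rel ::
  "('o, 'm, 'y) tricategory_scheme \<Rightarrow> ('p, 'n, 'z) precategory_scheme \<Rightarrow> ('o, 'm, 'p, 'n) cfunctor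
    \<Rightarrow> int \<Rightarrow> int \<Rightarrow> ('o, 'm) wchoice \<Rightarrow> 'o \<Rightarrow> 'n \<Rightarrow> bool" where
  "to_coF2_rel C A F k j D X u \<longleftrightarrow> factors A (FA F (w_in C D (k + j) X)) (F2_im C A F k j D X) u"

definition to_coF2 ::
  "('o, 'm, 'y) tricategory_scheme \<Rightarrow> ('p, 'n, 'z) precategory_scheme \<Rightarrow> ('o, 'm, 'p, 'n) cfunctor
    \<Rightarrow> int \<Rightarrow> int \<Rightarrow> ('o, 'm) wchoice \<Rightarrow> 'o \<Rightarrow> 'n" where
  "to_coF2 C A F k j D X = (THE u. to_coF2_rel C A F k j D X u)"

text \<open>The connecting transformation \<open>F\<^sub>2 \<circ> [1] \<rightarrow> F\<^sub>1\<close> is induced by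
  \<open>w_le (k + j) X \<rightarrow> (w_ge (k + j + 1) X)[1] \<rightarrow> w_ge (k + j) (X[1])\<close>.\<close>

definition codelta_rel ::
  "('o, 'm, 'y) tricategory_scheme \<Rightarrow> ('p, 'n, 'z) precategory_scheme \<Rightarrow> ('o, 'm, 'p, 'n) cfunctor
    \<Rightarrow> int \<Rightarrow> int \<Rightarrow> ('o, 'm) wchoice \<Rightarrow> 'o \<Rightarrow> 'n \<Rightarrow> bool" where
  "codelta_rel C A F k j D X v \<longleftrightarrow> (\<exists>u. sh_ext C D (k + j) X u \<and>
     factors A (FA F (u \<cdot>\<^bsub>C\<^esub> w_bd C D (k + j) X) \<cdot>\<^bsub>A\<^esub> F2_im C A F k j D (sh_ob C 1 X))
       (F1_im C A F k j D X) v)"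

definition codelta ::
  "('o, 'm, 'y) tricategory_scheme \<Rightarrow> ('p, 'n, 'z) precategory_scheme \<Rightarrow> ('o, 'm, 'p, 'n) cfunctor
    \<Rightarrow> int \<Rightarrow> int \<Rightarrow> ('o, 'm) wchoice \<Rightarrow> 'o \<Rightarrow> 'n" where
  "codelta C A F k j D X = (THE v. codelta_rel C A F k j D X v)"

end

theory Submission
  imports Defs
begin

text \<open>By orthogonality, a map \<open>X \<rightarrow> Y\<close> extends to \<open>w\<^sub>\<le>\<^sub>k X \<rightarrow> w\<^sub>\<le>\<^sub>k Y\<close>, and any two extensions agree after
  composition with \<open>w\<^sub>\<le>\<^sub>k\<^sub>+\<^sub>j X \<rightarrow> w\<^sub>\<le>\<^sub>k X\<close>; so every extension induces the same map of images, and
  functoriality, independence of the choices and the transformations to and from \<open>F\<close> follow.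
  For \<open>j = 1\<close> and a triangle \<open>X \<rightarrow> Y \<rightarrow> Z\<close>, the map \<open>Z \<rightarrow> V\<close> to the cone of
  \<open>w\<^sub>\<le>\<^sub>k\<^sub>+\<^sub>1 X \<rightarrow> w\<^sub>\<le>\<^sub>k Y\<close> factors through \<open>w\<^sub>\<le>\<^sub>k Z\<close>, so that exactness of \<open>F\<close> at \<open>w\<^sub>\<le>\<^sub>k Y\<close> gives that of
  \<open>F\<^sub>1\<close> at \<open>Y\<close>. The connecting map is induced by \<open>w\<^sub>\<le>\<^sub>k X \<rightarrow> (w\<^sub>\<ge>\<^sub>k\<^sub>+\<^sub>1 X)[1]\<close>. Contravariant functors are functors on
  the opposite category, where the two kinds of image functors trade places.\<close>

section \<open>Categories\<close>

text \<open>The shift of a chosen decomposition of \<open>X\<close> is a decomposition of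
  \<open>X[1]\<close>, but not the chosen one. Images are therefore formed for diagrams built from
  arbitrary pairs of decompositions, and \<open>imap\<close> relates any two diagrams;
  functoriality, independence of the choices and the passage to \<open>X[1]\<close> then become
  instances of one statement. An image map is pinned down twice: by an extension on targets through
  a monomorphism, and by one on sources through an epimorphism that knows nothing of the first. The
  value \<open>j = 1\<close> enters because a shift lowers a weight bound by exactly one: the shift
  of \<open>w_le (k + j) X\<close> has bound \<open>k + j - 1\<close>, which is \<open>k\<close> for
  \<open>j = 1\<close>. Duality is used for categories, functors and diagrams, but
  \<open>opp C\<close> is not made triangulated, so the cone argument for \<open>w_le\<close> has a
  separate counterpart with fibres for \<open>w_ge\<close>.\<close>

lemma in_Hom_iff: "f \<in> Hom C X Y \<longleftrightarrow> f \<in> Ar C \<and> Dom C f = X \<and> Cod C f = Y"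
  by (auto simp: Hom_def)

lemma mono_Ar: "is_mono C m \<Longrightarrow> m \<in> Ar C"
  and epi_Ar: "is_epi C m \<Longrightarrow> m \<in> Ar C"
  by (auto simp: is_mono_def is_epi_def)

lemma mono_cancel:
  "\<lbrakk>is_mono C m; g \<in> Hom C W (Dom C m); h \<in> Hom C W (Dom C m); m \<cdot>\<^bsub>C\<^esub> g = m \<cdot>\<^bsub>C\<^esub> h\<rbrakk> \<Longrightarrow> g = h"
  by (auto simp: is_mono_def)

lemma epi_cancel:
  "\<lbrakk>is_epi C e; g \<in> Hom C (Cod C e) W; h \<in> Hom C (Cod C e) W; g \<cdot>\<^bsub>C\<^esub> e = h \<cdot>\<^bsub>C\<^esub> e\<rbrakk> \<Longrightarrow> g = h"
  by (auto simp: is_epi_def)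

context category
begin

lemma comp_Ar [simp]: "\<lbrakk>f \<in> Ar C; g \<in> Ar C; Cod C f = Dom C g\<rbrakk> \<Longrightarrow> g \<cdot> f \<in> Ar C"
  and Dom_comp [simp]: "\<lbrakk>f \<in> Ar C; g \<in> Ar C; Cod C f = Dom C g\<rbrakk> \<Longrightarrow> Dom C (g \<cdot> f) = Dom C f"
  and Cod_comp [simp]: "\<lbrakk>f \<in> Ar C; g \<in> Ar C; Cod C f = Dom C g\<rbrakk> \<Longrightarrow> Cod C (g \<cdot> f) = Cod C g"
  using Comp_Hom[of f "Dom C f" "Cod C f" g "Cod C g"] by (auto simp: in_Hom_iff)

lemma comp_assoc [simp]:
  "\<lbrakk>f \<in> Ar C; g \<in> Ar C; h \<in> Ar C; Cod C f = Dom C g; Cod C g = Dom C h\<rbrakk>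
    \<Longrightarrow> (h \<cdot> g) \<cdot> f = h \<cdot> (g \<cdot> f)"
  using Comp_assoc[of f "Dom C f" "Cod C f" g "Cod C g" h "Cod C h"] by (auto simp: in_Hom_iff)

lemma Ident_Ar [simp]: "X \<in> Ob C \<Longrightarrow> Ident C X \<in> Ar C"
  and Dom_Ident [simp]: "X \<in> Ob C \<Longrightarrow> Dom C (Ident C X) = X"
  and Cod_Ident [simp]: "X \<in> Ob C \<Longrightarrow> Cod C (Ident C X) = X"
  using Id_Hom[of X] by (auto simp: in_Hom_iff)

lemma comp_Ident_right [simp]: "\<lbrakk>f \<in> Ar C; Dom C f = X\<rbrakk> \<Longrightarrow> f \<cdot> Ident C X = f"
  and comp_Ident_left [simp]: "\<lbrakk>f \<in> Ar C; Cod C f = X\<rbrakk> \<Longrightarrow> Ident C X \<cdot> f = f"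
  using Comp_Id_right[of f X "Cod C f"] Comp_Id_left[of f "Dom C f" X] by (auto simp: in_Hom_iff)

lemma Dom_in_Ob [simp]: "f \<in> Ar C \<Longrightarrow> Dom C f \<in> Ob C"
  and Cod_in_Ob [simp]: "f \<in> Ar C \<Longrightarrow> Cod C f \<in> Ob C"
  by (rule Dom_Ob Cod_Ob; assumption)+

lemma Hom_Ob:
  assumes "f \<in> Hom C X Y" shows "X \<in> Ob C" "Y \<in> Ob C"
  using assms by (auto simp: in_Hom_iff)

text \<open>The simplifier brackets composites to the right, so an equation about a composite of two
  arrows does not match inside a longer one. This form and \<open>comp_square\<close> apply it in
  front of a tail \<open>x\<close>.\<close>

lemma comp_reduce:
  "\<lbrakk>g \<cdot> f = h; f \<in> Ar C; g \<in> Ar C; Cod C f = Dom C g; x \<in> Ar C; Cod C x = Dom C f\<rbrakk>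
    \<Longrightarrow> g \<cdot> (f \<cdot> x) = h \<cdot> x"
  using comp_assoc[of x f g] by simp

lemma comp_square:
  "\<lbrakk>g \<cdot> f = g' \<cdot> f'; f \<in> Ar C; g \<in> Ar C; Cod C f = Dom C g; f' \<in> Ar C; g' \<in> Ar C; Cod C f' = Dom C g';
    x \<in> Ar C; Cod C x = Dom C f; Cod C x = Dom C f'\<rbrakk>
    \<Longrightarrow> g \<cdot> (f \<cdot> x) = g' \<cdot> (f' \<cdot> x)"
  using comp_assoc[of x f g] comp_assoc[of x f' g'] by simp

lemma mono_comp: "\<lbrakk>is_mono C m; is_mono C n; Cod C n = Dom C m\<rbrakk> \<Longrightarrow> is_mono C (m \<cdot> n)"
  unfolding is_mono_def by (clarsimp simp: in_Hom_iff)

lemma mono_cancel_right: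
  "\<lbrakk>is_mono C (m \<cdot> n); n \<in> Ar C; m \<in> Ar C; Cod C n = Dom C m\<rbrakk> \<Longrightarrow> is_mono C n"
  unfolding is_mono_def by (clarsimp simp: in_Hom_iff)

lemma mono_Ident: "X \<in> Ob C \<Longrightarrow> is_mono C (Ident C X)"
  by (auto simp: is_mono_def in_Hom_iff)

end

section \<open>Preadditive categories\<close>

context preadditive_category
begin

lemma Zer_Ar [simp]: "\<lbrakk>X \<in> Ob C; Y \<in> Ob C\<rbrakk> \<Longrightarrow> Zer C X Y \<in> Ar C"
  and Dom_Zer [simp]: "\<lbrakk>X \<in> Ob C; Y \<in> Ob C\<rbrakk> \<Longrightarrow> Dom C (Zer C X Y) = X"
  and Cod_Zer [simp]: "\<lbrakk>X \<in> Ob C; Y \<in> Ob C\<rbrakk> \<Longrightarrow> Cod C (Zer C X Y) = Y"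
proof -
  assume *: "X \<in> Ob C" "Y \<in> Ob C"
  interpret comm_group "hom_group C X Y" using hom_comm_group * .
  have "Zer C X Y \<in> Hom C X Y" using one_closed by (simp add: hom_group_def)
  then show "Zer C X Y \<in> Ar C" "Dom C (Zer C X Y) = X" "Cod C (Zer C X Y) = Y"
    by (auto simp: in_Hom_iff)
qed

context
  fixes f g X Y assumes f: "f \<in> Hom C X Y" and g: "g \<in> Hom C X Y"
begin

interpretation H: comm_group "hom_group C X Y"
  using hom_comm_group f by (auto simp: in_Hom_iff)

lemma Add_Hom: "f \<oplus> g \<in> Hom C X Y"
  using H.m_closed[of f g] f g by (simp add: hom_group_def)

lemma neg_Hom: "neg C f \<in> Hom C X Y"
  using H.inv_closed[of f] f by (auto simp: hom_group_def in_Hom_iff neg_def)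

lemma Add_neg: "f \<oplus> neg C f = Zer C X Y"
  using H.r_inv[of f] f by (auto simp: hom_group_def in_Hom_iff neg_def)

lemma Add_idem_Zer: "f \<oplus> f = f \<Longrightarrow> f = Zer C X Y"
  using H.l_cancel_one[of f f] f by (auto simp: hom_group_def)

lemma neg_unique: "f \<oplus> g = Zer C X Y \<Longrightarrow> g = neg C f"
  using H.inv_unique'[of f g] f g H.m_comm[of f g] by (auto simp: hom_group_def in_Hom_iff neg_def)

lemma Add_Zer: "f \<oplus> Zer C X Y = f"
  using H.r_one[of f] f by (auto simp: hom_group_def)

lemma neg_neg': "neg C (neg C f) = f"
  using H.inv_inv[of f] f neg_Hom by (auto simp: hom_group_def in_Hom_iff neg_def)

lemma diff_Zer: "f \<oplus> neg C g = Zer C X Y \<Longrightarrow> f = g"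
proof -
  assume *: "f \<oplus> neg C g = Zer C X Y"
  have "g = inv\<^bsub>hom_group C X Y\<^esub> (neg C g)" "neg C g \<in> carrier (hom_group C X Y)"
    using H.inv_inv[of g] H.inv_closed[of g] g by (auto simp: hom_group_def in_Hom_iff neg_def)
  then show ?thesis using * f H.inv_equality[of f "neg C g"] by (auto simp: hom_group_def)
qed

end

lemma Add_simps [simp]:
  assumes "f \<in> Ar C" "g \<in> Ar C" "Dom C f = Dom C g" "Cod C f = Cod C g"
  shows "f \<oplus> g \<in> Ar C" "Dom C (f \<oplus> g) = Dom C g" "Cod C (f \<oplus> g) = Cod C g"
  using Add_Hom[of f "Dom C g" "Cod C g" g] assms by (auto simp: in_Hom_iff)

lemma neg_simps [simp]:
  assumes "f \<in> Ar C"
  shows "neg C f \<in> Ar C" "Dom C (neg C f) = Dom C f" "Cod C (neg C f) = Cod C f" "neg C (neg C f) = f"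
  using neg_Hom[of f "Dom C f" "Cod C f" f] neg_neg'[of f "Dom C f" "Cod C f" f] assms
  by (auto simp: in_Hom_iff)

lemma Add_neg_Zer [simp]: "f \<in> Ar C \<Longrightarrow> f \<oplus> neg C f = Zer C (Dom C f) (Cod C f)"
  using Add_neg[of f "Dom C f" "Cod C f" f] by (simp add: in_Hom_iff)

lemma Add_Zer_right [simp]: "\<lbrakk>f \<in> Ar C; Dom C f = X; Cod C f = Y\<rbrakk> \<Longrightarrow> f \<oplus> Zer C X Y = f"
  using Add_Zer[of f X Y f] by (simp add: in_Hom_iff)

lemma comp_Zer [simp]:
  assumes "X \<in> Ob C" "g \<in> Ar C" "Dom C g = Y"
  shows "g \<cdot> Zer C X Y = Zer C X (Cod C g)"
proof -
  have Y: "Y \<in> Ob C" using assms by auto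
  have z: "Zer C X Y \<in> Hom C X Y" "g \<in> Hom C Y (Cod C g)" using assms Y by (auto simp: in_Hom_iff)
  have "g \<cdot> Zer C X Y \<oplus> g \<cdot> Zer C X Y = g \<cdot> Zer C X Y"
    using Comp_Add_right[OF z(1) z] Add_Zer[OF z(1) z(1)] by simp
  then show ?thesis using Add_idem_Zer[of "g \<cdot> Zer C X Y" X "Cod C g" "g \<cdot> Zer C X Y"] assms Y by (auto simp: in_Hom_iff)
qed

lemma comp_Add:
  assumes "f \<in> Ar C" "f' \<in> Ar C" "Dom C f = Dom C f'" "Cod C f = Cod C f'" "g \<in> Ar C" "Dom C g = Cod C f'"
  shows "g \<cdot> (f \<oplus> f') = g \<cdot> f \<oplus> g \<cdot> f'"
  using Comp_Add_right[of f "Dom C f" "Cod C f" f' g "Cod C g"] assms by (auto simp: in_Hom_iff)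

lemma comp_neg [simp]:
  assumes "f \<in> Ar C" "g \<in> Ar C" "Dom C g = Cod C f"
  shows "g \<cdot> neg C f = neg C (g \<cdot> f)"
  by (rule neg_unique[of _ "Dom C f" "Cod C g"])
    (use comp_Add[of f "neg C f" g] assms in \<open>simp_all add: in_Hom_iff\<close>)

lemma neg_Zer [simp]:
  assumes "X \<in> Ob C" "Y \<in> Ob C" shows "neg C (Zer C X Y) = Zer C X Y"
  by (rule neg_unique[of _ X Y, symmetric]) (use assms in \<open>simp_all add: in_Hom_iff\<close>)

lemma neg_eq_iff: "\<lbrakk>f \<in> Ar C; g \<in> Ar C\<rbrakk> \<Longrightarrow> neg C f = neg C g \<longleftrightarrow> f = g"
  using neg_simps(4) by metis

lemma neg_eq_Zer:
  "\<lbrakk>f \<in> Ar C; neg C f = Zer C X Y; X \<in> Ob C; Y \<in> Ob C\<rbrakk> \<Longrightarrow> f = Zer C X Y"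
  using neg_simps(4) neg_Zer by metis

end

subsection \<open>Duality\<close>

lemma opp_simps [simp]:
  "Ob (opp C) = Ob C" "Ar (opp C) = Ar C" "Dom (opp C) = Cod C" "Cod (opp C) = Dom C"
  "Ident (opp C) = Ident C" "g \<cdot>\<^bsub>opp C\<^esub> f = f \<cdot>\<^bsub>C\<^esub> g" "Zer (opp C) X Y = Zer C Y X"
  "f \<oplus>\<^bsub>opp C\<^esub> g = f \<oplus>\<^bsub>C\<^esub> g"
  by (simp_all add: opp_def)

lemma Hom_opp [simp]: "Hom (opp C) X Y = Hom C Y X"
  by (auto simp: Hom_def)

lemma hom_group_opp [simp]: "hom_group (opp C) X Y = hom_group C Y X"
  by (auto simp: hom_group_def fun_eq_iff)

lemma neg_opp [simp]: "neg (opp C) f = neg C f"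
  by (simp add: neg_def)

lemma mono_epi_opp [simp]: "is_mono (opp C) f = is_epi C f" "is_epi (opp C) f = is_mono C f"
  by (auto simp: is_mono_def is_epi_def)

lemma kernel_opp [simp]: "is_kernel (opp C) f m = is_cokernel C f m" "is_cokernel (opp C) f m = is_kernel C f m"
  by (auto simp: is_kernel_def is_cokernel_def)

lemma (in preadditive_category) category_opp: "category (opp C)"
  by unfold_locales (auto simp: in_Hom_iff)

lemma (in preadditive_category) preadditive_opp: "preadditive_category (opp C)"
  by (intro preadditive_category.intro category_opp preadditive_category_axioms.intro)
    (auto simp: hom_comm_group Comp_Add_left Comp_Add_right)

context preadditive_category
begin

interpretation opp: preadditive_category "opp C"
  by (rule preadditive_opp)

lemmas Zer_comp [simp] = opp.comp_Zer[simplified]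
  and Add_comp = opp.comp_Add[simplified]
  and neg_comp [simp] = opp.comp_neg[simplified]

end

subsection \<open>Kernels and cokernels\<close>

context preadditive_category
begin

lemma mono_iff_Zer:
  assumes "m \<in> Ar C"
    and "\<And>W h. \<lbrakk>h \<in> Hom C W (Dom C m); m \<cdot> h = Zer C W (Cod C m)\<rbrakk> \<Longrightarrow> h = Zer C W (Dom C m)"
  shows "is_mono C m"
  unfolding is_mono_def
proof (intro conjI allI impI assms(1))
  fix W g h assume gh: "g \<in> Hom C W (Dom C m)" "h \<in> Hom C W (Dom C m)" and eq: "m \<cdot> g = m \<cdot> h"
  have A: "g \<in> Ar C" "h \<in> Ar C" "Dom C g = W" "Dom C h = W" "Cod C g = Dom C m" "Cod C h = Dom C m"
    "W \<in> Ob C" using gh by (auto simp: in_Hom_iff)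
  have "m \<cdot> (g \<oplus> neg C h) = Zer C W (Cod C m)"
    using A assms(1) eq by (simp add: comp_Add)
  then have "g \<oplus> neg C h = Zer C W (Dom C m)" by (rule assms(2)[rotated]) (use A in \<open>simp add: in_Hom_iff\<close>)
  then show "g = h" by (rule diff_Zer[OF gh])
qed

lemma mono_Zer:
  assumes "is_mono C m" "h \<in> Hom C W (Dom C m)" "m \<cdot> h = Zer C W (Cod C m)"
  shows "h = Zer C W (Dom C m)"
proof (rule mono_cancel[OF assms(1,2)])
  show "Zer C W (Dom C m) \<in> Hom C W (Dom C m)" "m \<cdot> h = m \<cdot> Zer C W (Dom C m)"
    using assms(2,3) mono_Ar[OF assms(1)] Hom_Ob[OF assms(2)] by (simp_all add: in_Hom_iff)
qed

lemma kernel_mono: "is_kernel C f m \<Longrightarrow> is_mono C m"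
proof (rule mono_iff_Zer)
  assume m: "is_kernel C f m"
  then show mA: "m \<in> Ar C" by (simp add: is_kernel_def)
  fix W h assume h: "h \<in> Hom C W (Dom C m)" "m \<cdot> h = Zer C W (Cod C m)"
  have fA: "f \<in> Ar C" "Cod C m = Dom C f" using m by (auto simp: is_kernel_def)
  have z: "Zer C W (Dom C f) \<in> Hom C W (Dom C f)" "f \<cdot> Zer C W (Dom C f) = Zer C W (Cod C f)"
    using h fA by (auto simp: in_Hom_iff)
  then obtain u where "\<And>v. \<lbrakk>v \<in> Hom C W (Dom C m); m \<cdot> v = Zer C W (Dom C f)\<rbrakk> \<Longrightarrow> v = u"
    using m unfolding is_kernel_def by meson
  moreover have "Zer C W (Dom C m) \<in> Hom C W (Dom C m)" "m \<cdot> Zer C W (Dom C m) = Zer C W (Dom C f)"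
    using h mA fA by (auto simp: in_Hom_iff)
  ultimately show "h = Zer C W (Dom C m)" using h fA by metis
qed

lemma kernel_factor:
  assumes "is_kernel C f m" "h \<in> Ar C" "Cod C h = Dom C f" "f \<cdot> h = Zer C (Dom C h) (Cod C f)"
  obtains u where "u \<in> Hom C (Dom C h) (Dom C m)" "m \<cdot> u = h"
  using assms unfolding is_kernel_def by (metis in_Hom_iff)

lemma kernelI:
  assumes "is_mono C m" "f \<in> Ar C" "Cod C m = Dom C f" "f \<cdot> m = Zer C (Dom C m) (Cod C f)"
    and "\<And>h. \<lbrakk>h \<in> Ar C; Cod C h = Dom C f; f \<cdot> h = Zer C (Dom C h) (Cod C f)\<rbrakk>
      \<Longrightarrow> \<exists>u. u \<in> Hom C (Dom C h) (Dom C m) \<and> m \<cdot> u = h"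
  shows "is_kernel C f m"
  unfolding is_kernel_def
proof (intro conjI allI ballI impI)
  fix W h assume "h \<in> Hom C W (Dom C f)" "f \<cdot> h = Zer C W (Cod C f)"
  then obtain u where "u \<in> Hom C W (Dom C m) \<and> m \<cdot> u = h" using assms(5)[of h] by (auto simp: in_Hom_iff)
  then show "\<exists>!u. u \<in> Hom C W (Dom C m) \<and> m \<cdot> u = h" using mono_cancel[OF assms(1)] by blast
qed (use assms in \<open>auto simp: mono_Ar\<close>)

end

context preadditive_category
begin

interpretation opp: preadditive_category "opp C"
  by (rule preadditive_opp)

lemmas epi_comp = opp.mono_comp[simplified]
  and epi_cancel_left = opp.mono_cancel_right[simplified]
  and epi_Ident = opp.mono_Ident[simplified]
  and epi_iff_Zer = opp.mono_iff_Zer[simplified]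
  and epi_Zer = opp.mono_Zer[simplified]
  and cokernel_epi = opp.kernel_mono[simplified]
  and cokernel_factor = opp.kernel_factor[simplified]
  and cokernelI = opp.kernelI[simplified]

end

section \<open>Exactness in abelian categories\<close>

text \<open>The axioms on which the exactness arguments rest. The list is symmetric under reversal
  of arrows, so \<open>opp\<close> of such a category is one again and each lemma below has a dual
  at no cost.\<close>

locale normal_category = preadditive_category +
  assumes ex_ker: "f \<in> Ar C \<Longrightarrow> \<exists>m. is_kernel C f m"
    and ex_coker: "f \<in> Ar C \<Longrightarrow> \<exists>q. is_cokernel C f q"
    and mono_ker: "is_mono C m \<Longrightarrow> \<exists>f. is_kernel C f m"
    and epi_coker: "is_epi C q \<Longrightarrow> \<exists>f. is_cokernel C f q"

sublocale abelian_category \<subseteq> normal_category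
  by unfold_locales (rule ex_kernel ex_cokernel mono_normal epi_normal; assumption)+

lemma (in normal_category) normal_opp: "normal_category (opp C)"
  by (intro normal_category.intro preadditive_opp normal_category_axioms.intro)
    (auto intro: ex_ker ex_coker mono_ker epi_coker)

context normal_category
begin

lemma image_mono: "is_image C f m \<Longrightarrow> is_mono C m"
  by (auto simp: is_image_def intro: kernel_mono)

lemma image_Cod: "is_image C f m \<Longrightarrow> Cod C m = Cod C f"
  by (auto simp: is_image_def is_kernel_def is_cokernel_def)

lemma ex_image: "f \<in> Ar C \<Longrightarrow> \<exists>m. is_image C f m"
  unfolding is_image_def by (meson ex_coker ex_ker is_cokernel_def)

lemma image_incl: "f \<in> Ar C \<Longrightarrow> is_image C f (image_incl C f)"
  unfolding image_incl_def by (rule someI_ex) (rule ex_image)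

text \<open>\<open>e\<close> is epi because \<open>m\<close> is the least subobject through which
  \<open>f\<close> passes. If \<open>r \<cdot> e = 0\<close>, then \<open>f\<close> passes through
  \<open>m \<cdot> k\<close> with \<open>k\<close> the kernel of \<open>r\<close>. This monomorphism
  is the kernel of some \<open>s\<close>, which kills \<open>f\<close>, hence factors through
  \<open>q\<close> and kills \<open>m\<close>. So \<open>m\<close> passes through
  \<open>m \<cdot> k\<close>, which splits \<open>k\<close> and gives \<open>r = 0\<close>.\<close>

lemma image_factor:
  assumes "is_image C f m"
  obtains e where "e \<in> Hom C (Dom C f) (Dom C m)" "m \<cdot> e = f" "is_epi C e"
proof -
  obtain q where q: "is_cokernel C f q" "is_kernel C q m" using assms by (auto simp: is_image_def)
  have fA: "f \<in> Ar C" "q \<in> Ar C" "m \<in> Ar C" "Dom C q = Cod C f" "Cod C m = Cod C f"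
    "q \<cdot> f = Zer C (Dom C f) (Cod C q)" "q \<cdot> m = Zer C (Dom C m) (Cod C q)"
    using q by (auto simp: is_cokernel_def is_kernel_def)
  obtain e where e: "e \<in> Hom C (Dom C f) (Dom C m)" "m \<cdot> e = f"
    using kernel_factor[OF q(2), of f] fA by auto
  note mm = kernel_mono[OF q(2)]
  have eA: "e \<in> Ar C" "Dom C e = Dom C f" "Cod C e = Dom C m" using e by (auto simp: in_Hom_iff)
  have "is_epi C e"
  proof (rule epi_iff_Zer[OF eA(1)])
    fix W r assume r: "r \<in> Hom C (Cod C e) W" "r \<cdot> e = Zer C (Dom C e) W"
    then have rA: "r \<in> Ar C" "Dom C r = Dom C m" "Cod C r = W" using eA by (auto simp: in_Hom_iff)
    obtain k where k: "is_kernel C r k" using ex_ker rA by blast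
    have kA: "k \<in> Ar C" "Cod C k = Dom C m" "r \<cdot> k = Zer C (Dom C k) W" "is_mono C k"
      using k rA kernel_mono[OF k] by (auto simp: is_kernel_def)
    obtain e' where e': "e' \<in> Hom C (Dom C e) (Dom C k)" "k \<cdot> e' = e"
      using kernel_factor[OF k, of e] eA rA r by auto
    have "is_mono C (m \<cdot> k)" using mono_comp mm kA by auto
    then obtain s where s: "is_kernel C s (m \<cdot> k)" using mono_ker by blast
    have sA: "s \<in> Ar C" "Dom C s = Cod C m" "s \<cdot> (m \<cdot> k) = Zer C (Dom C k) (Cod C s)"
      using s kA fA by (auto simp: is_kernel_def)
    have "s \<cdot> f = s \<cdot> (m \<cdot> k) \<cdot> e'" using e' e kA fA by (auto simp: in_Hom_iff)
    also have "\<dots> = Zer C (Dom C k) (Cod C s) \<cdot> e'"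
      by (rule comp_reduce[OF sA(3)]) (use sA(1,2) kA(1,2) fA e' in \<open>auto simp: in_Hom_iff\<close>)
    also have "\<dots> = Zer C (Dom C f) (Cod C s)" using sA kA e' eA by (auto simp: in_Hom_iff)
    finally obtain s' where s': "s' \<in> Hom C (Cod C q) (Cod C s)" "s' \<cdot> q = s"
      using cokernel_factor[OF q(1), of s] sA fA by auto
    have "s \<cdot> m = s' \<cdot> (q \<cdot> m)" using s' fA by (auto simp: in_Hom_iff)
    also have "\<dots> = Zer C (Dom C m) (Cod C s)" using s' fA by (auto simp: in_Hom_iff)
    finally obtain n where n: "n \<in> Hom C (Dom C m) (Dom C k)" "(m \<cdot> k) \<cdot> n = m"
      using kernel_factor[OF s, of m] sA fA kA by auto
    have "k \<cdot> n = Ident C (Dom C m)"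
      by (rule mono_cancel[OF mm, of _ "Dom C m"]) (use n kA fA in \<open>auto simp: in_Hom_iff\<close>)
    then have "r = r \<cdot> (k \<cdot> n)" using rA by auto
    also have "\<dots> = (r \<cdot> k) \<cdot> n" using rA kA(1,2) n by (simp add: in_Hom_iff)
    also have "\<dots> = Zer C (Cod C e) W" using kA n rA eA by (auto simp: in_Hom_iff)
    finally show "r = Zer C (Cod C e) W" .
  qed
  then show thesis using that e by blast
qed

text \<open>\<open>n\<close> is the kernel of some \<open>s\<close>; since \<open>s\<close> kills
  \<open>f\<close>, and \<open>f\<close> reaches \<open>m\<close> by an epimorphism,
  \<open>s\<close> kills \<open>m\<close>.\<close>

lemma image_least:
  assumes "is_image C f m" "is_mono C n" "e \<in> Ar C" "Cod C e = Dom C n" "n \<cdot> e = f"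
  obtains y where "y \<in> Hom C (Dom C m) (Dom C n)" "n \<cdot> y = m"
proof -
  obtain s where s: "is_kernel C s n" using mono_ker assms(2) by blast
  obtain d where d: "d \<in> Hom C (Dom C f) (Dom C m)" "m \<cdot> d = f" "is_epi C d" using image_factor[OF assms(1)] .
  have nA: "n \<in> Ar C" "s \<in> Ar C" "Dom C s = Cod C n" "s \<cdot> n = Zer C (Dom C n) (Cod C s)"
    using s by (auto simp: is_kernel_def)
  have mA: "m \<in> Ar C" "Cod C m = Cod C n"
    using image_mono[OF assms(1)] image_Cod[OF assms(1)] assms nA by (auto simp: mono_Ar)
  have de: "Dom C d = Dom C e" using d(1) Dom_comp[of e n] assms nA by (simp add: in_Hom_iff)
  have "s \<cdot> m = Zer C (Dom C m) (Cod C s)"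
  proof (rule epi_cancel[OF d(3)])
    have "(s \<cdot> m) \<cdot> d = s \<cdot> (n \<cdot> e)" using d mA nA assms(5) by (auto simp: in_Hom_iff)
    also have "\<dots> = (s \<cdot> n) \<cdot> e" using assms nA(1-3) by simp
    also have "\<dots> = Zer C (Dom C e) (Cod C s)" using assms nA by simp
    finally show "(s \<cdot> m) \<cdot> d = Zer C (Dom C m) (Cod C s) \<cdot> d"
      using d mA nA de by (auto simp: in_Hom_iff)
  qed (use d mA nA in \<open>auto simp: in_Hom_iff\<close>)
  then show thesis using kernel_factor[OF s, of m] mA nA that by auto
qed

section \<open>Exact pairs and their transfer to images\<close>

lemma exact_comp_Zer:
  assumes "exact C f g"
  shows "f \<in> Ar C" "g \<in> Ar C" "Cod C f = Dom C g" "g \<cdot> f = Zer C (Dom C f) (Cod C g)"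
proof -
  obtain m where m: "is_image C f m" "is_kernel C g m" using assms by (auto simp: exact_def)
  show f: "f \<in> Ar C" "g \<in> Ar C" "Cod C f = Dom C g" using m by (auto simp: is_image_def is_kernel_def is_cokernel_def)
  obtain e where e: "e \<in> Hom C (Dom C f) (Dom C m)" "m \<cdot> e = f" "is_epi C e" using image_factor[OF m(1)] .
  have mA: "m \<in> Ar C" "Cod C m = Dom C g" "g \<cdot> m = Zer C (Dom C m) (Cod C g)" using m by (auto simp: is_kernel_def)
  have "g \<cdot> f = (g \<cdot> m) \<cdot> e" using e mA(1,2) f by (auto simp: in_Hom_iff)
  then show "g \<cdot> f = Zer C (Dom C f) (Cod C g)" using e mA f by (auto simp: in_Hom_iff)
qed

text \<open>Makes exactness self-dual: \<open>exact\<close> matches the kernel of \<open>g\<close>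
  with the kernel of the cokernel of \<open>f\<close>, while on \<open>opp C\<close> it matches the
  cokernel of \<open>f\<close> with the cokernel of the kernel of \<open>g\<close>.\<close>

lemma cokernel_image_swap:
  assumes q: "is_cokernel C f q" and m: "is_kernel C q m" shows "is_cokernel C m q"
proof (rule cokernelI)
  show "is_epi C q" using q by (rule cokernel_epi)
  have A: "f \<in> Ar C" "q \<in> Ar C" "m \<in> Ar C" "Dom C q = Cod C f" "Cod C m = Cod C f"
    using q m by (auto simp: is_cokernel_def is_kernel_def)
  then show "m \<in> Ar C" "Dom C q = Cod C m" "q \<cdot> m = Zer C (Dom C m) (Cod C q)"
    using m by (auto simp: is_kernel_def)
  fix h assume h: "h \<in> Ar C" "Dom C h = Cod C m" "h \<cdot> m = Zer C (Dom C m) (Cod C h)"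
  obtain e where e: "e \<in> Hom C (Dom C f) (Dom C m)" "m \<cdot> e = f" "is_epi C e"
    using image_factor[of f m] q m by (auto simp: is_image_def)
  have "h \<cdot> f = (h \<cdot> m) \<cdot> e" using e h(1,2) A by (auto simp: in_Hom_iff)
  then have "h \<cdot> f = Zer C (Dom C f) (Cod C h)" using e h A by (auto simp: in_Hom_iff)
  then show "\<exists>u. u \<in> Hom C (Cod C q) (Cod C h) \<and> u \<cdot> q = h"
    using cokernel_factor[OF q, of h] h A by metis
qed

lemma kernel_coimage_swap:
  assumes "is_kernel C f m" "is_cokernel C m q" shows "is_kernel C q m"
proof -
  interpret O: normal_category "opp C" by (rule normal_opp)
  show ?thesis using O.cokernel_image_swap[of f m q] assms by simp
qed

lemma exact_opp: "exact (opp C) g f \<longleftrightarrow> exact C f g"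
  unfolding exact_def is_image_def kernel_opp
  using cokernel_image_swap kernel_coimage_swap by blast

text \<open>Here \<open>u\<close> is what remains of \<open>c\<close> after stripping off an
  epimorphism in front and a monomorphism behind. If \<open>u'\<close> kills \<open>h\<close>, then
  \<open>v\<close> kills \<open>m \<cdot> h\<close> by the relation with \<open>s\<close>, so
  \<open>m \<cdot> h\<close> lies in the image of \<open>c\<close>. That image lies in
  \<open>m \<cdot> n\<close> with \<open>n\<close> the image of \<open>u\<close>, and cancelling
  \<open>m\<close> puts \<open>h\<close> into \<open>n\<close>.\<close>

lemma exact_under:
  assumes c: "exact C c v" and m: "is_mono C m" and e: "is_epi C e"
    and u: "u \<in> Hom C (Cod C e) (Dom C m)" "m \<cdot> (u \<cdot> e) = c"
    and u': "u' \<in> Ar C" "Dom C u' = Cod C u" "u' \<cdot> u = Zer C (Dom C u) (Cod C u')"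
    and s: "s \<in> Ar C" "Dom C s = Cod C u'" "s \<cdot> u' = v \<cdot> m"
  shows "exact C u u'"
proof -
  have A: "m \<in> Ar C" "e \<in> Ar C" using m e by (auto simp: mono_Ar epi_Ar)
  have uA: "u \<in> Ar C" "Dom C u = Cod C e" "Cod C u = Dom C m" using u by (auto simp: in_Hom_iff)
  obtain i where i: "is_image C c i" "is_kernel C v i" using c by (auto simp: exact_def)
  have vA: "v \<in> Ar C" "Dom C v = Cod C m"
    using exact_comp_Zer[OF c] u(2)[symmetric] A uA by auto
  obtain n where n: "is_image C u n" using ex_image uA by blast
  obtain d where d: "d \<in> Hom C (Dom C u) (Dom C n)" "n \<cdot> d = u" "is_epi C d" using image_factor[OF n] .
  have nA: "n \<in> Ar C" "Cod C n = Cod C u" "is_mono C n"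
    using image_mono[OF n] image_Cod[OF n] by (auto simp: mono_Ar)
  have "is_kernel C u' n"
  proof (rule kernelI)
    show "u' \<cdot> n = Zer C (Dom C n) (Cod C u')"
      by (rule epi_cancel[OF d(3), of _ "Cod C u'"]) (use d nA u' uA A in \<open>auto simp: in_Hom_iff\<close>)
    fix h assume h: "h \<in> Ar C" "Cod C h = Dom C u'" "u' \<cdot> h = Zer C (Dom C h) (Cod C u')"
    have "v \<cdot> (m \<cdot> h) = s \<cdot> (u' \<cdot> h)"
      by (rule comp_square) (use A vA h uA u' s in auto)
    also have "\<dots> = Zer C (Dom C h) (Cod C s)" using h s by simp
    also have "Cod C s = Cod C v" using s(3) s(1,2) u' A vA by (metis Cod_comp)
    finally obtain x where x: "x \<in> Hom C (Dom C h) (Dom C i)" "i \<cdot> x = m \<cdot> h"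
      using kernel_factor[OF i(2), of "m \<cdot> h"] A h uA u' vA by auto
    have "is_mono C (m \<cdot> n)" using mono_comp m nA uA by auto
    moreover have "(m \<cdot> n) \<cdot> (d \<cdot> e) = c" using u(2) d nA uA A
      by (auto simp: in_Hom_iff comp_reduce[of n d u])
    ultimately obtain y where y: "y \<in> Hom C (Dom C i) (Dom C (m \<cdot> n))" "(m \<cdot> n) \<cdot> y = i"
      using image_least[OF i(1), of "m \<cdot> n" "d \<cdot> e"] d A nA uA by (auto simp: in_Hom_iff)
    have yA: "y \<in> Ar C" "Dom C y = Dom C i" "Cod C y = Dom C n" "x \<in> Ar C" "Cod C x = Dom C i" "Dom C x = Dom C h"
      using y x nA uA A by (auto simp: in_Hom_iff)
    have "n \<cdot> (y \<cdot> x) = h"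
    proof (rule mono_cancel[OF m, of _ "Dom C h"])
      have "m \<cdot> (n \<cdot> (y \<cdot> x)) = ((m \<cdot> n) \<cdot> y) \<cdot> x"
        using yA A nA uA by simp
      then show "m \<cdot> (n \<cdot> (y \<cdot> x)) = m \<cdot> h" using y(2) x(2) by simp
    qed (use yA nA uA h u' in \<open>auto simp: in_Hom_iff\<close>)
    then show "\<exists>u. u \<in> Hom C (Dom C h) (Dom C n) \<and> n \<cdot> u = h" using yA by (auto simp: in_Hom_iff intro!: exI[of _ "y \<cdot> x"])
  qed (use nA u' uA in auto)
  then show ?thesis using n by (auto simp: exact_def)
qed

lemma exact_over:
  assumes "exact C v c" and "is_mono C m" and "is_epi C e"
    and "u' \<in> Hom C (Cod C e) (Dom C m)" "m \<cdot> (u' \<cdot> e) = c"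
    and "u \<in> Ar C" "Cod C u = Dom C u'" "u' \<cdot> u = Zer C (Dom C u) (Cod C u')"
    and "s \<in> Ar C" "Cod C s = Dom C u" "u \<cdot> s = e \<cdot> v"
  shows "exact C u u'"
proof -
  interpret O: normal_category "opp C" by (rule normal_opp)
  have A: "m \<in> Ar C" "e \<in> Ar C" using assms by (auto simp: mono_Ar epi_Ar)
  have "exact (opp C) u' u"
    by (rule O.exact_under[of c v e m _ _ s]) (use assms A in \<open>auto simp: exact_opp in_Hom_iff\<close>)
  then show ?thesis by (simp add: exact_opp)
qed

text \<open>An epimorphism in front of \<open>a\<close> does not change its image, and a
  monomorphism behind \<open>b\<close> does not change its kernel.\<close>

lemma exact_mono_epi:
  assumes "exact C (a \<cdot> e) (m \<cdot> b)" "is_mono C m" "is_epi C e"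
    "a \<in> Ar C" "b \<in> Ar C" "Dom C a = Cod C e" "Cod C b = Dom C m" "Cod C a = Dom C b"
  shows "exact C a b"
proof (rule exact_under[OF assms(1) mono_Ident[of "Cod C a"] assms(3)])
  have A: "m \<in> Ar C" "e \<in> Ar C" using assms by (auto simp: mono_Ar epi_Ar)
  show "b \<cdot> a = Zer C (Dom C a) (Cod C b)"
    by (rule epi_cancel[OF assms(3), of _ "Cod C b"], use assms A in \<open>auto simp: in_Hom_iff\<close>)
      (rule mono_cancel[OF assms(2), of _ "Dom C e"],
        use assms A exact_comp_Zer[OF assms(1)] in \<open>auto simp: in_Hom_iff\<close>)
qed (use assms in \<open>auto simp: in_Hom_iff mono_Ar epi_Ar\<close>)

lemma kernel_neg:
  assumes "is_kernel C f m" shows "is_kernel C (neg C f) m"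
proof (rule kernelI)
  have A: "f \<in> Ar C" "m \<in> Ar C" "Cod C m = Dom C f" "f \<cdot> m = Zer C (Dom C m) (Cod C f)"
    using assms by (auto simp: is_kernel_def)
  then show "neg C f \<in> Ar C" "Cod C m = Dom C (neg C f)" "neg C f \<cdot> m = Zer C (Dom C m) (Cod C (neg C f))"
    by auto
  fix h assume h: "h \<in> Ar C" "Cod C h = Dom C (neg C f)" "neg C f \<cdot> h = Zer C (Dom C h) (Cod C (neg C f))"
  have "f \<cdot> h = Zer C (Dom C h) (Cod C f)" by (rule neg_eq_Zer) (use A h in auto)
  then show "\<exists>u. u \<in> Hom C (Dom C h) (Dom C m) \<and> m \<cdot> u = h"
    using kernel_factor[OF assms, of h] h A by auto
qed (rule kernel_mono[OF assms])

lemma exact_neg_right: "exact C f g \<Longrightarrow> exact C f (neg C g)"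
  by (auto simp: exact_def intro: kernel_neg)

lemma exact_neg_left: "exact C f g \<Longrightarrow> exact C (neg C f) g"
proof -
  interpret O: normal_category "opp C" by (rule normal_opp)
  show "exact C f g \<Longrightarrow> exact C (neg C f) g"
    using O.exact_neg_right[of g f] by (simp add: exact_opp)
qed

lemma exact_neg_iff:
  "f \<in> Ar C \<Longrightarrow> exact C (neg C f) g \<longleftrightarrow> exact C f g" "g \<in> Ar C \<Longrightarrow> exact C f (neg C g) \<longleftrightarrow> exact C f g"
  using exact_neg_left[of "neg C f" g] exact_neg_left[of f g] exact_neg_right[of f "neg C g"] exact_neg_right[of f g] by auto

end

section \<open>Additive functors\<close>

lemma
  assumes "preadditive_category C" "preadditive_category A" and F: "additive_functor C A F"
  shows additive_functor_Zer: "\<lbrakk>X \<in> Ob C; Y \<in> Ob C\<rbrakk> \<Longrightarrow> FA F (Zer C X Y) = Zer A (FO F X) (FO F Y)"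
    and additive_functor_neg: "f \<in> Ar C \<Longrightarrow> FA F (neg C f) = neg A (FA F f)"
proof -
  interpret C: preadditive_category C by fact
  interpret A: preadditive_category A by fact
  have H: "FA F f \<in> Hom A (FO F X) (FO F Y)" if "f \<in> Hom C X Y" for f X Y
    using F that unfolding additive_functor_def is_functor_def by blast
  have add: "FA F (f \<oplus>\<^bsub>C\<^esub> g) = FA F f \<oplus>\<^bsub>A\<^esub> FA F g" if "f \<in> Hom C X Y" "g \<in> Hom C X Y" for f g X Y
    using F that unfolding additive_functor_def by blast
  have Z: "FA F (Zer C X Y) = Zer A (FO F X) (FO F Y)" if XY: "X \<in> Ob C" "Y \<in> Ob C" for X Y
  proof -
    have z: "Zer C X Y \<in> Hom C X Y" using XY by (simp add: in_Hom_iff)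
    have "FA F (Zer C X Y) \<oplus>\<^bsub>A\<^esub> FA F (Zer C X Y) = FA F (Zer C X Y)"
      using add[OF z z] XY by simp
    then show ?thesis using A.Add_idem_Zer[OF H[OF z] H[OF z]] by simp
  qed
  then show "\<lbrakk>X \<in> Ob C; Y \<in> Ob C\<rbrakk> \<Longrightarrow> FA F (Zer C X Y) = Zer A (FO F X) (FO F Y)" .
  assume f: "f \<in> Ar C"
  have ff: "f \<in> Hom C (Dom C f) (Cod C f)" "neg C f \<in> Hom C (Dom C f) (Cod C f)"
    using f by (simp_all add: in_Hom_iff)
  show "FA F (neg C f) = neg A (FA F f)"
    by (rule A.neg_unique[OF H[OF ff(1)] H[OF ff(2)]])
      (use add[OF ff] Z[of "Dom C f" "Cod C f"] f in simp)
qed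

lemma functor_Hom:
  assumes "is_functor C A F" "f \<in> Hom C X Y" shows "FA F f \<in> Hom A (FO F X) (FO F Y)"
  using assms by (simp add: is_functor_def)

lemma functor_Ar: "is_functor C A F \<Longrightarrow> f \<in> Ar C \<Longrightarrow> FA F f \<in> Ar A"
  using functor_Hom[of C A F f "Dom C f" "Cod C f"] by (simp add: in_Hom_iff)

lemma comp_functor_Zer:
  assumes "preadditive_category C" "preadditive_category A" "additive_functor C A H"
    and f: "f \<in> Hom C X Y" "g \<in> Hom C Y Z" "g \<cdot>\<^bsub>C\<^esub> f = Zer C X Z"
  shows "FA H g \<cdot>\<^bsub>A\<^esub> FA H f = Zer A (FO H X) (FO H Z)"
proof -
  interpret C: preadditive_category C by fact
  have "FA H g \<cdot>\<^bsub>A\<^esub> FA H f = FA H (g \<cdot>\<^bsub>C\<^esub> f)"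
    using assms(3) f(1,2) unfolding additive_functor_def is_functor_def by metis
  also have "\<dots> = Zer A (FO H X) (FO H Z)"
    using additive_functor_Zer[OF assms(1-3), of X Z] C.Hom_Ob[OF f(1)] C.Hom_Ob[OF f(2)] f(3) by simp
  finally show ?thesis .
qed

context normal_category
begin

lemma iso_mono_epi: assumes "is_iso C f" shows "is_mono C f" "is_epi C f"
proof -
  obtain g where fA: "f \<in> Ar C" and g: "g \<in> Ar C" "Dom C g = Cod C f" "Cod C g = Dom C f"
    and gf: "g \<cdot> f = Ident C (Dom C f)" and fg: "f \<cdot> g = Ident C (Cod C f)"
    using assms by (auto simp: is_iso_def in_Hom_iff)
  show "is_mono C f"
    by (rule mono_cancel_right[of g]) (use fA g in \<open>auto simp: gf intro: mono_Ident\<close>)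
  show "is_epi C f"
    by (rule epi_cancel_left[of _ g]) (use fA g in \<open>auto simp: fg intro: epi_Ident\<close>)
qed

text \<open>\<open>m\<^sub>2\<close> is the kernel of some \<open>q\<close>. By the square
  \<open>q\<close> kills \<open>b \<cdot> (m\<^sub>1 \<cdot> e\<^sub>1)\<close>, hence also
  \<open>b \<cdot> m\<^sub>1\<close>, as \<open>e\<^sub>1\<close> is epi.\<close>

lemma image_square:
  assumes m: "is_mono C m\<^sub>2" and e: "is_epi C e\<^sub>1"
    and A: "m\<^sub>1 \<in> Ar C" "e\<^sub>2 \<in> Ar C" "a \<in> Ar C" "b \<in> Ar C" "Cod C e\<^sub>1 = Dom C m\<^sub>1" "Cod C e\<^sub>2 = Dom C m\<^sub>2"
      "Dom C a = Dom C e\<^sub>1" "Cod C a = Dom C e\<^sub>2" "Dom C b = Cod C m\<^sub>1"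
    and eq: "b \<cdot> (m\<^sub>1 \<cdot> e\<^sub>1) = m\<^sub>2 \<cdot> (e\<^sub>2 \<cdot> a)"
  obtains u where "u \<in> Hom C (Dom C m\<^sub>1) (Dom C m\<^sub>2)" "m\<^sub>2 \<cdot> u = b \<cdot> m\<^sub>1" "u \<cdot> e\<^sub>1 = e\<^sub>2 \<cdot> a"
proof -
  obtain q where q: "is_kernel C q m\<^sub>2" using mono_ker m by blast
  note A [simp] = A mono_Ar[OF m] epi_Ar[OF e]
  have qA [simp]: "q \<in> Ar C" "Dom C q = Cod C m\<^sub>2" and qm: "q \<cdot> m\<^sub>2 = Zer C (Dom C m\<^sub>2) (Cod C q)"
    using q by (simp_all add: is_kernel_def)
  have bm [simp]: "Cod C b = Cod C m\<^sub>2" using arg_cong[OF eq, of "Cod C"] by simp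
  have "(q \<cdot> (b \<cdot> m\<^sub>1)) \<cdot> e\<^sub>1 = q \<cdot> (m\<^sub>2 \<cdot> (e\<^sub>2 \<cdot> a))" using eq by simp
  also have "\<dots> = Zer C (Dom C m\<^sub>2) (Cod C q) \<cdot> (e\<^sub>2 \<cdot> a)" by (rule comp_reduce[OF qm]) auto
  finally have "q \<cdot> (b \<cdot> m\<^sub>1) = Zer C (Dom C m\<^sub>1) (Cod C q)"
    using epi_Zer[OF e, of "q \<cdot> (b \<cdot> m\<^sub>1)" "Cod C q"] by (simp add: in_Hom_iff)
  then obtain u where u: "u \<in> Hom C (Dom C m\<^sub>1) (Dom C m\<^sub>2)" "m\<^sub>2 \<cdot> u = b \<cdot> m\<^sub>1"
    using kernel_factor[OF q, of "b \<cdot> m\<^sub>1"] by auto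
  have uA [simp]: "u \<in> Ar C" "Dom C u = Dom C m\<^sub>1" "Cod C u = Dom C m\<^sub>2" using u by (auto simp: in_Hom_iff)
  have "m\<^sub>2 \<cdot> (u \<cdot> e\<^sub>1) = b \<cdot> (m\<^sub>1 \<cdot> e\<^sub>1)" by (rule comp_square[OF u(2)]) auto
  then have "m\<^sub>2 \<cdot> (u \<cdot> e\<^sub>1) = m\<^sub>2 \<cdot> (e\<^sub>2 \<cdot> a)" using eq by simp
  then have "u \<cdot> e\<^sub>1 = e\<^sub>2 \<cdot> a"
    by (rule mono_cancel[OF m, of _ "Dom C e\<^sub>1", rotated 2]) (simp_all add: in_Hom_iff)
  then show thesis using that u by blast
qed

text \<open>\<open>m1 \<cdot> e1\<close> and \<open>m2 \<cdot> e2\<close> are the image factorizations of the maps \<open>P\<^sub>1 \<rightarrow> Q\<^sub>1\<close> and \<open>P\<^sub>2 \<rightarrow> Q\<^sub>2\<close> between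
  exact rows \<open>T\<^sub>0 \<rightarrow> P\<^sub>1 \<rightarrow> P\<^sub>2 \<rightarrow> T\<^sub>3\<close> and \<open>T\<^sub>0 \<rightarrow> Q\<^sub>1 \<rightarrow> Q\<^sub>2 \<rightarrow> T\<^sub>3\<close> that agree at both ends.\<close>

lemma exact_images:
  assumes Q: "exact C aQ bQ" and P: "exact C bP cP"
    and m1: "is_mono C m1" and e1: "is_epi C e1" and m2: "is_mono C m2" and e2: "is_epi C e2"
    and me: "Cod C e1 = Dom C m1" "Cod C e2 = Dom C m2"
    and ends: "Dom C e1 = Dom C bP" "Cod C m1 = Dom C bQ" "Dom C e2 = Cod C bP"
    and b: "bQ \<cdot> (m1 \<cdot> e1) = m2 \<cdot> (e2 \<cdot> bP)"
    and t: "t \<in> Hom C (Dom C aQ) (Dom C m1)" "m1 \<cdot> t = aQ"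
    and d: "d \<in> Hom C (Dom C m1) (Dom C m2)" "m2 \<cdot> d = bQ \<cdot> m1"
    and s: "s \<in> Hom C (Dom C m2) (Cod C cP)" "s \<cdot> e2 = cP"
  shows "exact C t d" "exact C d s"
proof -
  note q = exact_comp_Zer[OF Q] and p = exact_comp_Zer[OF P]
  note mA = mono_Ar[OF m1] mono_Ar[OF m2] epi_Ar[OF e1] epi_Ar[OF e2]
  have A: "t \<in> Ar C" "Dom C t = Dom C aQ" "Cod C t = Dom C m1" "d \<in> Ar C" "Dom C d = Dom C m1"
    "Cod C d = Dom C m2" "s \<in> Ar C" "Dom C s = Dom C m2" "Cod C s = Cod C cP"
    using t d s by (auto simp: in_Hom_iff)
  have m2b: "Cod C m2 = Cod C bQ"
    using arg_cong[OF d(2), of "Cod C"] mA A q(2) ends by simp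
  have "m2 \<cdot> (d \<cdot> t) = bQ \<cdot> (m1 \<cdot> t)" by (rule comp_square) (use A mA q(2) ends d in auto)
  also have "\<dots> = Zer C (Dom C aQ) (Cod C bQ)" using t q by simp
  finally have z1: "d \<cdot> t = Zer C (Dom C t) (Cod C d)"
    using mono_Zer[OF m2, of "d \<cdot> t" "Dom C aQ"] A m2b by (simp add: in_Hom_iff)
  show "exact C t d"
    by (rule exact_under[OF Q m1 epi_Ident[of "Dom C aQ"] _ _ _ _ z1, of m2])
      (use A mA q(1,2) me t d m2b in \<open>simp_all add: in_Hom_iff\<close>)
  have "m2 \<cdot> (d \<cdot> e1) = bQ \<cdot> (m1 \<cdot> e1)" by (rule comp_square) (use A mA q(2) ends me d in auto)
  then have "m2 \<cdot> (d \<cdot> e1) = m2 \<cdot> (e2 \<cdot> bP)" using b by simp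
  then have ed: "d \<cdot> e1 = e2 \<cdot> bP"
    by (rule mono_cancel[OF m2, of _ "Dom C e1", rotated 2]) (use A mA p(1) q(2) ends me in \<open>simp_all add: in_Hom_iff\<close>)
  have "(s \<cdot> d) \<cdot> e1 = s \<cdot> (e2 \<cdot> bP)" using ed A mA me by simp
  also have "\<dots> = cP \<cdot> bP" by (rule comp_reduce) (use s A mA me ends p in auto)
  finally have "(s \<cdot> d) \<cdot> e1 = Zer C (Dom C e1) (Cod C cP)" using p ends by simp
  then have z2: "s \<cdot> d = Zer C (Dom C d) (Cod C s)"
    using epi_Zer[OF e1, of "s \<cdot> d" "Cod C cP"] A me by (simp add: in_Hom_iff)
  have CP: "Dom C cP = Dom C e2" using p ends by simp
  show "exact C d s"
    by (rule exact_over[OF P mono_Ident[of "Cod C cP"] e2 _ _ _ _ z2, of e1])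
      (use A mA p(1,2) me s ed ends CP in \<open>simp_all add: in_Hom_iff\<close>)
qed

end

section \<open>Functors on diagrams given by images\<close>

text \<open>A diagram \<open>d\<close> stands for the arrow \<open>con d\<close>; \<open>EP d d' g a\<close> and \<open>EQ d d' g b\<close> say that \<open>a\<close> and \<open>b\<close>, on
  the sources and on the targets of these arrows, extend the map \<open>g\<close> from \<open>ob d\<close> to \<open>ob d'\<close>.\<close>

locale diagram_system = preadditive_category S
  for S :: "('o, 'm, 's) precategory_scheme" (structure) +
  fixes I :: "'i set" and ob :: "'i \<Rightarrow> 'o" and con :: "'i \<Rightarrow> 'm" and EP EQ :: "'i \<Rightarrow> 'i \<Rightarrow> 'm \<Rightarrow> 'm \<Rightarrow> bool"
  assumes con_Ar: "d \<in> I \<Longrightarrow> con d \<in> Ar S"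
    and ob: "d \<in> I \<Longrightarrow> ob d \<in> Ob S"
    and EP_Hom: "\<lbrakk>d \<in> I; d' \<in> I; EP d d' g a\<rbrakk> \<Longrightarrow> a \<in> Hom S (Dom S (con d)) (Dom S (con d'))"
    and EQ_Hom: "\<lbrakk>d \<in> I; d' \<in> I; EQ d d' g b\<rbrakk> \<Longrightarrow> b \<in> Hom S (Cod S (con d)) (Cod S (con d'))"
    and ex_EP: "\<lbrakk>d \<in> I; d' \<in> I; g \<in> Hom S (ob d) (ob d')\<rbrakk> \<Longrightarrow> \<exists>a. EP d d' g a"
    and ex_EQ: "\<lbrakk>d \<in> I; d' \<in> I; g \<in> Hom S (ob d) (ob d')\<rbrakk> \<Longrightarrow> \<exists>b. EQ d d' g b"
    and EP_Ident: "d \<in> I \<Longrightarrow> EP d d (Ident S (ob d)) (Ident S (Dom S (con d)))"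
    and EQ_Ident: "d \<in> I \<Longrightarrow> EQ d d (Ident S (ob d)) (Ident S (Cod S (con d)))"
    and EP_comp: "\<lbrakk>d \<in> I; d' \<in> I; d'' \<in> I; g \<in> Hom S (ob d) (ob d'); g' \<in> Hom S (ob d') (ob d'');
        EP d d' g a; EP d' d'' g' a'\<rbrakk> \<Longrightarrow> EP d d'' (g' \<cdot> g) (a' \<cdot> a)"
    and EQ_comp: "\<lbrakk>d \<in> I; d' \<in> I; d'' \<in> I; g \<in> Hom S (ob d) (ob d'); g' \<in> Hom S (ob d') (ob d'');
        EQ d d' g b; EQ d' d'' g' b'\<rbrakk> \<Longrightarrow> EQ d d'' (g' \<cdot> g) (b' \<cdot> b)"
    and EP_Add: "\<lbrakk>d \<in> I; d' \<in> I; g \<in> Hom S (ob d) (ob d'); g' \<in> Hom S (ob d) (ob d');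
        EP d d' g a; EP d d' g' a'\<rbrakk> \<Longrightarrow> EP d d' (g \<oplus> g') (a \<oplus> a')"
    and EQ_Add: "\<lbrakk>d \<in> I; d' \<in> I; g \<in> Hom S (ob d) (ob d'); g' \<in> Hom S (ob d) (ob d');
        EQ d d' g b; EQ d d' g' b'\<rbrakk> \<Longrightarrow> EQ d d' (g \<oplus> g') (b \<oplus> b')"
    and EP_EQ: "\<lbrakk>d \<in> I; d' \<in> I; g \<in> Hom S (ob d) (ob d'); EP d d' g a; EQ d d' g b\<rbrakk>
        \<Longrightarrow> b \<cdot> con d = con d' \<cdot> a"

text \<open>Reversing arrows turns the target of \<open>con d\<close> into its source, so
  \<open>EP\<close> and \<open>EQ\<close> trade places. This lets contravariant functors reuse the
  theory of covariant ones.\<close>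

lemma (in diagram_system) diagram_system_opp:
  "diagram_system (opp S) I ob con (\<lambda>d d'. EQ d' d) (\<lambda>d d'. EP d' d)"
  by (intro diagram_system.intro preadditive_opp diagram_system_axioms.intro)
    (auto intro: con_Ar ob EP_Ident EQ_Ident EP_Add EQ_Add EP_EQ[symmetric] EP_comp EQ_comp ex_EP ex_EQ
      dest: EP_Hom EQ_Hom)

text \<open>\<open>y\<close> ends at the source of \<open>con\<close>, and \<open>z\<close> in the
  next locale starts at its target; the maps at the other ends are composites with
  \<open>con\<close>. The first kind yields a map from \<open>F\<close> to the image, the second a
  map from the image to \<open>F\<close>, and \<open>opp\<close> exchanges them.\<close>

locale diagram_under = diagram_system S I ob con EP EQ
  for S :: "('o, 'm, 's) precategory_scheme" (structure) and I :: "'i set" and ob con EP EQ +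
  fixes y :: "'i \<Rightarrow> 'm"
  assumes y_Hom: "d \<in> I \<Longrightarrow> y d \<in> Hom S (ob d) (Dom S (con d))"
    and EP_y: "\<lbrakk>d \<in> I; d' \<in> I; g \<in> Hom S (ob d) (ob d'); EP d d' g a\<rbrakk> \<Longrightarrow> a \<cdot> y d = y d' \<cdot> g"

locale diagram_over = diagram_system S I ob con EP EQ
  for S :: "('o, 'm, 's) precategory_scheme" (structure) and I :: "'i set" and ob con EP EQ +
  fixes z :: "'i \<Rightarrow> 'm"
  assumes z_Hom: "d \<in> I \<Longrightarrow> z d \<in> Hom S (Cod S (con d)) (ob d)"
    and EQ_z: "\<lbrakk>d \<in> I; d' \<in> I; g \<in> Hom S (ob d) (ob d'); EQ d d' g b\<rbrakk> \<Longrightarrow> z d' \<cdot> b = g \<cdot> z d"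

lemma (in diagram_under) diagram_over_opp:
  "diagram_over (opp S) I ob con (\<lambda>d d'. EQ d' d) (\<lambda>d d'. EP d' d) y"
  by (intro diagram_over.intro diagram_system_opp diagram_over_axioms.intro) (auto intro: y_Hom EP_y)

lemma (in diagram_over) diagram_under_opp:
  "diagram_under (opp S) I ob con (\<lambda>d d'. EQ d' d) (\<lambda>d d'. EP d' d) z"
  by (intro diagram_under.intro diagram_system_opp diagram_under_axioms.intro) (auto intro: z_Hom EQ_z)

locale image_system = S: preadditive_category S + diagram_system S I ob con EP EQ + A: normal_category A
  for S :: "('o, 'm, 's) precategory_scheme" and A :: "('p, 'n, 'z) precategory_scheme" (structure)
    and F :: "('o, 'm, 'p, 'n) cfunctor" and I :: "'i set" and ob :: "'i \<Rightarrow> 'o" and con :: "'i \<Rightarrow> 'm" and EP EQ +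
  assumes F: "is_functor S A F"
begin

lemma FO_Ob [simp]: "X \<in> Ob S \<Longrightarrow> FO F X \<in> Ob A"
  and FA_Ident [simp]: "X \<in> Ob S \<Longrightarrow> FA F (Ident S X) = Ident A (FO F X)"
  using F by (simp_all add: is_functor_def)

lemma FA_Hom: "f \<in> Hom S X Y \<Longrightarrow> FA F f \<in> Hom A (FO F X) (FO F Y)"
  using F by (simp add: is_functor_def)

lemma FA_simps [simp]:
  assumes "f \<in> Ar S"
  shows "FA F f \<in> Ar A" "Dom A (FA F f) = FO F (Dom S f)" "Cod A (FA F f) = FO F (Cod S f)"
  using FA_Hom[of f "Dom S f" "Cod S f"] assms by (simp_all add: in_Hom_iff)

lemma FA_comp [simp]:
  "\<lbrakk>f \<in> Ar S; g \<in> Ar S; Cod S f = Dom S g\<rbrakk> \<Longrightarrow> FA F (g \<cdot>\<^bsub>S\<^esub> f) = FA F g \<cdot> FA F f"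
proof -
  assume "f \<in> Ar S" "g \<in> Ar S" "Cod S f = Dom S g"
  then have "f \<in> Hom S (Dom S f) (Dom S g)" "g \<in> Hom S (Dom S g) (Cod S g)" by (auto simp: in_Hom_iff)
  then show ?thesis using F unfolding is_functor_def by blast
qed

section \<open>Images of diagrams and the maps between them\<close>

definition im :: "'i \<Rightarrow> 'n" where "im d = image_incl A (FA F (con d))"

definition coim :: "'i \<Rightarrow> 'n" where
  "coim d = (SOME e. e \<in> Hom A (FO F (Dom S (con d))) (Dom A (im d)) \<and> im d \<cdot> e = FA F (con d) \<and> is_epi A e)"

text \<open>The common shape of \<open>F1_rel\<close>, \<open>F2_rel\<close>,
  \<open>coF1_rel\<close> and \<open>coF2_rel\<close>, which mention extensions on the targets
  only.\<close>

definition rel :: "'i \<Rightarrow> 'i \<Rightarrow> 'm \<Rightarrow> 'n \<Rightarrow> bool" where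
  "rel d d' g u \<longleftrightarrow> (\<exists>b. EQ d d' g b \<and> factors A (FA F b \<cdot> im d) (im d') u)"

definition imap :: "'i \<Rightarrow> 'i \<Rightarrow> 'm \<Rightarrow> 'n" where "imap d d' g = (THE u. rel d d' g u)"

context
  fixes d assumes d: "d \<in> I"
begin

lemma im_image: "is_image A (FA F (con d)) (im d)"
  unfolding im_def using con_Ar[OF d] by (intro A.image_incl) simp

lemma im_mono: "is_mono A (im d)"
  using A.image_mono[OF im_image] .

lemma im_simps [simp]: "im d \<in> Ar A" "Cod A (im d) = FO F (Cod S (con d))"
  using mono_Ar[OF im_mono] A.image_Cod[OF im_image] con_Ar[OF d] by simp_all

lemma coim: "coim d \<in> Hom A (FO F (Dom S (con d))) (Dom A (im d)) \<and> im d \<cdot> coim d = FA F (con d) \<and> is_epi A (coim d)"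
  unfolding coim_def
  by (rule someI_ex) (use A.image_factor[OF im_image] con_Ar[OF d] in auto)

lemma coim_simps [simp]: "coim d \<in> Ar A" "Dom A (coim d) = FO F (Dom S (con d))" "Cod A (coim d) = Dom A (im d)"
  and coim_epi: "is_epi A (coim d)" and im_coim: "im d \<cdot> coim d = FA F (con d)"
  using coim by (auto simp: in_Hom_iff)

end

lemmas dgm_simps = con_Ar im_simps coim_simps
  and EP_Ar = EP_Hom[unfolded in_Hom_iff] and EQ_Ar = EQ_Hom[unfolded in_Hom_iff]

context
  fixes d d' g assumes d: "d \<in> I" "d' \<in> I" and g: "g \<in> Hom S (ob d) (ob d')"
begin

text \<open>The last clause describes \<open>u\<close> through any extension \<open>a\<close> on the
  sources, chosen without regard to \<open>b\<close>. As \<open>coim d\<close> is epi, this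
  determines \<open>u\<close>, so different \<open>b\<close> lead to the same map;
  \<open>rel_unique\<close> rests on it.\<close>

lemma factors_ex1:
  assumes "EQ d d' g b"
  obtains u where "u \<in> Hom A (Dom A (im d)) (Dom A (im d'))" "im d' \<cdot> u = FA F b \<cdot> im d"
    "\<And>a. EP d d' g a \<Longrightarrow> u \<cdot> coim d = coim d' \<cdot> FA F a"
proof -
  note [simp] = dgm_simps[OF d(1)] dgm_simps[OF d(2)] EQ_Ar[OF d assms]
  have sq: "FA F b \<cdot> (im d \<cdot> coim d) = FA F (con d') \<cdot> FA F a" "a \<in> Hom S (Dom S (con d)) (Dom S (con d'))"
    if "EP d d' g a" for a
    using EP_EQ[OF d g that assms] EP_Hom[OF d that] FA_comp[of "con d" b] FA_comp[of a "con d'"]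
    by (simp_all add: im_coim d in_Hom_iff)
  obtain a where a: "EP d d' g a" using ex_EP[OF d g] by blast
  have aA [simp]: "a \<in> Ar S" "Dom S a = Dom S (con d)" "Cod S a = Dom S (con d')"
    using sq(2)[OF a] by (simp_all add: in_Hom_iff)
  have sq': "FA F b \<cdot> (im d \<cdot> coim d) = im d' \<cdot> (coim d' \<cdot> FA F a)"
    unfolding sq(1)[OF a] by (rule A.comp_reduce[OF im_coim[OF d(2)], symmetric]) auto
  obtain u where u: "u \<in> Hom A (Dom A (im d)) (Dom A (im d'))" "im d' \<cdot> u = FA F b \<cdot> im d"
    by (rule A.image_square[OF im_mono[OF d(2)] coim_epi[OF d(1)] _ _ _ _ _ _ _ _ _ sq']) simp_all
  have uA: "u \<in> Ar A" "Dom A u = Dom A (im d)" "Cod A u = Dom A (im d')" using u by (auto simp: in_Hom_iff)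
  have "u \<cdot> coim d = coim d' \<cdot> FA F a" if ep: "EP d d' g a" for a
  proof (rule mono_cancel[OF im_mono[OF d(2)], of _ "FO F (Dom S (con d))"])
    have aA: "a \<in> Ar S" "Dom S a = Dom S (con d)" "Cod S a = Dom S (con d')"
      using sq(2)[OF ep] by (simp_all add: in_Hom_iff)
    show "u \<cdot> coim d \<in> Hom A (FO F (Dom S (con d))) (Dom A (im d'))" using uA by (simp add: in_Hom_iff)
    show "coim d' \<cdot> FA F a \<in> Hom A (FO F (Dom S (con d))) (Dom A (im d'))" using aA by (simp add: in_Hom_iff)
    have "im d' \<cdot> (u \<cdot> coim d) = FA F b \<cdot> (im d \<cdot> coim d)"
      by (rule A.comp_square[OF u(2)]) (use uA in auto)
    also have "\<dots> = FA F (con d') \<cdot> FA F a" by (rule sq(1)[OF ep])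
    also have "\<dots> = im d' \<cdot> (coim d' \<cdot> FA F a)"
      by (rule A.comp_reduce[OF im_coim[OF d(2)], symmetric]) (use aA in auto)
    finally show "im d' \<cdot> (u \<cdot> coim d) = im d' \<cdot> (coim d' \<cdot> FA F a)" .
  qed
  then show thesis using that u by blast
qed

lemma rel_unique: "\<exists>!u. rel d d' g u"
proof -
  have eq: "u = u'" if "rel d d' g u" "rel d d' g u'" for u u'
  proof -
    obtain b b' where b: "EQ d d' g b" "factors A (FA F b \<cdot> im d) (im d') u"
      "EQ d d' g b'" "factors A (FA F b' \<cdot> im d) (im d') u'" using \<open>rel d d' g u\<close> \<open>rel d d' g u'\<close> by (auto simp: rel_def)
    note [simp] = dgm_simps[OF d(1)] dgm_simps[OF d(2)]
    have H: "v = w" if "factors A (FA F c \<cdot> im d) (im d') v" "EQ d d' g c"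
      "w \<in> Hom A (Dom A (im d)) (Dom A (im d'))" "im d' \<cdot> w = FA F c \<cdot> im d" for c v w
      using mono_cancel[OF im_mono[OF d(2)], of v "Dom A (im d)" w] that EQ_Hom[OF d that(2)]
      by (simp add: factors_def in_Hom_iff)
    obtain v where v: "v \<in> Hom A (Dom A (im d)) (Dom A (im d'))" "im d' \<cdot> v = FA F b \<cdot> im d"
      "\<And>a. EP d d' g a \<Longrightarrow> v \<cdot> coim d = coim d' \<cdot> FA F a" by (rule factors_ex1[OF b(1)]) blast
    obtain v' where v': "v' \<in> Hom A (Dom A (im d)) (Dom A (im d'))" "im d' \<cdot> v' = FA F b' \<cdot> im d"
      "\<And>a. EP d d' g a \<Longrightarrow> v' \<cdot> coim d = coim d' \<cdot> FA F a" by (rule factors_ex1[OF b(3)]) blast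
    obtain a where a: "EP d d' g a" using ex_EP[OF d g] by blast
    have "v = v'"
      by (rule epi_cancel[OF coim_epi[OF d(1)], of _ "Dom A (im d')"])
        (use v(1) v'(1) v(3)[OF a] v'(3)[OF a] coim_simps[OF d(1)] in auto)
    then show ?thesis using H[OF b(2,1) v(1,2)] H[OF b(4,3) v'(1,2)] by simp
  qed
  obtain b where b: "EQ d d' g b" using ex_EQ[OF d g] by blast
  obtain u where u: "u \<in> Hom A (Dom A (im d)) (Dom A (im d'))" "im d' \<cdot> u = FA F b \<cdot> im d"
    using factors_ex1[OF b] by metis
  have "rel d d' g u" unfolding rel_def factors_def
    using b u EQ_Hom[OF d b] im_simps[OF d(1)] con_Ar[OF d(1)] by (auto simp: in_Hom_iff)
  then show ?thesis using eq by blast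
qed

lemma imap_rel: "rel d d' g (imap d d' g)"
  unfolding imap_def using rel_unique by (rule theI')

lemma imap_char:
  assumes "EQ d d' g b"
  shows "imap d d' g \<in> Hom A (Dom A (im d)) (Dom A (im d'))" "im d' \<cdot> imap d d' g = FA F b \<cdot> im d"
    "EP d d' g a \<Longrightarrow> imap d d' g \<cdot> coim d = coim d' \<cdot> FA F a"
proof -
  obtain u where u: "u \<in> Hom A (Dom A (im d)) (Dom A (im d'))" "im d' \<cdot> u = FA F b \<cdot> im d"
    "\<And>a. EP d d' g a \<Longrightarrow> u \<cdot> coim d = coim d' \<cdot> FA F a" by (rule factors_ex1[OF assms]) blast
  have "rel d d' g u" unfolding rel_def factors_def
    using assms u EQ_Hom[OF d assms] im_simps[OF d(1)] con_Ar[OF d(1)] by (auto simp: in_Hom_iff)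
  then have "imap d d' g = u" using rel_unique imap_rel by blast
  then show "imap d d' g \<in> Hom A (Dom A (im d)) (Dom A (im d'))" "im d' \<cdot> imap d d' g = FA F b \<cdot> im d"
    "EP d d' g a \<Longrightarrow> imap d d' g \<cdot> coim d = coim d' \<cdot> FA F a" using u by auto
qed

lemma imap_Hom: "imap d d' g \<in> Hom A (Dom A (im d)) (Dom A (im d'))"
  using ex_EQ[OF d g] imap_char(1) by blast

lemma imap_simps [simp]:
  "imap d d' g \<in> Ar A" "Dom A (imap d d' g) = Dom A (im d)" "Cod A (imap d d' g) = Dom A (im d')"
  using imap_Hom by (simp_all add: in_Hom_iff)

lemma imap_coim: "EP d d' g a \<Longrightarrow> imap d d' g \<cdot> coim d = coim d' \<cdot> FA F a"
  using ex_EQ[OF d g] imap_char(3) by blast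

lemma imap_eqI:
  assumes "EQ d d' g b" "u \<in> Hom A (Dom A (im d)) (Dom A (im d'))" "im d' \<cdot> u = FA F b \<cdot> im d"
  shows "imap d d' g = u"
  using mono_cancel[OF im_mono[OF d(2)] imap_Hom assms(2)] imap_char(2)[OF assms(1)] assms(3) by simp

end

lemma imap_Ident: "d \<in> I \<Longrightarrow> imap d d (Ident S (ob d)) = Ident A (Dom A (im d))"
  by (rule imap_eqI[OF _ _ _ EQ_Ident]) (simp_all add: in_Hom_iff ob con_Ar)

lemma imap_comp:
  assumes d: "d \<in> I" "d' \<in> I" "d'' \<in> I" and g: "g \<in> Hom S (ob d) (ob d')" "g' \<in> Hom S (ob d') (ob d'')"
  shows "imap d d'' (g' \<cdot>\<^bsub>S\<^esub> g) = imap d' d'' g' \<cdot> imap d d' g"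
proof -
  obtain b where b: "EQ d d' g b" using ex_EQ d g by blast
  obtain b' where b': "EQ d' d'' g' b'" using ex_EQ d g by blast
  note [simp] = dgm_simps[OF d(1)] dgm_simps[OF d(2)] dgm_simps[OF d(3)] imap_simps[OF d(1,2) g(1)]
     imap_simps[OF d(2,3) g(2)] EQ_Ar[OF d(1,2) b] EQ_Ar[OF d(2,3) b']
  have gg: "g' \<cdot>\<^bsub>S\<^esub> g \<in> Hom S (ob d) (ob d'')" using g by (auto simp: in_Hom_iff)
  show ?thesis
  proof (rule imap_eqI[OF d(1,3) gg EQ_comp[OF d g b b']])
    have "im d'' \<cdot> (imap d' d'' g' \<cdot> imap d d' g) = FA F b' \<cdot> (im d' \<cdot> imap d d' g)"
      by (rule A.comp_square[OF imap_char(2)[OF d(2,3) g(2) b']]) auto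
    also have "\<dots> = FA F (b' \<cdot>\<^bsub>S\<^esub> b) \<cdot> im d" using imap_char(2)[OF d(1,2) g(1) b] by simp
    finally show "im d'' \<cdot> (imap d' d'' g' \<cdot> imap d d' g) = FA F (b' \<cdot>\<^bsub>S\<^esub> b) \<cdot> im d" .
  qed (simp add: in_Hom_iff)
qed

lemma imap_Add:
  assumes additive: "additive_functor S A F"
    and d: "d \<in> I" "d' \<in> I" and g: "g \<in> Hom S (ob d) (ob d')" "g' \<in> Hom S (ob d) (ob d')"
  shows "imap d d' (g \<oplus>\<^bsub>S\<^esub> g') = imap d d' g \<oplus> imap d d' g'"
proof -
  obtain b where b: "EQ d d' g b" using ex_EQ d g by blast
  obtain b' where b': "EQ d d' g' b'" using ex_EQ d g by blast
  note [simp] = dgm_simps[OF d(1)] dgm_simps[OF d(2)] imap_simps[OF d g(1)] imap_simps[OF d g(2)]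
    EQ_Ar[OF d b] EQ_Ar[OF d b']
  have FAdd: "FA F (b \<oplus>\<^bsub>S\<^esub> b') = FA F b \<oplus> FA F b'"
    using additive EQ_Hom[OF d b] EQ_Hom[OF d b'] unfolding additive_functor_def by blast
  show ?thesis
    by (rule imap_eqI[OF d S.Add_Hom[OF g] EQ_Add[OF d g b b']])
      (simp_all add: in_Hom_iff FAdd A.comp_Add A.Add_comp imap_char(2)[OF d g(1) b] imap_char(2)[OF d g(2) b'])
qed

lemma imap_inverse:
  assumes d: "d \<in> I" "d' \<in> I" "ob d' = ob d"
  shows "imap d' d (Ident S (ob d)) \<cdot> imap d d' (Ident S (ob d)) = Ident A (Dom A (im d))"
  using imap_comp[of d d' d "Ident S (ob d)" "Ident S (ob d)"] imap_Ident[OF d(1)] d ob[OF d(1)]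
  by (simp add: in_Hom_iff)

text \<open>Serves twice: for the comparison of two choices, and for the passage from the shift of a
  chosen decomposition to the one chosen for the shifted object.\<close>

lemma imap_iso:
  assumes d: "d \<in> I" "d' \<in> I" "ob d = X" "ob d' = X"
  shows "is_iso A (imap d d' (Ident S X))"
proof -
  have g: "Ident S X \<in> Hom S (ob d) (ob d')" "Ident S X \<in> Hom S (ob d') (ob d)"
    using d ob[OF d(1)] by (simp_all add: in_Hom_iff)
  show ?thesis
    unfolding is_iso_def imap_simps[OF d(1,2) g(1)]
    using imap_Hom[OF d(2,1) g(2)] imap_inverse[OF d(1,2)] imap_inverse[OF d(2,1)] imap_simps[OF d(1,2) g(1)] d by auto
qed

lemma imap_absorb:
  assumes d: "d \<in> I" "d' \<in> I" "d'' \<in> I" "ob d = X" "ob d' = X" "ob d'' = Y" and g: "g \<in> Hom S X Y"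
  shows "imap d' d'' g \<cdot> imap d d' (Ident S X) = imap d d'' g"
  using imap_comp[of d d' d'' "Ident S X" g] d g ob[OF d(1)] by (simp add: in_Hom_iff)

lemma imap_absorb':
  assumes d: "d \<in> I" "d' \<in> I" "d'' \<in> I" "ob d = X" "ob d' = Y" "ob d'' = Y" and g: "g \<in> Hom S X Y"
  shows "imap d' d'' (Ident S Y) \<cdot> imap d d' g = imap d d'' g"
  using imap_comp[of d d' d'' g "Ident S Y"] d g ob[OF d(2)] by (simp add: in_Hom_iff)

section \<open>Functors given by the images of a family of diagrams\<close>

definition computes :: "('o \<Rightarrow> 'i) \<Rightarrow> ('o, 'm, 'p, 'n) cfunctor \<Rightarrow> bool" where
  "computes dg G \<longleftrightarrow> (\<forall>X \<in> Ob S. dg X \<in> I \<and> ob (dg X) = X \<and> FO G X = Dom A (im (dg X))) \<and>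
     (\<forall>g \<in> Ar S. FA G g = imap (dg (Dom S g)) (dg (Cod S g)) g)"

lemma computesD:
  assumes "computes dg G"
  shows "X \<in> Ob S \<Longrightarrow> dg X \<in> I" "X \<in> Ob S \<Longrightarrow> ob (dg X) = X" "X \<in> Ob S \<Longrightarrow> FO G X = Dom A (im (dg X))"
    "g \<in> Hom S X Y \<Longrightarrow> FA G g = imap (dg X) (dg Y) g"
  using assms by (auto simp: computes_def in_Hom_iff)

lemma computes_functor: assumes G: "computes dg G" shows "is_functor S A G"
  unfolding is_functor_def
proof (intro conjI ballI allI)
  note GD [simp] = computesD[OF G]
  fix X assume X: "X \<in> Ob S"
  show "FO G X \<in> Ob A" using X A.Dom_in_Ob[of "im (dg X)"] by simp
  show "FA G (Ident S X) = Ident A (FO G X)" using imap_Ident[of "dg X"] X S.Id_Hom[OF X] by simp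
next
  fix X Y f assume f: "f \<in> Hom S X Y"
  note [simp] = S.Hom_Ob[OF f]
  show "FA G f \<in> Hom A (FO G X) (FO G Y)" using imap_Hom[of "dg X" "dg Y" f] f computesD[OF G] by simp
next
  fix X Y Z f g assume f: "f \<in> Hom S X Y" "g \<in> Hom S Y Z"
  note [simp] = S.Hom_Ob[OF f(1)] S.Hom_Ob[OF f(2)]
  have "g \<cdot>\<^bsub>S\<^esub> f \<in> Hom S X Z" using f by (rule S.Comp_Hom)
  then show "FA G (g \<cdot>\<^bsub>S\<^esub> f) = FA G g \<cdot> FA G f"
    using imap_comp[of "dg X" "dg Y" "dg Z" f g] f by (simp add: computesD[OF G])
qed

lemma computes_additive:
  assumes G: "computes dg G" and "additive_functor S A F" shows "additive_functor S A G"
  unfolding additive_functor_def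
proof (intro conjI ballI allI computes_functor[OF G])
  fix X Y f g assume f: "f \<in> Hom S X Y" "g \<in> Hom S X Y"
  show "FA G (f \<oplus>\<^bsub>S\<^esub> g) = FA G f \<oplus> FA G g"
    using imap_Add[OF assms(2), of "dg X" "dg Y" f g] f S.Hom_Ob[OF f(1)] S.Add_Hom[OF f]
    by (simp add: computesD[OF G])
qed

lemma computes_iso:
  assumes G: "computes dg G" and H: "computes dh H"
    and eta: "\<And>X. X \<in> Ob S \<Longrightarrow> \<eta> X = imap (dg X) (dh X) (Ident S X)"
  shows "nat_iso S A G H \<eta>"
  unfolding nat_iso_def nat_trans_def
proof (intro conjI ballI allI)
  note D = computesD[OF G] computesD[OF H]
  fix X assume X: "X \<in> Ob S"
  show "is_iso A (\<eta> X)" using imap_iso[of "dg X" "dh X" X] X by (simp add: D eta)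
  show "\<eta> X \<in> Hom A (FO G X) (FO H X)"
    using imap_Hom[of "dg X" "dh X" "Ident S X"] X S.Id_Hom[OF X] by (simp add: D eta)
next
  note D = computesD[OF G] computesD[OF H]
  fix X Y f assume f: "f \<in> Hom S X Y"
  note [simp] = S.Hom_Ob[OF f]
  show "\<eta> Y \<cdot> FA G f = FA H f \<cdot> \<eta> X"
    using imap_absorb[of "dg X" "dh X" "dh Y" X Y f] imap_absorb'[of "dg X" "dg Y" "dh Y" X Y f] f
    by (simp add: D eta)
qed

text \<open>Half-exactness is inherited from a cone of \<open>con (dg Y) \<cdot> a\<close>, respectively from a fibre of
  \<open>con (dg Z) \<cdot> b\<close>: maps that run diagonally between neighbouring diagrams.\<close>

context
  fixes dg K X Y Z f g
  assumes K: "computes dg K" and additive: "additive_functor S A F"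
    and fg: "f \<in> Hom S X Y" "g \<in> Hom S Y Z" "g \<cdot>\<^bsub>S\<^esub> f = Zer S X Z"
begin

lemma half_exact_facts:
  "dg X \<in> I" "dg Y \<in> I" "dg Z \<in> I" "f \<in> Hom S (ob (dg X)) (ob (dg Y))" "g \<in> Hom S (ob (dg Y)) (ob (dg Z))"
  "FA K f = imap (dg X) (dg Y) f" "FA K g = imap (dg Y) (dg Z) g"
  "imap (dg Y) (dg Z) g \<cdot> imap (dg X) (dg Y) f = Zer A (Dom A (im (dg X))) (Dom A (im (dg Z)))"
  using computesD[OF K] fg S.Hom_Ob[OF fg(1)] S.Hom_Ob[OF fg(2)]
    comp_functor_Zer[OF S.preadditive_category_axioms A.preadditive_category_axioms computes_additive[OF K additive] fg]
  by simp_all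

lemma half_exact_under:
  assumes a: "EP (dg X) (dg Y) f a" and ex: "exact A (FA F (con (dg Y) \<cdot>\<^bsub>S\<^esub> a)) (FA F v)" and v: "v \<in> Ar S" "Dom S v = Cod S (con (dg Y))"
    and b: "EQ (dg Y) (dg Z) g b" and s: "s \<in> Ar S" "Dom S s = Cod S (con (dg Z))"
    and sb: "s \<cdot>\<^bsub>S\<^esub> (b \<cdot>\<^bsub>S\<^esub> con (dg Y)) = v \<cdot>\<^bsub>S\<^esub> con (dg Y)"
  shows "exact A (FA K f) (FA K g)"
proof -
  note d = half_exact_facts(1-3) and f = half_exact_facts(4) and g = half_exact_facts(5) and zero = half_exact_facts(8)
  note A = EP_Ar[OF d(1,2) a] EQ_Ar[OF d(2,3) b]
  have sv: "Cod S s = Cod S v" using arg_cong[OF sb, of "Cod S"] A s v con_Ar[OF d(2)] by simp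
  note [simp] = dgm_simps[OF d(1)] dgm_simps[OF d(2)] dgm_simps[OF d(3)] imap_simps[OF d(1,2) f]
     imap_simps[OF d(2,3) g] A v s
  show ?thesis unfolding half_exact_facts(6,7)
  proof (rule A.exact_under[OF ex im_mono[OF d(2)] coim_epi[OF d(1)]])
    have "im (dg Y) \<cdot> (coim (dg Y) \<cdot> FA F a) = FA F (con (dg Y)) \<cdot> FA F a"
      by (rule A.comp_reduce[OF im_coim[OF d(2)]]) auto
    then show "im (dg Y) \<cdot> (imap (dg X) (dg Y) f \<cdot> coim (dg X)) = FA F (con (dg Y) \<cdot>\<^bsub>S\<^esub> a)"
      by (simp add: imap_coim[OF d(1,2) f a])
    \<comment> \<open>\<open>sb\<close> is given only after composition with
      \<open>con (dg Y)\<close>. Since \<open>im\<close> after \<open>coim\<close> is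
      \<open>F\<close> of that arrow, the identity for \<open>im\<close> may be tested on the
      epimorphism \<open>coim (dg Y)\<close>.\<close>
    show "(FA F s \<cdot> im (dg Z)) \<cdot> imap (dg Y) (dg Z) g = FA F v \<cdot> im (dg Y)"
    proof (rule epi_cancel[OF coim_epi[OF d(2)], of _ "FO F (Cod S v)"])
      have "(FA F s \<cdot> im (dg Z)) \<cdot> imap (dg Y) (dg Z) g = (FA F s \<cdot> FA F b) \<cdot> im (dg Y)"
        using imap_char(2)[OF d(2,3) g b] by simp
      then have "((FA F s \<cdot> im (dg Z)) \<cdot> imap (dg Y) (dg Z) g) \<cdot> coim (dg Y) = FA F (s \<cdot>\<^bsub>S\<^esub> (b \<cdot>\<^bsub>S\<^esub> con (dg Y)))"
        by (simp add: im_coim[OF d(2)] del: A.comp_assoc) (simp add: im_coim[OF d(2)])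
      also have "\<dots> = FA F v \<cdot> (im (dg Y) \<cdot> coim (dg Y))" unfolding sb by (simp add: im_coim[OF d(2)])
      finally show "((FA F s \<cdot> im (dg Z)) \<cdot> imap (dg Y) (dg Z) g) \<cdot> coim (dg Y) = (FA F v \<cdot> im (dg Y)) \<cdot> coim (dg Y)"
        by simp
    qed (simp_all add: in_Hom_iff sv)
  qed (simp_all add: in_Hom_iff zero)
qed

lemma half_exact_over:
  assumes b: "EP (dg Y) (dg Z) g b" and ex: "exact A (FA F v) (FA F (con (dg Z) \<cdot>\<^bsub>S\<^esub> b))" and v: "v \<in> Ar S" "Cod S v = Dom S (con (dg Y))"
    and a: "EP (dg X) (dg Y) f a" and s: "s \<in> Ar S" "Cod S s = Dom S (con (dg X))"
    and sb: "con (dg Y) \<cdot>\<^bsub>S\<^esub> (a \<cdot>\<^bsub>S\<^esub> s) = con (dg Y) \<cdot>\<^bsub>S\<^esub> v"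
  shows "exact A (FA K f) (FA K g)"
proof -
  note d = half_exact_facts(1-3) and f = half_exact_facts(4) and g = half_exact_facts(5) and zero = half_exact_facts(8)
  note A = EP_Ar[OF d(1,2) a] EP_Ar[OF d(2,3) b]
  have sv: "Dom S s = Dom S v" using arg_cong[OF sb, of "Dom S"] A s v con_Ar[OF d(2)] by simp
  note [simp] = dgm_simps[OF d(1)] dgm_simps[OF d(2)] dgm_simps[OF d(3)] imap_simps[OF d(1,2) f]
     imap_simps[OF d(2,3) g] A v s
  show ?thesis unfolding half_exact_facts(6,7)
  proof (rule A.exact_over[OF ex im_mono[OF d(3)] coim_epi[OF d(2)]])
    have "im (dg Z) \<cdot> (coim (dg Z) \<cdot> FA F b) = FA F (con (dg Z)) \<cdot> FA F b"
      by (rule A.comp_reduce[OF im_coim[OF d(3)]]) auto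
    then show "im (dg Z) \<cdot> (imap (dg Y) (dg Z) g \<cdot> coim (dg Y)) = FA F (con (dg Z) \<cdot>\<^bsub>S\<^esub> b)"
      by (simp add: imap_coim[OF d(2,3) g b])
    \<comment> \<open>Dually, \<open>sb\<close> gives an identity after \<open>con (dg Y)\<close>,
      which the monomorphism \<open>im (dg Y)\<close> turns into one for
      \<open>coim\<close>.\<close>
    show "imap (dg X) (dg Y) f \<cdot> (coim (dg X) \<cdot> FA F s) = coim (dg Y) \<cdot> FA F v"
    proof (rule mono_cancel[OF im_mono[OF d(2)], of _ "FO F (Dom S v)"])
      have "imap (dg X) (dg Y) f \<cdot> (coim (dg X) \<cdot> FA F s) = coim (dg Y) \<cdot> (FA F a \<cdot> FA F s)"
        by (rule A.comp_square[OF imap_coim[OF d(1,2) f a]]) auto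
      then have "im (dg Y) \<cdot> (imap (dg X) (dg Y) f \<cdot> (coim (dg X) \<cdot> FA F s)) = im (dg Y) \<cdot> (coim (dg Y) \<cdot> (FA F a \<cdot> FA F s))" by simp
      also have "\<dots> = FA F (con (dg Y)) \<cdot> (FA F a \<cdot> FA F s)"
        by (rule A.comp_reduce[OF im_coim[OF d(2)]]) auto
      also have "\<dots> = FA F (con (dg Y) \<cdot>\<^bsub>S\<^esub> (a \<cdot>\<^bsub>S\<^esub> s))" by simp
      also have "\<dots> = FA F (con (dg Y)) \<cdot> FA F v" unfolding sb by simp
      also have "\<dots> = im (dg Y) \<cdot> (coim (dg Y) \<cdot> FA F v)"
        by (rule A.comp_reduce[OF im_coim[OF d(2)], symmetric]) auto
      finally show "im (dg Y) \<cdot> (imap (dg X) (dg Y) f \<cdot> (coim (dg X) \<cdot> FA F s)) = im (dg Y) \<cdot> (coim (dg Y) \<cdot> FA F v)" .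
    qed (simp_all add: in_Hom_iff sv)
  qed (simp_all add: in_Hom_iff zero)
qed

end

end

locale image_under = image_system S A F I ob con EP EQ + diagram_under S I ob con EP EQ y
  for S :: "('o, 'm, 's) precategory_scheme" and A :: "('p, 'n, 'z) precategory_scheme" (structure) and F
    and I :: "'i set" and ob :: "'i \<Rightarrow> 'o" and con :: "'i \<Rightarrow> 'm" and EP EQ y
begin

lemma EQ_y:
  assumes d: "d \<in> I" "d' \<in> I" and g: "g \<in> Hom S (ob d) (ob d')" and b: "EQ d d' g b"
  shows "b \<cdot>\<^bsub>S\<^esub> (con d \<cdot>\<^bsub>S\<^esub> y d) = (con d' \<cdot>\<^bsub>S\<^esub> y d') \<cdot>\<^bsub>S\<^esub> g"
proof -
  obtain a where a: "EP d d' g a" using ex_EP[OF d g] by blast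
  note A = EP_Ar[OF d a] EQ_Ar[OF d b] y_Hom[OF d(1), unfolded in_Hom_iff]
    y_Hom[OF d(2), unfolded in_Hom_iff] g[unfolded in_Hom_iff] con_Ar[OF d(1)] con_Ar[OF d(2)]
  have "b \<cdot>\<^bsub>S\<^esub> (con d \<cdot>\<^bsub>S\<^esub> y d) = con d' \<cdot>\<^bsub>S\<^esub> (a \<cdot>\<^bsub>S\<^esub> y d)"
    by (rule S.comp_square[OF EP_EQ[OF d g a b]]) (use A in simp_all)
  then show ?thesis using EP_y[OF d g a] A by simp
qed

definition to_im :: "'i \<Rightarrow> 'n" where
  "to_im d = (THE u. factors A (FA F (con d \<cdot>\<^bsub>S\<^esub> y d)) (im d) u)"

lemma to_im_unique: assumes d: "d \<in> I" shows "\<exists>!u. factors A (FA F (con d \<cdot>\<^bsub>S\<^esub> y d)) (im d) u"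
proof (rule ex1I)
  note [simp] = dgm_simps[OF d]
  have yA [simp]: "y d \<in> Ar S" "Dom S (y d) = ob d" "Cod S (y d) = Dom S (con d)"
    using y_Hom[OF d] by (simp_all add: in_Hom_iff)
  have e: "im d \<cdot> (coim d \<cdot> FA F (y d)) = FA F (con d) \<cdot> FA F (y d)"
    by (rule A.comp_reduce[OF im_coim[OF d]]) auto
  then show "factors A (FA F (con d \<cdot>\<^bsub>S\<^esub> y d)) (im d) (coim d \<cdot> FA F (y d))"
    by (simp add: factors_def in_Hom_iff)
  fix u assume "factors A (FA F (con d \<cdot>\<^bsub>S\<^esub> y d)) (im d) u"
  then have "u \<in> Hom A (FO F (ob d)) (Dom A (im d))" "im d \<cdot> u = FA F (con d) \<cdot> FA F (y d)"
    by (simp_all add: factors_def)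
  then show "u = coim d \<cdot> FA F (y d)"
    using mono_cancel[OF im_mono[OF d], of u "FO F (ob d)" "coim d \<cdot> FA F (y d)"]
    by (simp add: in_Hom_iff e)
qed

lemma to_im:
  assumes d: "d \<in> I"
  shows "to_im d \<in> Hom A (FO F (ob d)) (Dom A (im d))" "im d \<cdot> to_im d = FA F (con d \<cdot>\<^bsub>S\<^esub> y d)"
  using theI'[OF to_im_unique[OF d]] y_Hom[OF d] con_Ar[OF d]
  by (simp_all add: to_im_def factors_def in_Hom_iff)

lemma to_im_natural:
  assumes d: "d \<in> I" "d' \<in> I" and g: "g \<in> Hom S (ob d) (ob d')"
  shows "imap d d' g \<cdot> to_im d = to_im d' \<cdot> FA F g"
proof -
  obtain b where b: "EQ d d' g b" using ex_EQ d g by blast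
  note [simp] = EQ_Ar[OF d b] g[unfolded in_Hom_iff] to_im(1)[OF d(1), unfolded in_Hom_iff]
    to_im(1)[OF d(2), unfolded in_Hom_iff] y_Hom[OF d(1), unfolded in_Hom_iff] y_Hom[OF d(2), unfolded in_Hom_iff]
    dgm_simps[OF d(1)] dgm_simps[OF d(2)] imap_simps[OF d g]
  show ?thesis
  proof (rule mono_cancel[OF im_mono[OF d(2)], of _ "FO F (ob d)"])
    have "im d' \<cdot> (imap d d' g \<cdot> to_im d) = FA F b \<cdot> (im d \<cdot> to_im d)"
      by (rule A.comp_square[OF imap_char(2)[OF d g b]]) auto
    also have "\<dots> = FA F (b \<cdot>\<^bsub>S\<^esub> (con d \<cdot>\<^bsub>S\<^esub> y d))" using to_im(2)[OF d(1)] by simp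
    also have "\<dots> = FA F (con d' \<cdot>\<^bsub>S\<^esub> y d') \<cdot> FA F g" unfolding EQ_y[OF d g b] by simp
    also have "\<dots> = im d' \<cdot> (to_im d' \<cdot> FA F g)"
      by (rule A.comp_reduce[OF to_im(2)[OF d(2)], symmetric]) auto
    finally show "im d' \<cdot> (imap d d' g \<cdot> to_im d) = im d' \<cdot> (to_im d' \<cdot> FA F g)" .
  qed (simp_all add: in_Hom_iff)
qed

lemma computes_to_im:
  assumes G: "computes dg G" and t: "\<And>X. X \<in> Ob S \<Longrightarrow> t X = to_im (dg X)"
  shows "nat_trans S A F G t"
  unfolding nat_trans_def
proof (intro conjI ballI allI)
  note D = computesD[OF G]
  fix X assume X: "X \<in> Ob S"
  show "t X \<in> Hom A (FO F X) (FO G X)" using to_im(1)[of "dg X"] X by (simp add: D t)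
next
  note D = computesD[OF G]
  fix X Y f assume f: "f \<in> Hom S X Y"
  show "t Y \<cdot> FA F f = FA G f \<cdot> t X"
    using to_im_natural[of "dg X" "dg Y" f] f S.Hom_Ob[OF f] by (simp add: D t)
qed

end

locale image_over = image_system S A F I ob con EP EQ + diagram_over S I ob con EP EQ z
  for S :: "('o, 'm, 's) precategory_scheme" and A :: "('p, 'n, 'z) precategory_scheme" (structure) and F
    and I :: "'i set" and ob :: "'i \<Rightarrow> 'o" and con :: "'i \<Rightarrow> 'm" and EP EQ z
begin

definition from_im :: "'i \<Rightarrow> 'n" where "from_im d = FA F (z d) \<cdot> im d"

lemma from_im_Hom: "d \<in> I \<Longrightarrow> from_im d \<in> Hom A (Dom A (im d)) (FO F (ob d))"
  unfolding from_im_def using z_Hom[of d] con_Ar[of d] by (simp add: in_Hom_iff)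

lemma from_im_natural:
  assumes d: "d \<in> I" "d' \<in> I" and g: "g \<in> Hom S (ob d) (ob d')"
  shows "from_im d' \<cdot> imap d d' g = FA F g \<cdot> from_im d"
proof -
  obtain b where b: "EQ d d' g b" using ex_EQ d g by blast
  note [simp] = EQ_Ar[OF d b] g[unfolded in_Hom_iff] z_Hom[OF d(1), unfolded in_Hom_iff]
    z_Hom[OF d(2), unfolded in_Hom_iff] dgm_simps[OF d(1)] dgm_simps[OF d(2)] imap_simps[OF d g]
  have "from_im d' \<cdot> imap d d' g = FA F (z d') \<cdot> (FA F b \<cdot> im d)"
    unfolding from_im_def using imap_char(2)[OF d g b] by simp
  also have "\<dots> = FA F (z d' \<cdot>\<^bsub>S\<^esub> b) \<cdot> im d" by simp
  also have "\<dots> = FA F g \<cdot> from_im d" unfolding EQ_z[OF d g b] from_im_def by simp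
  finally show ?thesis .
qed

lemma computes_from_im:
  assumes G: "computes dg G" and t: "\<And>X. X \<in> Ob S \<Longrightarrow> t X = from_im (dg X)"
  shows "nat_trans S A G F t"
  unfolding nat_trans_def
proof (intro conjI ballI allI)
  note D = computesD[OF G]
  fix X assume X: "X \<in> Ob S"
  show "t X \<in> Hom A (FO G X) (FO F X)" using from_im_Hom[of "dg X"] X by (simp add: D t)
next
  note D = computesD[OF G]
  fix X Y f assume f: "f \<in> Hom S X Y"
  show "t Y \<cdot> FA G f = FA F f \<cdot> t X"
    using from_im_natural[of "dg X" "dg Y" f] f S.Hom_Ob[OF f] by (simp add: D t)
qed

end

subsection \<open>Connecting maps\<close>

text \<open>The first system lies under its objects and the second over them: \<open>F\<close> maps
  to images of the first kind and receives maps from images of the second. For covariant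
  \<open>F\<close> these come from \<open>w_le\<close> and \<open>w_ge\<close>; for contravariant
  \<open>F\<close> the two are exchanged.\<close>

locale image_pair = U: image_under S A F I ob con EP EQ y + O: image_over S A F J ob' con' EP' EQ' z
  for S :: "('o, 'm, 's) precategory_scheme" and A :: "('p, 'n, 'z) precategory_scheme" (structure) and F
    and I :: "'i set" and ob :: "'i \<Rightarrow> 'o" and con :: "'i \<Rightarrow> 'm" and EP EQ y
    and J :: "'j set" and ob' :: "'j \<Rightarrow> 'o" and con' :: "'j \<Rightarrow> 'm" and EP' EQ' z
begin

text \<open>A commutative square from \<open>con u\<close> to \<open>con' v\<close>. The objects
  \<open>ob u\<close> and \<open>ob' v\<close> are unrelated here; in both uses one is the shift of
  the other.\<close>

definition linked :: "'i \<Rightarrow> 'j \<Rightarrow> 'm \<Rightarrow> 'm \<Rightarrow> bool" where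
  "linked u v p q \<longleftrightarrow> u \<in> I \<and> v \<in> J \<and> p \<in> Hom S (Dom S (con u)) (Dom S (con' v)) \<and>
     q \<in> Hom S (Cod S (con u)) (Cod S (con' v)) \<and> q \<cdot>\<^bsub>S\<^esub> con u = con' v \<cdot>\<^bsub>S\<^esub> p"

definition link :: "'i \<Rightarrow> 'j \<Rightarrow> 'm \<Rightarrow> 'n" where
  "link u v q = (SOME k. k \<in> Hom A (Dom A (U.im u)) (Dom A (O.im v)) \<and> O.im v \<cdot> k = FA F q \<cdot> U.im u)"

text \<open>\<open>u'\<close> and \<open>v'\<close> are other diagrams over the objects of the linked diagrams \<open>u\<close> and \<open>v\<close>.\<close>

definition connect :: "'i \<Rightarrow> 'i \<Rightarrow> 'j \<Rightarrow> 'j \<Rightarrow> 'm \<Rightarrow> 'n" where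
  "connect u' u v v' q =
     O.imap v v' (Ident S (ob' v)) \<cdot> (link u v q \<cdot> U.imap u' u (Ident S (ob u)))"

context
  fixes u v p q assumes uv: "linked u v p q"
begin

lemma linkedD:
  "u \<in> I" "v \<in> J" "p \<in> Ar S" "Dom S p = Dom S (con u)" "Cod S p = Dom S (con' v)"
  "q \<in> Ar S" "Dom S q = Cod S (con u)" "Cod S q = Cod S (con' v)" "q \<cdot>\<^bsub>S\<^esub> con u = con' v \<cdot>\<^bsub>S\<^esub> p"
  using uv by (auto simp: linked_def in_Hom_iff)

lemma link_square: "FA F q \<cdot> (U.im u \<cdot> U.coim u) = O.im v \<cdot> (O.coim v \<cdot> FA F p)"
proof -
  note [simp] = linkedD(3-8) U.dgm_simps[OF linkedD(1)] O.dgm_simps[OF linkedD(2)]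
  have "FA F q \<cdot> (U.im u \<cdot> U.coim u) = FA F (q \<cdot>\<^bsub>S\<^esub> con u)" using U.im_coim[OF linkedD(1)] by simp
  also have "\<dots> = FA F (con' v) \<cdot> FA F p" unfolding linkedD(9) by simp
  also have "\<dots> = O.im v \<cdot> (O.coim v \<cdot> FA F p)"
    by (rule U.A.comp_reduce[OF O.im_coim[OF linkedD(2)], symmetric]) simp_all
  finally show ?thesis .
qed

lemma link:
  "link u v q \<in> Ar A" "Dom A (link u v q) = Dom A (U.im u)" "Cod A (link u v q) = Dom A (O.im v)"
  "O.im v \<cdot> link u v q = FA F q \<cdot> U.im u"
proof -
  note [simp] = linkedD(3-8) U.dgm_simps[OF linkedD(1)] O.dgm_simps[OF linkedD(2)]
  have "\<exists>k. k \<in> Hom A (Dom A (U.im u)) (Dom A (O.im v)) \<and> O.im v \<cdot> k = FA F q \<cdot> U.im u"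
    by (rule U.A.image_square[OF O.im_mono[OF linkedD(2)] U.coim_epi[OF linkedD(1)] _ _ _ _ _ _ _ _ _ link_square])
      (simp_all, blast)
  from someI_ex[OF this] show "link u v q \<in> Ar A" "Dom A (link u v q) = Dom A (U.im u)"
    "Cod A (link u v q) = Dom A (O.im v)" "O.im v \<cdot> link u v q = FA F q \<cdot> U.im u"
    by (simp_all add: link_def in_Hom_iff)
qed

context
  fixes u' v' assumes u': "u' \<in> I" "ob u' = ob u" and v': "v' \<in> J" "ob' v' = ob' v"
begin

lemma Ident_Hom:
  "Ident S (ob u) \<in> Hom S (ob u') (ob u)" "Ident S (ob u) \<in> Hom S (ob u) (ob u')"
  "Ident S (ob' v) \<in> Hom S (ob' v) (ob' v')" "Ident S (ob' v) \<in> Hom S (ob' v') (ob' v)"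
  using U.ob[OF linkedD(1)] O.ob[OF linkedD(2)] u' v' by (simp_all add: in_Hom_iff)

lemma connect_simps:
  "connect u' u v v' q \<in> Ar A" "Dom A (connect u' u v v' q) = Dom A (U.im u')" "Cod A (connect u' u v v' q) = Dom A (O.im v')"
  using link U.imap_simps[OF u'(1) linkedD(1) Ident_Hom(1)] O.imap_simps[OF linkedD(2) v'(1) Ident_Hom(3)]
  by (simp_all add: connect_def)

lemma im_connect:
  assumes a: "EQ u' u (Ident S (ob u)) a" and b: "EQ' v v' (Ident S (ob' v)) b"
  shows "O.im v' \<cdot> connect u' u v v' q = FA F (b \<cdot>\<^bsub>S\<^esub> (q \<cdot>\<^bsub>S\<^esub> a)) \<cdot> U.im u'"
proof -
  note [simp] = link(1-3) linkedD(3-8) U.imap_simps[OF u'(1) linkedD(1) Ident_Hom(1)]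
     O.imap_simps[OF linkedD(2) v'(1) Ident_Hom(3)] U.dgm_simps[OF linkedD(1)] O.dgm_simps[OF linkedD(2)]
     U.dgm_simps[OF u'(1)] O.dgm_simps[OF v'(1)] U.EQ_Ar[OF u'(1) linkedD(1) a]
     O.EQ_Ar[OF linkedD(2) v'(1) b]
  have "O.im v' \<cdot> connect u' u v v' q = FA F b \<cdot> (O.im v \<cdot> (link u v q \<cdot> U.imap u' u (Ident S (ob u))))"
    unfolding connect_def
    by (rule U.A.comp_square[OF O.imap_char(2)[OF linkedD(2) v'(1) Ident_Hom(3) b]]) simp_all
  also have "O.im v \<cdot> (link u v q \<cdot> U.imap u' u (Ident S (ob u))) = FA F q \<cdot> (U.im u \<cdot> U.imap u' u (Ident S (ob u)))"
    by (rule U.A.comp_square[OF link(4)]) simp_all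
  also have "U.im u \<cdot> U.imap u' u (Ident S (ob u)) = FA F a \<cdot> U.im u'"
    by (rule U.imap_char(2)[OF u'(1) linkedD(1) Ident_Hom(1) a])
  finally show ?thesis by simp
qed

lemma connect_unique:
  assumes a: "EQ u' u (Ident S (ob u)) a" and b: "EQ' v v' (Ident S (ob' v)) b"
  shows "factors A (FA F (b \<cdot>\<^bsub>S\<^esub> (q \<cdot>\<^bsub>S\<^esub> a)) \<cdot> U.im u') (O.im v') k \<longleftrightarrow> k = connect u' u v v' q"
proof -
  have H: "connect u' u v v' q \<in> Hom A (Dom A (U.im u')) (Dom A (O.im v'))"
    using connect_simps by (simp add: in_Hom_iff)
  have "Dom A (FA F (b \<cdot>\<^bsub>S\<^esub> (q \<cdot>\<^bsub>S\<^esub> a)) \<cdot> U.im u') = Dom A (U.im u')"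
    using connect_simps O.im_simps[OF v'(1)] by (simp add: im_connect[OF a b, symmetric])
  then show ?thesis
    using mono_cancel[OF O.im_mono[OF v'(1)] _ H, of k] H im_connect[OF a b] by (auto simp: factors_def)
qed

text \<open>The hypotheses are the rows of \<open>exact_images\<close>: the row of targets prolonged
  to the left by \<open>F\<close> of \<open>ob u\<close>, and the row of sources prolonged to the
  right by \<open>F\<close> of \<open>ob' v\<close>.\<close>

lemma connect_exact:
  assumes Q: "exact A (FA F (con u \<cdot>\<^bsub>S\<^esub> y u)) (FA F q)" and P: "exact A (FA F p) (FA F (z v \<cdot>\<^bsub>S\<^esub> con' v))"
  shows "exact A (U.to_im u') (connect u' u v v' q)" "exact A (connect u' u v v' q) (O.from_im v')"
proof -
  note lD = linkedD(1,2) and i = Ident_Hom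
  let ?a = "U.imap u' u (Ident S (ob u))" and ?a' = "U.imap u u' (Ident S (ob u))"
  let ?b = "O.imap v v' (Ident S (ob' v))" and ?b' = "O.imap v' v (Ident S (ob' v))"
  have iso: "is_iso A ?a" "is_iso A ?a'" "is_iso A ?b" "is_iso A ?b'"
    using U.imap_iso[OF u'(1) lD(1)] U.imap_iso[OF lD(1) u'(1)] O.imap_iso[OF lD(2) v'(1)] O.imap_iso[OF v'(1) lD(2)] u' v'
    by simp_all
  note [simp] = linkedD(3-8) link(1-3) connect_simps U.dgm_simps[OF lD(1)] O.dgm_simps[OF lD(2)]
     U.dgm_simps[OF u'(1)] O.dgm_simps[OF v'(1)] U.imap_simps[OF u'(1) lD(1) i(1)]
     U.imap_simps[OF lD(1) u'(1) i(2)] O.imap_simps[OF lD(2) v'(1) i(3)] O.imap_simps[OF v'(1) lD(2) i(4)]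
     U.to_im(1)[OF u'(1), unfolded in_Hom_iff] O.from_im_Hom[OF v'(1), unfolded in_Hom_iff]
     U.y_Hom[OF lD(1), unfolded in_Hom_iff] O.z_Hom[OF lD(2), unfolded in_Hom_iff]
  have inv: "?a \<cdot> ?a' = Ident A (Dom A (U.im u))" "?b' \<cdot> ?b = Ident A (Dom A (O.im v))"
    using U.imap_inverse[OF lD(1) u'(1)] O.imap_inverse[OF lD(2) v'(1)] u' v' by simp_all
  have aa: "?a \<cdot> (?a' \<cdot> x) = x" if "x \<in> Ar A" "Cod A x = Dom A (U.im u)" for x
    using U.A.comp_reduce[OF inv(1), of x] that by simp
  have bb: "?b' \<cdot> (?b \<cdot> x) = x" if "x \<in> Ar A" "Cod A x = Dom A (O.im v)" for x
    using U.A.comp_reduce[OF inv(2), of x] that by simp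
  \<comment> \<open>Twisted by the comparison isomorphisms, \<open>im\<close> and
    \<open>coim\<close> still factor the same arrows, but now through the images of
    \<open>u'\<close> and \<open>v'\<close>, so \<open>exact_images\<close> applies to
    \<open>connect\<close> itself.\<close>
  have m1: "is_mono A (U.im u \<cdot> ?a)" and m2: "is_mono A (O.im v \<cdot> ?b')"
    using U.A.mono_comp[OF U.im_mono[OF lD(1)] U.A.iso_mono_epi(1)[OF iso(1)]]
      U.A.mono_comp[OF O.im_mono[OF lD(2)] U.A.iso_mono_epi(1)[OF iso(4)]] by simp_all
  have e1: "is_epi A (?a' \<cdot> U.coim u)" and e2: "is_epi A (?b \<cdot> O.coim v)"
    using U.A.epi_comp[OF U.coim_epi[OF lD(1)] U.A.iso_mono_epi(2)[OF iso(2)]]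
      U.A.epi_comp[OF O.coim_epi[OF lD(2)] U.A.iso_mono_epi(2)[OF iso(3)]] by simp_all
  have b: "FA F q \<cdot> ((U.im u \<cdot> ?a) \<cdot> (?a' \<cdot> U.coim u)) = (O.im v \<cdot> ?b') \<cdot> ((?b \<cdot> O.coim v) \<cdot> FA F p)"
    using link_square by (simp add: aa bb)
  have c: "(O.im v \<cdot> ?b') \<cdot> connect u' u v v' q = FA F q \<cdot> (U.im u \<cdot> ?a)"
  proof -
    have "(O.im v \<cdot> ?b') \<cdot> connect u' u v v' q = O.im v \<cdot> (link u v q \<cdot> ?a)"
      unfolding connect_def by (simp add: bb)
    also have "\<dots> = FA F q \<cdot> (U.im u \<cdot> ?a)" by (rule U.A.comp_square[OF link(4)]) simp_all
    finally show ?thesis .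
  qed
  have "?a \<cdot> U.to_im u' = U.to_im u" "O.from_im v' \<cdot> ?b = O.from_im v"
    using U.to_im_natural[OF u'(1) lD(1) i(1)] O.from_im_natural[OF lD(2) v'(1) i(3)] u' v'
      U.to_im(1)[OF lD(1)] O.from_im_Hom[OF lD(2)] U.ob[OF lD(1)] O.ob[OF lD(2)] by (simp_all add: in_Hom_iff)
  then have t: "(U.im u \<cdot> ?a) \<cdot> U.to_im u' = FA F (con u \<cdot>\<^bsub>S\<^esub> y u)"
    and s: "O.from_im v' \<cdot> (?b \<cdot> O.coim v) = FA F (z v \<cdot>\<^bsub>S\<^esub> con' v)"
    using U.to_im(2)[OF lD(1)] O.im_coim[OF lD(2)] U.A.comp_reduce[of "O.from_im v'" ?b "O.from_im v" "O.coim v"]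
    by (simp_all add: O.from_im_def[of v])
  show "exact A (U.to_im u') (connect u' u v v' q)"
    by (rule U.A.exact_images(1)[OF Q P m1 e1 m2 e2 _ _ _ _ _ b _ t _ c _ s]) (simp_all add: in_Hom_iff u' v')
  show "exact A (connect u' u v v' q) (O.from_im v')"
    by (rule U.A.exact_images(2)[OF Q P m1 e1 m2 e2 _ _ _ _ _ b _ t _ c _ s]) (simp_all add: in_Hom_iff u' v')
qed

end

end

text \<open>With \<open>coim v\<close> in front and \<open>im u\<close> behind, the two maps become
  those of the hypothesis, in which the images no longer occur.\<close>

lemma exact_from_to:
  assumes u: "u \<in> I" and v: "v \<in> J" and "ob' v = ob u"
    and ex: "exact A (FA F (z v \<cdot>\<^bsub>S\<^esub> con' v)) (FA F (con u \<cdot>\<^bsub>S\<^esub> y u))"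
  shows "exact A (O.from_im v) (U.to_im u)"
proof -
  note [simp] = O.dgm_simps[OF v] O.z_Hom[OF v, unfolded in_Hom_iff] U.to_im(1)[OF u, unfolded in_Hom_iff]
     O.from_im_Hom[OF v, unfolded in_Hom_iff] U.dgm_simps[OF u]
  have "O.from_im v \<cdot> O.coim v = FA F (z v \<cdot>\<^bsub>S\<^esub> con' v)"
    unfolding O.from_im_def using O.im_coim[OF v] by simp
  then show ?thesis
    using U.A.exact_mono_epi[OF _ U.im_mono[OF u] O.coim_epi[OF v], of "O.from_im v" "U.to_im u"] ex assms(3)
    by (simp add: U.to_im(2)[OF u, symmetric])
qed

text \<open>On the linked diagrams the square is checked behind the monomorphism
  \<open>O.im\<close>, where it reduces to \<open>sq\<close>; the comparison maps to the primed
  diagrams commute with everything by functoriality of \<open>imap\<close>.\<close>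

lemma connect_natural:
  assumes l: "linked u\<^sub>1 v\<^sub>1 p\<^sub>1 q\<^sub>1" "linked u\<^sub>2 v\<^sub>2 p\<^sub>2 q\<^sub>2"
    and w1: "u\<^sub>1' \<in> I" "ob u\<^sub>1' = ob u\<^sub>1" "v\<^sub>1' \<in> J" "ob' v\<^sub>1' = ob' v\<^sub>1"
    and w2: "u\<^sub>2' \<in> I" "ob u\<^sub>2' = ob u\<^sub>2" "v\<^sub>2' \<in> J" "ob' v\<^sub>2' = ob' v\<^sub>2"
    and g: "g \<in> Hom S (ob u\<^sub>1) (ob u\<^sub>2)" and h: "h \<in> Hom S (ob' v\<^sub>1) (ob' v\<^sub>2)"
    and c: "EQ u\<^sub>1 u\<^sub>2 g c" and e: "EQ' v\<^sub>1 v\<^sub>2 h e" and sq: "e \<cdot>\<^bsub>S\<^esub> q\<^sub>1 = q\<^sub>2 \<cdot>\<^bsub>S\<^esub> c"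
  shows "O.imap v\<^sub>1' v\<^sub>2' h \<cdot> connect u\<^sub>1' u\<^sub>1 v\<^sub>1 v\<^sub>1' q\<^sub>1 = connect u\<^sub>2' u\<^sub>2 v\<^sub>2 v\<^sub>2' q\<^sub>2 \<cdot> U.imap u\<^sub>1' u\<^sub>2' g"
proof -
  note d1 = linkedD(1,2)[OF l(1)] and d2 = linkedD(1,2)[OF l(2)]
  note i1 = Ident_Hom[OF l(1) w1] and i2 = Ident_Hom[OF l(2) w2]
  have g': "g \<in> Hom S (ob u\<^sub>1') (ob u\<^sub>2')" and h': "h \<in> Hom S (ob' v\<^sub>1') (ob' v\<^sub>2')" using g h w1 w2 by simp_all
  note [simp] = linkedD(3-8)[OF l(1)] linkedD(3-8)[OF l(2)] link(1-3)[OF l(1)] link(1-3)[OF l(2)]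
     U.dgm_simps[OF d1(1)] U.dgm_simps[OF d2(1)] O.dgm_simps[OF d1(2)] O.dgm_simps[OF d2(2)]
     U.imap_simps[OF d1(1) d2(1) g] O.imap_simps[OF d1(2) d2(2) h] U.imap_simps[OF w1(1) w2(1) g']
     O.imap_simps[OF w1(3) w2(3) h'] U.imap_simps[OF w1(1) d1(1) i1(1)] U.imap_simps[OF w2(1) d2(1) i2(1)]
     O.imap_simps[OF d1(2) w1(3) i1(3)] O.imap_simps[OF d2(2) w2(3) i2(3)]
     U.EQ_Ar[OF d1(1) d2(1) c] O.EQ_Ar[OF d1(2) d2(2) e]
  have k: "O.imap v\<^sub>1 v\<^sub>2 h \<cdot> link u\<^sub>1 v\<^sub>1 q\<^sub>1 = link u\<^sub>2 v\<^sub>2 q\<^sub>2 \<cdot> U.imap u\<^sub>1 u\<^sub>2 g"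
  proof (rule mono_cancel[OF O.im_mono[OF d2(2)], of _ "Dom A (U.im u\<^sub>1)"])
    have "O.im v\<^sub>2 \<cdot> (O.imap v\<^sub>1 v\<^sub>2 h \<cdot> link u\<^sub>1 v\<^sub>1 q\<^sub>1) = FA F e \<cdot> (O.im v\<^sub>1 \<cdot> link u\<^sub>1 v\<^sub>1 q\<^sub>1)"
      by (rule U.A.comp_square[OF O.imap_char(2)[OF d1(2) d2(2) h e]]) simp_all
    also have "\<dots> = FA F (e \<cdot>\<^bsub>S\<^esub> q\<^sub>1) \<cdot> U.im u\<^sub>1" using link(4)[OF l(1)] by simp
    also have "\<dots> = FA F q\<^sub>2 \<cdot> (U.im u\<^sub>2 \<cdot> U.imap u\<^sub>1 u\<^sub>2 g)"
      unfolding sq using U.imap_char(2)[OF d1(1) d2(1) g c] by simp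
    also have "\<dots> = O.im v\<^sub>2 \<cdot> (link u\<^sub>2 v\<^sub>2 q\<^sub>2 \<cdot> U.imap u\<^sub>1 u\<^sub>2 g)"
      by (rule U.A.comp_square[OF link(4)[OF l(2)], symmetric]) simp_all
    finally show "O.im v\<^sub>2 \<cdot> (O.imap v\<^sub>1 v\<^sub>2 h \<cdot> link u\<^sub>1 v\<^sub>1 q\<^sub>1) = O.im v\<^sub>2 \<cdot> (link u\<^sub>2 v\<^sub>2 q\<^sub>2 \<cdot> U.imap u\<^sub>1 u\<^sub>2 g)" .
  qed (simp_all add: in_Hom_iff)
  have O: "O.imap v\<^sub>1' v\<^sub>2' h \<cdot> O.imap v\<^sub>1 v\<^sub>1' (Ident S (ob' v\<^sub>1)) = O.imap v\<^sub>2 v\<^sub>2' (Ident S (ob' v\<^sub>2)) \<cdot> O.imap v\<^sub>1 v\<^sub>2 h"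
    using O.imap_absorb[OF d1(2) w1(3) w2(3) refl w1(4) w2(4) h] O.imap_absorb'[OF d1(2) d2(2) w2(3) refl refl w2(4) h] by simp
  have U: "U.imap u\<^sub>1 u\<^sub>2 g \<cdot> U.imap u\<^sub>1' u\<^sub>1 (Ident S (ob u\<^sub>1)) = U.imap u\<^sub>2' u\<^sub>2 (Ident S (ob u\<^sub>2)) \<cdot> U.imap u\<^sub>1' u\<^sub>2' g"
    using U.imap_absorb[OF w1(1) d1(1) d2(1) w1(2) refl refl g] U.imap_absorb'[OF w1(1) w2(1) d2(1) w1(2) w2(2) refl g] by simp
  have "O.imap v\<^sub>1' v\<^sub>2' h \<cdot> connect u\<^sub>1' u\<^sub>1 v\<^sub>1 v\<^sub>1' q\<^sub>1
      = O.imap v\<^sub>2 v\<^sub>2' (Ident S (ob' v\<^sub>2)) \<cdot> (O.imap v\<^sub>1 v\<^sub>2 h \<cdot> (link u\<^sub>1 v\<^sub>1 q\<^sub>1 \<cdot> U.imap u\<^sub>1' u\<^sub>1 (Ident S (ob u\<^sub>1))))"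
    unfolding connect_def by (rule U.A.comp_square[OF O]) simp_all
  also have "O.imap v\<^sub>1 v\<^sub>2 h \<cdot> (link u\<^sub>1 v\<^sub>1 q\<^sub>1 \<cdot> U.imap u\<^sub>1' u\<^sub>1 (Ident S (ob u\<^sub>1)))
      = link u\<^sub>2 v\<^sub>2 q\<^sub>2 \<cdot> (U.imap u\<^sub>1 u\<^sub>2 g \<cdot> U.imap u\<^sub>1' u\<^sub>1 (Ident S (ob u\<^sub>1)))"
    by (rule U.A.comp_square[OF k]) simp_all
  finally show ?thesis unfolding U connect_def by simp
qed

end

section \<open>Triangulated categories\<close>

text \<open>The common form of \<open>sh_ob\<close> and \<open>sh_ar\<close>, for which the laws of
  powers of a bijection are proved once.\<close>

definition ipow :: "'a set \<Rightarrow> ('a \<Rightarrow> 'a) \<Rightarrow> int \<Rightarrow> 'a \<Rightarrow> 'a" where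
  "ipow S f i = (if 0 \<le> i then f ^^ nat i else inv_into S f ^^ nat (- i))"

context
  fixes S :: "'a set" and f assumes f: "bij_betw f S S"
begin

lemma funpow_closed: assumes "x \<in> S" shows "(f ^^ n) x \<in> S" "(inv_into S f ^^ n) x \<in> S"
proof -
  show "(f ^^ n) x \<in> S" using assms f by (induction n) (auto simp: bij_betw_def)
  show "(inv_into S f ^^ n) x \<in> S"
    using assms bij_betw_inv_into[OF f] by (induction n) (auto simp: bij_betw_def)
qed

lemma ipow_closed: "x \<in> S \<Longrightarrow> ipow S f i x \<in> S"
  by (simp add: ipow_def funpow_closed)

lemma ipow_succ: assumes "x \<in> S" shows "ipow S f (i + 1) x = f (ipow S f i x)"
proof (cases "0 \<le> i")
  case True
  then show ?thesis by (simp add: ipow_def nat_add_distrib)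
next
  case False
  define n where "n = nat (- i - 1)"
  have i: "i = - int n - 1" using False by (simp add: n_def)
  have "ipow S f i x = inv_into S f ((inv_into S f ^^ n) x)"
    using False by (simp add: ipow_def i nat_add_distrib)
  moreover have "ipow S f (i + 1) x = (inv_into S f ^^ n) x" by (simp add: ipow_def i)
  ultimately show ?thesis
    using bij_betw_inv_into_right[OF f funpow_closed(2)[OF assms]] by simp
qed

lemma ipow_add: assumes "x \<in> S" shows "ipow S f (i + j) x = ipow S f i (ipow S f j x)"
proof (induction i rule: int_induct[of _ 0])
  case base
  show ?case by (simp add: ipow_def[of _ _ 0])
next
  case (step1 i)
  have "ipow S f (i + 1 + j) x = f (ipow S f (i + j) x)"
    using ipow_succ[OF assms, of "i + j"] by (simp add: algebra_simps)
  then show ?case using step1 ipow_succ[OF ipow_closed[OF assms], of i] by simp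
next
  case (step2 i)
  have "f (ipow S f (i - 1 + j) x) = ipow S f (i + j) x"
    using ipow_succ[OF assms, of "i - 1 + j"] by (simp add: algebra_simps)
  also have "\<dots> = f (ipow S f (i - 1) (ipow S f j x))"
    using step2 ipow_succ[OF ipow_closed[OF assms], of "i - 1"] by simp
  finally show ?case
    using f ipow_closed assms by (auto simp: bij_betw_def dest: inj_onD)
qed

end

lemma sh_ob_ipow: "sh_ob C = ipow (Ob C) (FO (Shift C))"
  and sh_ar_ipow: "sh_ar C = ipow (Ar C) (FA (Shift C))"
  by (simp_all add: fun_eq_iff sh_ob_def sh_ar_def ipow_def)

context triangulated_category
begin

lemma sh_ob_simps [simp]:
  assumes "X \<in> Ob C"
  shows "sh_ob C i X \<in> Ob C" "sh_ob C 0 X = X"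
  unfolding sh_ob_ipow using ipow_closed[OF Shift_bij_Ob assms] by (simp_all add: ipow_def)

lemma sh_ob_sh_ob [simp]: "X \<in> Ob C \<Longrightarrow> sh_ob C i (sh_ob C j X) = sh_ob C (i + j) X"
  unfolding sh_ob_ipow by (rule ipow_add[OF Shift_bij_Ob, symmetric])

lemma sh_ar_0 [simp]: "sh_ar C 0 f = f"
  by (simp add: sh_ar_def)

lemma sh_ar_Ar [simp]: "f \<in> Ar C \<Longrightarrow> sh_ar C i f \<in> Ar C"
  unfolding sh_ar_ipow by (rule ipow_closed[OF Shift_bij_Ar])

lemma sh_ar_sh_ar [simp]: "f \<in> Ar C \<Longrightarrow> sh_ar C i (sh_ar C j f) = sh_ar C (i + j) f"
  unfolding sh_ar_ipow by (rule ipow_add[OF Shift_bij_Ar, symmetric])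

lemma sh_ar_inj:
  assumes "f \<in> Ar C" "g \<in> Ar C" "sh_ar C i f = sh_ar C i g" shows "f = g"
  using arg_cong[OF assms(3), of "sh_ar C (- i)"] assms(1,2) by simp

lemma sh_ob_inj:
  assumes "X \<in> Ob C" "Y \<in> Ob C" "sh_ob C i X = sh_ob C i Y" shows "X = Y"
  using arg_cong[OF assms(3), of "sh_ob C (- i)"] assms(1,2) by simp

lemma sh_1: "sh_ob C 1 = FO (Shift C)" "sh_ar C 1 = FA (Shift C)"
  by (simp_all add: sh_ob_def sh_ar_def)

lemma sh_ar_Dom_Cod: "f \<in> Ar C \<Longrightarrow> Dom C (sh_ar C i f) = sh_ob C i (Dom C f) \<and> Cod C (sh_ar C i f) = sh_ob C i (Cod C f)"
proof -
  have up: "Dom C (sh_ar C 1 f) = sh_ob C 1 (Dom C f) \<and> Cod C (sh_ar C 1 f) = sh_ob C 1 (Cod C f)" if "f \<in> Ar C" for f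
    using Shift_additive that unfolding additive_functor_def is_functor_def sh_1 by (auto simp: in_Hom_iff)
  assume f: "f \<in> Ar C"
  show ?thesis
  proof (induction i rule: int_induct[of _ 0])
    case base
    show ?case using f by simp
  next
    case (step1 i)
    then show ?case using up[of "sh_ar C i f"] f by (simp add: add.commute)
  next
    case (step2 i)
    have "sh_ob C 1 (Dom C (sh_ar C (i - 1) f)) = sh_ob C 1 (sh_ob C (i - 1) (Dom C f))"
      "sh_ob C 1 (Cod C (sh_ar C (i - 1) f)) = sh_ob C 1 (sh_ob C (i - 1) (Cod C f))"
      using up[of "sh_ar C (i - 1) f"] step2 f by simp_all
    then show ?case using f sh_ob_inj[of _ _ 1] by auto
  qed
qed

lemma sh_ar_simps [simp]:
  "f \<in> Ar C \<Longrightarrow> Dom C (sh_ar C i f) = sh_ob C i (Dom C f)"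
  "f \<in> Ar C \<Longrightarrow> Cod C (sh_ar C i f) = sh_ob C i (Cod C f)"
  using sh_ar_Dom_Cod by blast+

lemma sh_ar_Hom: "f \<in> Hom C X Y \<Longrightarrow> sh_ar C i f \<in> Hom C (sh_ob C i X) (sh_ob C i Y)"
  by (auto simp: in_Hom_iff)

text \<open>A property of the shift that is compatible with the unshifted operation extends from the shift
  to its inverse by injectivity.\<close>

lemma sh_ar_comp [simp]:
  assumes "f \<in> Ar C" "g \<in> Ar C" "Cod C f = Dom C g"
  shows "sh_ar C i (g \<cdot> f) = sh_ar C i g \<cdot> sh_ar C i f"
proof -
  have up: "sh_ar C 1 (g \<cdot> f) = sh_ar C 1 g \<cdot> sh_ar C 1 f" if "f \<in> Ar C" "g \<in> Ar C" "Cod C f = Dom C g" for f g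
  proof -
    have "f \<in> Hom C (Dom C f) (Cod C f)" "g \<in> Hom C (Cod C f) (Cod C g)" using that by (auto simp: in_Hom_iff)
    then show ?thesis using Shift_additive unfolding additive_functor_def is_functor_def sh_1 by blast
  qed
  show ?thesis
  proof (induction i rule: int_induct[of _ 0])
    case base
    show ?case by simp
  next
    case (step1 i)
    then show ?case using up[of "sh_ar C i f" "sh_ar C i g"] assms sh_ar_sh_ar[of "g \<cdot> f" 1 i] by (simp add: add.commute)
  next
    case (step2 i)
    have "sh_ar C 1 (sh_ar C (i - 1) (g \<cdot> f)) = sh_ar C 1 (sh_ar C (i - 1) g \<cdot> sh_ar C (i - 1) f)"
      using up[of "sh_ar C (i - 1) f" "sh_ar C (i - 1) g"] step2 assms by simp
    then show ?case by (rule sh_ar_inj[rotated 2]) (use assms in simp_all)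
  qed
qed

lemma sh_ar_Add:
  assumes "f \<in> Hom C X Y" "g \<in> Hom C X Y"
  shows "sh_ar C i (f \<oplus> g) = sh_ar C i f \<oplus> sh_ar C i g"
proof -
  have up: "sh_ar C 1 (f \<oplus> g) = sh_ar C 1 f \<oplus> sh_ar C 1 g" if "f \<in> Hom C X Y" "g \<in> Hom C X Y" for f g X Y
    using Shift_additive that unfolding additive_functor_def is_functor_def sh_1 by blast
  note A = assms[unfolded in_Hom_iff] Add_Hom[OF assms, unfolded in_Hom_iff]
  show ?thesis
  proof (induction i rule: int_induct[of _ 0])
    case base
    show ?case by simp
  next
    case (step1 i)
    then show ?case using up[of "sh_ar C i f" "sh_ob C i X" "sh_ob C i Y" "sh_ar C i g"] A sh_ar_sh_ar[of "f \<oplus> g" 1 i]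
      by (simp add: add.commute in_Hom_iff)
  next
    case (step2 i)
    have "sh_ar C 1 (sh_ar C (i - 1) (f \<oplus> g)) = sh_ar C 1 (sh_ar C (i - 1) f \<oplus> sh_ar C (i - 1) g)"
      using up[of "sh_ar C (i - 1) f" "sh_ob C (i - 1) X" "sh_ob C (i - 1) Y" "sh_ar C (i - 1) g"] step2 A by (simp add: in_Hom_iff)
    then show ?case by (rule sh_ar_inj[rotated 2]) (use A in simp_all)
  qed
qed

text \<open>Every arrow into \<open>sh_ob C i X\<close> is a shift, so the shifted identity is a
  left unit for all of them, in particular for the identity of \<open>sh_ob C i X\<close>.\<close>

lemma sh_ar_Ident [simp]: assumes "X \<in> Ob C" shows "sh_ar C i (Ident C X) = Ident C (sh_ob C i X)"
proof -
  have e: "sh_ar C i (Ident C X) \<cdot> f = f" if "f \<in> Ar C" "Cod C f = sh_ob C i X" for f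
  proof -
    have "sh_ar C i (Ident C X \<cdot> sh_ar C (- i) f) = sh_ar C i (sh_ar C (- i) f)" using that assms by simp
    then show ?thesis using that assms sh_ar_comp[of "sh_ar C (- i) f" "Ident C X" i] by simp
  qed
  show ?thesis using e[of "Ident C (sh_ob C i X)"] assms by simp
qed

lemma sh_additive: "additive_functor C C (sh C i)"
  unfolding additive_functor_def is_functor_def
  by (auto simp: sh_def sh_ar_Add in_Hom_iff)

lemma sh_ar_Zer [simp]: "\<lbrakk>X \<in> Ob C; Y \<in> Ob C\<rbrakk> \<Longrightarrow> sh_ar C i (Zer C X Y) = Zer C (sh_ob C i X) (sh_ob C i Y)"
  and sh_ar_neg [simp]: "f \<in> Ar C \<Longrightarrow> sh_ar C i (neg C f) = neg C (sh_ar C i f)"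
  using additive_functor_Zer[OF preadditive_category_axioms preadditive_category_axioms sh_additive, of X Y i]
    additive_functor_neg[OF preadditive_category_axioms preadditive_category_axioms sh_additive, of f i]
  by (simp_all add: sh_def)

subsection \<open>Distinguished triangles\<close>

lemma distD:
  assumes "(f, g, h) \<in> Dist C"
  shows "f \<in> Ar C" "g \<in> Ar C" "h \<in> Ar C" "Dom C g = Cod C f" "Dom C h = Cod C g" "Cod C h = sh_ob C 1 (Dom C f)"
  using Dist_triangle[OF assms] by (auto simp: triangle_def in_Hom_iff)

lemma dist_Hom:
  assumes "(f, g, h) \<in> Dist C"
  shows "f \<in> Hom C (Dom C f) (Cod C f)" "g \<in> Hom C (Cod C f) (Cod C g)"
  using distD[OF assms] by (auto simp: in_Hom_iff)

lemma dist_rotate: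
  assumes "(f, g, h) \<in> Dist C" shows "(g, h, neg C (sh_ar C 1 f)) \<in> Dist C"
proof -
  have "triangle C (Dom C f) (Cod C f) (Cod C g) (f, g, h)"
    using distD[OF assms] by (auto simp: triangle_def in_Hom_iff)
  from TR2[OF this] assms show ?thesis by simp
qed

lemma dist_unrotate:
  assumes "(f, g, h) \<in> Dist C" shows "(neg C (sh_ar C (- 1) h), f, g) \<in> Dist C"
proof -
  note D = distD[OF assms]
  have "triangle C (sh_ob C (- 1) (Cod C g)) (Dom C f) (Cod C f) (neg C (sh_ar C (- 1) h), f, g)"
    using D by (auto simp: triangle_def in_Hom_iff)
  from TR2[OF this] show ?thesis using assms D by simp
qed

lemma neg_Ident_iso: "X \<in> Ob C \<Longrightarrow> is_iso C (neg C (Ident C X))"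
  by (auto simp: is_iso_def in_Hom_iff intro!: bexI[of _ "neg C (Ident C X)"])

lemma Ident_iso: "X \<in> Ob C \<Longrightarrow> is_iso C (Ident C X)"
  by (auto simp: is_iso_def in_Hom_iff intro!: bexI[of _ "Ident C X"])

text \<open>The two signs are absorbed by minus the identity on the middle vertex, which gives an
  isomorphism of triangles.\<close>

lemma dist_neg_neg:
  assumes "(neg C f, neg C g, h) \<in> Dist C" and A: "f \<in> Ar C" "g \<in> Ar C" shows "(f, g, h) \<in> Dist C"
proof -
  note D = distD[OF assms(1)]
  show ?thesis
  proof (rule TR1_iso[OF assms(1), of "Dom C f" "Cod C f" "Cod C g" _ "Ident C (Dom C f)" "neg C (Ident C (Cod C f))" "Ident C (Cod C g)"])
    show "triangle C (Dom C f) (Cod C f) (Cod C g) (f, g, h)"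
      using D A by (auto simp: triangle_def in_Hom_iff)
    show "tri_mor C (neg C f, neg C g, h) (f, g, h) (Ident C (Dom C f)) (neg C (Ident C (Cod C f))) (Ident C (Cod C g))"
      using D A by (auto simp: tri_mor_def in_Hom_iff)
  qed (use A in \<open>auto intro: neg_Ident_iso Ident_iso\<close>)
qed

definition sgn_ar :: "int \<Rightarrow> 'm \<Rightarrow> 'm" where "sgn_ar i f = (if even i then f else neg C f)"

lemma sgn_ar_simps [simp]:
  assumes "f \<in> Ar C"
  shows "sgn_ar i f \<in> Ar C" "Dom C (sgn_ar i f) = Dom C f" "Cod C (sgn_ar i f) = Cod C f"
    "sh_ar C j (sgn_ar i f) = sgn_ar i (sh_ar C j f)"
  using assms by (auto simp: sgn_ar_def)

text \<open>Three rotations shift a triangle by one and negate all three maps.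
  \<open>dist_neg_neg\<close> removes two of the signs, which leaves one on the last map per
  step.\<close>

lemma dist_shift:
  assumes "(f, g, h) \<in> Dist C"
  shows "(sh_ar C i f, sh_ar C i g, sgn_ar i (sh_ar C i h)) \<in> Dist C"
proof (induction i rule: int_induct[of _ 0])
  case base
  show ?case using assms by (simp add: sgn_ar_def)
next
  note D [simp] = distD[OF assms]
  case (step1 i)
  from dist_rotate[OF dist_rotate[OF dist_rotate[OF step1(2)]]]
  have "(neg C (sh_ar C (i + 1) f), neg C (sh_ar C (i + 1) g), neg C (sgn_ar i (sh_ar C (i + 1) h))) \<in> Dist C"
    by (simp add: add.commute)
  from dist_neg_neg[OF this] show ?case by (simp add: sgn_ar_def split: if_splits)
next
  note D [simp] = distD[OF assms]
  case (step2 i)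
  from dist_unrotate[OF dist_unrotate[OF dist_unrotate[OF step2(2)]]]
  have "(neg C (sh_ar C (i - 1) f), neg C (sh_ar C (i - 1) g), neg C (sgn_ar i (sh_ar C (i - 1) h))) \<in> Dist C"
    by simp
  from dist_neg_neg[OF this] show ?case by (simp add: sgn_ar_def split: if_splits)
qed

lemma obtain_zero: obtains Z where "zero_object C Z" "Z \<in> Ob C"
  using ex_zero_object by (auto simp: zero_object_def)

section \<open>Lifting and extension along distinguished triangles\<close>

lemma dist_comp_Zer:
  assumes "(f, g, h) \<in> Dist C"
  shows "g \<cdot> f = Zer C (Dom C f) (Cod C g)"
proof -
  note D = distD[OF assms]
  obtain Z where Z: "zero_object C Z" "Z \<in> Ob C" by (rule obtain_zero)
  \<comment> \<open>The triangle of the identity of \<open>Dom C f\<close> maps to the given one, so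
    \<open>g \<cdot> f\<close> passes through the zero object \<open>Z\<close>.\<close>
  obtain c where "tri_mor C (Ident C (Dom C f), Zer C (Dom C f) Z, Zer C Z (sh_ob C 1 (Dom C f))) (f, g, h) (Ident C (Dom C f)) f c"
    using TR3[OF TR1_Id[OF _ Z(1), of "Dom C f"] assms, of "Ident C (Dom C f)" f] D by (auto simp: in_Hom_iff)
  then have "c \<in> Ar C" "Dom C c = Z" "Cod C c = Cod C g" "c \<cdot> Zer C (Dom C f) Z = g \<cdot> f"
    using D Z by (auto simp: tri_mor_def in_Hom_iff)
  then show ?thesis using D Z comp_Zer[of "Dom C f" c Z] by simp
qed

text \<open>\<open>f\<close> is a weak kernel of \<open>g\<close>: the rotated triangle of the
  identity of \<open>Dom C u\<close> maps to the rotated given triangle, and shifting the third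
  component back gives the lift.\<close>

lemma dist_lift:
  assumes T: "(f, g, h) \<in> Dist C" and u: "u \<in> Ar C" "Cod C u = Dom C g" "g \<cdot> u = Zer C (Dom C u) (Cod C g)"
  obtains w where "w \<in> Ar C" "Dom C w = Dom C u" "Cod C w = Dom C f" "f \<cdot> w = u"
proof -
  note D = distD[OF T]
  obtain Z where Z: "zero_object C Z" "Z \<in> Ob C" by (rule obtain_zero)
  let ?W = "Dom C u"
  have W: "?W \<in> Ob C" using u by simp
  have "(Zer C ?W Z, Zer C Z (sh_ob C 1 ?W), neg C (sh_ar C 1 (Ident C ?W))) \<in> Dist C"
    by (rule dist_rotate[OF TR1_Id[OF W Z(1)]])
  from TR3[OF this dist_rotate[OF T], of u "Zer C Z (Cod C g)"]
  obtain c where "tri_mor C (Zer C ?W Z, Zer C Z (sh_ob C 1 ?W), neg C (sh_ar C 1 (Ident C ?W)))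
      (g, h, neg C (sh_ar C 1 f)) u (Zer C Z (Cod C g)) c"
    using u D Z W by (auto simp: in_Hom_iff)
  then have c: "c \<in> Ar C" "Dom C c = sh_ob C 1 ?W" "Cod C c = sh_ob C 1 (Dom C f)"
    and eq: "neg C (sh_ar C 1 u) = neg C (sh_ar C 1 f \<cdot> c)"
    using D W u Z by (auto simp: tri_mor_def in_Hom_iff)
  have "sh_ar C 1 u = sh_ar C 1 (f \<cdot> sh_ar C (- 1) c)"
    using neg_eq_iff[of "sh_ar C 1 u" "sh_ar C 1 f \<cdot> c"] eq c D u W by simp
  then have "f \<cdot> sh_ar C (- 1) c = u" by (rule sh_ar_inj[rotated 2, symmetric]) (use c D u W in simp_all)
  then show thesis using that[of "sh_ar C (- 1) c"] c W D by simp
qed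

lemma dist_extend:
  assumes T: "(f, g, h) \<in> Dist C" and u: "u \<in> Ar C" "Dom C u = Cod C f" "u \<cdot> f = Zer C (Dom C f) (Cod C u)"
  obtains w where "w \<in> Ar C" "Dom C w = Cod C g" "Cod C w = Cod C u" "w \<cdot> g = u"
proof -
  note D = distD[OF T]
  obtain Z where Z: "zero_object C Z" "Z \<in> Ob C" by (rule obtain_zero)
  let ?W = "Cod C u"
  have W: "?W \<in> Ob C" using u by simp
  let ?Z = "sh_ob C (- 1) Z"
  have T': "(Zer C ?Z ?W, Ident C ?W, Zer C ?W Z) \<in> Dist C"
    using dist_unrotate[OF TR1_Id[OF W Z(1)]] Z W by simp
  obtain c where "tri_mor C (f, g, h) (Zer C ?Z ?W, Ident C ?W, Zer C ?W Z) (Zer C (Dom C f) ?Z) u c"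
    using TR3[OF T T', of "Zer C (Dom C f) ?Z" u] u D Z W by (auto simp: in_Hom_iff)
  then show thesis using that[of c] u D W Z by (auto simp: tri_mor_def in_Hom_iff)
qed

text \<open>The difference of the two extensions vanishes on \<open>g\<close>, hence factors through
  \<open>sh_ob C 1 (Dom C f)\<close>, from which only the zero map leads to
  \<open>V\<close>.\<close>

lemma dist_extend_eq:
  assumes T: "(f, g, h) \<in> Dist C" and c: "c \<in> Hom C (Cod C g) V" "c' \<in> Hom C (Cod C g) V" "c \<cdot> g = c' \<cdot> g"
    and orth: "Hom C (sh_ob C 1 (Dom C f)) V = {Zer C (sh_ob C 1 (Dom C f)) V}"
  shows "c = c'"
proof (rule diff_Zer[OF c(1,2)])
  note D = distD[OF T]
  have A: "c \<in> Ar C" "c' \<in> Ar C" "Dom C c = Cod C g" "Dom C c' = Cod C g" "Cod C c = V" "Cod C c' = V" "V \<in> Ob C"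
    using c(1,2) Hom_Ob by (auto simp: in_Hom_iff)
  have z: "(c \<oplus> neg C c') \<cdot> g = Zer C (Cod C f) V" using A D c(3) by (simp add: Add_comp)
  have diff: "c \<oplus> neg C c' \<in> Ar C" "Dom C (c \<oplus> neg C c') = Cod C g" "Cod C (c \<oplus> neg C c') = V"
    using A by simp_all
  obtain w where w: "w \<in> Ar C" "Dom C w = Cod C h" "Cod C w = V" "w \<cdot> h = c \<oplus> neg C c'"
    by (rule dist_extend[OF dist_rotate[OF T] diff(1)]) (use diff(2,3) D z in simp_all)
  have "w \<in> Hom C (sh_ob C 1 (Dom C f)) V" using w D by (simp add: in_Hom_iff)
  then have "w = Zer C (sh_ob C 1 (Dom C f)) V" using orth by simp
  then show "c \<oplus> neg C c' = Zer C (Cod C g) V" using w D A Zer_comp[of V h] by simp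
qed

lemma dist_lift_eq:
  assumes T: "(f, g, h) \<in> Dist C" and c: "c \<in> Hom C U (Dom C f)" "c' \<in> Hom C U (Dom C f)" "f \<cdot> c = f \<cdot> c'"
    and orth: "Hom C U (sh_ob C (- 1) (Cod C g)) = {Zer C U (sh_ob C (- 1) (Cod C g))}"
  shows "c = c'"
proof (rule diff_Zer[OF c(1,2)])
  note D = distD[OF T]
  have A: "c \<in> Ar C" "c' \<in> Ar C" "Cod C c = Dom C f" "Cod C c' = Dom C f" "Dom C c = U" "Dom C c' = U" "U \<in> Ob C"
    using c(1,2) Hom_Ob by (auto simp: in_Hom_iff)
  have z: "f \<cdot> (c \<oplus> neg C c') = Zer C U (Cod C f)" using A D c(3) by (simp add: comp_Add)
  have diff: "c \<oplus> neg C c' \<in> Ar C" "Dom C (c \<oplus> neg C c') = U" "Cod C (c \<oplus> neg C c') = Dom C f"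
    using A by simp_all
  obtain w where w: "w \<in> Ar C" "Dom C w = U" "Cod C w = sh_ob C (- 1) (Cod C g)"
      "neg C (sh_ar C (- 1) h) \<cdot> w = c \<oplus> neg C c'"
    by (rule dist_lift[OF dist_unrotate[OF T] diff(1)]) (use diff(2,3) D z in simp_all)
  have "w \<in> Hom C U (sh_ob C (- 1) (Cod C g))" using w by (simp add: in_Hom_iff)
  then have "w = Zer C U (sh_ob C (- 1) (Cod C g))" using orth by simp
  then show "c \<oplus> neg C c' = Zer C U (Dom C f)"
    using w D A comp_Zer[of U "neg C (sh_ar C (- 1) h)" "sh_ob C (- 1) (Cod C g)"] by simp
qed

text \<open>\<open>TR3\<close> for the rotated triangles; the completing arrow is found one shift
  too high and moved back.\<close>

lemma TR3_left:
  assumes T: "(f, g, h) \<in> Dist C" and T': "(f', g', h') \<in> Dist C"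
    and b: "b \<in> Hom C (Cod C f) (Cod C f')" and c: "c \<in> Hom C (Cod C g) (Cod C g')" and eq: "c \<cdot> g = g' \<cdot> b"
  obtains a where "tri_mor C (f, g, h) (f', g', h') a b c"
proof -
  note D = distD[OF T] and D' = distD[OF T']
  have A: "b \<in> Ar C" "Dom C b = Cod C f" "Cod C b = Cod C f'" "c \<in> Ar C" "Dom C c = Cod C g" "Cod C c = Cod C g'"
    using b c by (auto simp: in_Hom_iff)
  obtain a where "tri_mor C (g, h, neg C (sh_ar C 1 f)) (g', h', neg C (sh_ar C 1 f')) b c a"
    using TR3[OF dist_rotate[OF T] dist_rotate[OF T'], of b c] A D D' eq by (auto simp: in_Hom_iff)
  then have a: "a \<in> Ar C" "Dom C a = sh_ob C 1 (Dom C f)" "Cod C a = sh_ob C 1 (Dom C f')"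
    "a \<cdot> h = h' \<cdot> c" "neg C (sh_ar C 1 b \<cdot> sh_ar C 1 f) = neg C (sh_ar C 1 f' \<cdot> a)"
    using D D' A by (auto simp: tri_mor_def in_Hom_iff)
  have "sh_ar C 1 (b \<cdot> f) = sh_ar C 1 (f' \<cdot> sh_ar C (- 1) a)"
    using neg_eq_iff[of "sh_ar C 1 b \<cdot> sh_ar C 1 f" "sh_ar C 1 f' \<cdot> a"] a D D' A by simp
  then have "b \<cdot> f = f' \<cdot> sh_ar C (- 1) a" by (rule sh_ar_inj[rotated 2]) (use a D D' A in simp_all)
  then have "tri_mor C (f, g, h) (f', g', h') (sh_ar C (- 1) a) b c"
    using a D D' A eq by (auto simp: tri_mor_def in_Hom_iff)
  then show thesis using that by blast
qed

lemma dist_fibre: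
  assumes "g \<in> Ar C" obtains f h where "(f, g, h) \<in> Dist C"
  using TR1_cone[OF assms] dist_unrotate by blast

lemma Hom_shift_Zer:
  assumes "Hom C (sh_ob C i X) (sh_ob C i Y) = {Zer C (sh_ob C i X) (sh_ob C i Y)}" "X \<in> Ob C" "Y \<in> Ob C"
  shows "Hom C X Y = {Zer C X Y}"
proof
  show "Hom C X Y \<subseteq> {Zer C X Y}"
  proof
    fix f assume f: "f \<in> Hom C X Y"
    then have "sh_ar C i f = sh_ar C i (Zer C X Y)" using sh_ar_Hom[OF f, of i] assms by simp
    then show "f \<in> {Zer C X Y}" using sh_ar_inj[of f "Zer C X Y" i] f assms by (simp add: in_Hom_iff)
  qed
qed (use assms in \<open>simp add: in_Hom_iff\<close>)

end

subsection \<open>Homological functors\<close>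

context triangulated_category
begin

lemma exact_sgn:
  assumes "normal_category A" and neg: "\<And>f. f \<in> Ar C \<Longrightarrow> FA G (neg C f) = neg A (FA G f) \<and> FA G f \<in> Ar A"
    and f: "f \<in> Ar C"
  shows "exact A (FA G (sgn_ar i f)) x \<longleftrightarrow> exact A (FA G f) x" "exact A x (FA G (sgn_ar i f)) \<longleftrightarrow> exact A x (FA G f)"
    "exact A (FA G (neg C f)) x \<longleftrightarrow> exact A (FA G f) x" "exact A x (FA G (neg C f)) \<longleftrightarrow> exact A x (FA G f)"
proof -
  interpret A: normal_category A by fact
  show "exact A (FA G (neg C f)) x \<longleftrightarrow> exact A (FA G f) x" "exact A x (FA G (neg C f)) \<longleftrightarrow> exact A x (FA G f)"
    using neg[OF f] by (simp_all add: A.exact_neg_iff)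
  then show "exact A (FA G (sgn_ar i f)) x \<longleftrightarrow> exact A (FA G f) x" "exact A x (FA G (sgn_ar i f)) \<longleftrightarrow> exact A x (FA G f)"
    by (simp_all add: sgn_ar_def)
qed

text \<open>Exactness at the middle of every triangle suffices: each other place of the long
  sequence is the middle of a rotated shift, up to signs, which exactness ignores.\<close>

lemma homologicalI:
  assumes A: "normal_category A" and G: "additive_functor C A G"
    and half: "\<And>f g h. (f, g, h) \<in> Dist C \<Longrightarrow> exact A (FA G f) (FA G g)"
  shows "homological C A G"
proof -
  interpret A: normal_category A by fact
  have neg: "FA G (neg C f) = neg A (FA G f) \<and> FA G f \<in> Ar A" if "f \<in> Ar C" for f
    using additive_functor_neg[OF preadditive_category_axioms A.preadditive_category_axioms G that]
      functor_Ar[of C A G f] G that by (simp add: additive_functor_def)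
  have "long_exact A (\<lambda>n. FA G (sh_ar C n f)) (\<lambda>n. FA G (sh_ar C n g)) (\<lambda>n. FA G (sh_ar C n h))"
    if T: "(f, g, h) \<in> Dist C" for f g h
    unfolding long_exact_def
  proof (intro allI conjI)
    note [simp] = distD(1-3)[OF T]
    fix n
    note T1 = dist_shift[OF T, of n] and T2 = dist_shift[OF T, of "n + 1"]
    show "exact A (FA G (sh_ar C n f)) (FA G (sh_ar C n g))" by (rule half[OF T1])
    show "exact A (FA G (sh_ar C n g)) (FA G (sh_ar C n h))"
      using half[OF dist_rotate[OF T1]] exact_sgn(2)[OF A neg] by simp
    show "exact A (FA G (sh_ar C n h)) (FA G (sh_ar C (n + 1) f))"
      using half[OF dist_unrotate[OF T2]] exact_sgn(1,3)[OF A neg] by simp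
  qed
  then show ?thesis unfolding homological_def using G by auto
qed

lemma cohomologicalI:
  assumes A: "normal_category A" and G: "additive_functor (opp C) A G"
    and half: "\<And>f g h. (f, g, h) \<in> Dist C \<Longrightarrow> exact A (FA G g) (FA G f)"
  shows "cohomological C A G"
proof -
  interpret A: normal_category A by fact
  have neg: "FA G (neg C f) = neg A (FA G f) \<and> FA G f \<in> Ar A" if "f \<in> Ar C" for f
    using additive_functor_neg[OF preadditive_opp A.preadditive_category_axioms G, of f]
      functor_Ar[of "opp C" A G f] G that by (simp add: additive_functor_def)
  have "long_exact A (\<lambda>n. FA G (sh_ar C (- n) g)) (\<lambda>n. FA G (sh_ar C (- n) f)) (\<lambda>n. FA G (sh_ar C (- n - 1) h))"
    if T: "(f, g, h) \<in> Dist C" for f g h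
    unfolding long_exact_def
  proof (intro allI conjI)
    note [simp] = distD(1-3)[OF T]
    fix n
    note T1 = dist_shift[OF T, of "- n"] and T2 = dist_shift[OF T, of "- n - 1"]
    show "exact A (FA G (sh_ar C (- n) g)) (FA G (sh_ar C (- n) f))" by (rule half[OF T1])
    show "exact A (FA G (sh_ar C (- n) f)) (FA G (sh_ar C (- n - 1) h))"
      using half[OF dist_unrotate[OF T1]] exact_sgn(2,4)[OF A neg] by (simp add: minus_diff_commute)
    show "exact A (FA G (sh_ar C (- n - 1) h)) (FA G (sh_ar C (- (n + 1)) g))"
      using half[OF dist_rotate[OF T2]] exact_sgn(1)[OF A neg] by simp
  qed
  then show ?thesis unfolding cohomological_def using G by auto
qed

lemma homologicalD:
  assumes "homological C A G"
  shows "additive_functor C A G" "(f, g, h) \<in> Dist C \<Longrightarrow> exact A (FA G f) (FA G g)"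
    "(f, g, h) \<in> Dist C \<Longrightarrow> exact A (FA G g) (FA G h)" "(f, g, h) \<in> Dist C \<Longrightarrow> exact A (FA G h) (FA G (sh_ar C 1 f))"
proof -
  show "additive_functor C A G" using assms by (simp add: homological_def)
  assume "(f, g, h) \<in> Dist C"
  then have "long_exact A (\<lambda>n. FA G (sh_ar C n f)) (\<lambda>n. FA G (sh_ar C n g)) (\<lambda>n. FA G (sh_ar C n h))"
    using assms by (auto simp: homological_def)
  then show "exact A (FA G f) (FA G g)" "exact A (FA G g) (FA G h)" "exact A (FA G h) (FA G (sh_ar C 1 f))"
    unfolding long_exact_def by (auto dest!: spec[of _ "0 :: int"])
qed

lemma cohomologicalD:
  assumes "cohomological C A G"
  shows "additive_functor (opp C) A G" "(f, g, h) \<in> Dist C \<Longrightarrow> exact A (FA G g) (FA G f)"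
    "(f, g, h) \<in> Dist C \<Longrightarrow> exact A (FA G h) (FA G g)" "(f, g, h) \<in> Dist C \<Longrightarrow> exact A (FA G (sh_ar C 1 f)) (FA G h)"
proof -
  show "additive_functor (opp C) A G" using assms by (simp add: cohomological_def)
  assume "(f, g, h) \<in> Dist C"
  then have "long_exact A (\<lambda>n. FA G (sh_ar C (- n) g)) (\<lambda>n. FA G (sh_ar C (- n) f)) (\<lambda>n. FA G (sh_ar C (- n - 1) h))"
    using assms by (auto simp: cohomological_def)
  then show "exact A (FA G g) (FA G f)" "exact A (FA G h) (FA G g)" "exact A (FA G (sh_ar C 1 f)) (FA G h)"
    unfolding long_exact_def by (auto dest: spec[of _ "- 1 :: int"] spec[of _ "0 :: int"])
qed

end

section \<open>Weight decompositions\<close>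

text \<open>A triangle is a triple of arrows; \<open>t_in\<close>, \<open>t_pr\<close> and \<open>t_bd\<close> are its arrows \<open>w\<^sub>\<ge> X \<rightarrow> X\<close>,
  \<open>X \<rightarrow> w\<^sub>\<le> X\<close> and \<open>w\<^sub>\<le> X \<rightarrow> (w\<^sub>\<ge> X)[1]\<close>.\<close>

definition t_in :: "'m \<times> 'm \<times> 'm \<Rightarrow> 'm" where "t_in = fst"
definition t_pr :: "'m \<times> 'm \<times> 'm \<Rightarrow> 'm" where "t_pr t = fst (snd t)"
definition t_bd :: "'m \<times> 'm \<times> 'm \<Rightarrow> 'm" where "t_bd t = snd (snd t)"

lemma t_collapse: "t = (t_in t, t_pr t, t_bd t)"
  by (simp add: t_in_def t_pr_def t_bd_def)

text \<open>\<open>w_conn\<close> with arbitrary triangles in place of chosen ones, so that it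
  applies to shifted decompositions as well.\<close>

definition tri_conn ::
  "('o, 'm, 'z) tricategory_scheme \<Rightarrow> 'm \<times> 'm \<times> 'm \<Rightarrow> 'm \<times> 'm \<times> 'm \<Rightarrow> 'o \<Rightarrow> 'm \<times> 'm" where
  "tri_conn C t t' X = (THE (d, c). tri_mor C t t' d (Ident C X) c)"

locale weighted_category = triangulated_category C
  for C :: "('o, 'm, 'z) tricategory_scheme" (structure) +
  fixes L G :: "'o set"
  assumes weights: "weight_structure C L G"
begin

abbreviation hi :: "'m \<times> 'm \<times> 'm \<Rightarrow> 'o" where "hi t \<equiv> Dom C (t_in t)"
abbreviation lo :: "'m \<times> 'm \<times> 'm \<Rightarrow> 'o" where "lo t \<equiv> Cod C (t_pr t)"

text \<open>The levels of the pieces: \<open>w_ge i X\<close> lies in \<open>ge i\<close> and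
  \<open>w_le i X\<close> in \<open>le i\<close>. Shifting by \<open>j\<close> lowers both levels by
  \<open>j\<close>.\<close>

definition ge :: "int \<Rightarrow> 'o set" where "ge i = sh_ob C (- i) ` G"
definition le :: "int \<Rightarrow> 'o set" where "le i = sh_ob C (- i) ` L"

lemma L_Ob: "L \<subseteq> Ob C" and G_Ob: "G \<subseteq> Ob C" and L_shift: "sh_ob C 1 ` L \<subseteq> L"
  using weights by (auto simp: weight_structure_def additive_class_def)

lemma ge_Ob: "U \<in> ge i \<Longrightarrow> U \<in> Ob C" and le_Ob: "V \<in> le i \<Longrightarrow> V \<in> Ob C"
  using L_Ob G_Ob by (auto simp: ge_def le_def)

lemma ge_shift: assumes "U \<in> ge i" shows "sh_ob C j U \<in> ge (i - j)"
proof -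
  obtain A where A: "A \<in> G" "U = sh_ob C (- i) A" using assms by (auto simp: ge_def)
  then have "sh_ob C j U = sh_ob C (- (i - j)) A" using G_Ob by auto
  then show ?thesis using A by (auto simp: ge_def)
qed

lemma le_shift: assumes "V \<in> le i" shows "sh_ob C j V \<in> le (i - j)"
proof -
  obtain A where A: "A \<in> L" "V = sh_ob C (- i) A" using assms by (auto simp: le_def)
  then have "sh_ob C j V = sh_ob C (- (i - j)) A" using L_Ob by auto
  then show ?thesis using A by (auto simp: le_def)
qed

lemma L_shift_nat: "B \<in> L \<Longrightarrow> sh_ob C (int n) B \<in> L"
proof (induction n)
  case (Suc n)
  have "sh_ob C (int (Suc n)) B = sh_ob C 1 (sh_ob C (int n) B)" using Suc L_Ob by auto
  then show ?case using Suc L_shift by auto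
qed (use L_Ob in auto)

lemma orth:
  assumes U: "U \<in> ge m" and V: "V \<in> le l" and "l < m"
  shows "Hom C U V = {Zer C U V}"
proof (rule Hom_shift_Zer[of m])
  obtain A where A: "A \<in> G" "U = sh_ob C (- m) A" using U by (auto simp: ge_def)
  obtain B where B: "B \<in> L" "V = sh_ob C (- l) B" using V by (auto simp: le_def)
  \<comment> \<open>This is \<open>B\<close> shifted by \<open>m - l\<close>. Splitting off one
    shift leaves a nonnegative one because \<open>l < m\<close>, and \<open>L\<close> is closed
    under those.\<close>
  have "sh_ob C m V = sh_ob C 1 (sh_ob C (int (nat (m - l - 1))) B)"
    using B L_Ob \<open>l < m\<close> by (auto simp: algebra_simps)
  then have "sh_ob C m V \<in> sh_ob C 1 ` L" using L_shift_nat[OF B(1)] by blast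
  moreover have "sh_ob C m U = A" using A G_Ob by auto
  ultimately show "Hom C (sh_ob C m U) (sh_ob C m V) = {Zer C (sh_ob C m U) (sh_ob C m V)}"
    using weights A(1) unfolding weight_structure_def orthogonal_def by blast
qed (use U V ge_Ob le_Ob in auto)

lemma orth_eq:
  assumes "U \<in> ge m" "V \<in> le l" "l < m" and w: "w \<in> Ar C" "Dom C w = U" "Cod C w = V"
  shows "w = Zer C U V"
proof -
  have "w \<in> Hom C U V" using w by (simp add: in_Hom_iff)
  then show ?thesis using orth[OF assms(1-3)] by blast
qed

text \<open>The level is that of the last vertex; the first one has level \<open>i + 1\<close>.
  Hence \<open>w_ge m\<close> and \<open>w_ge l\<close> are vertices of the triangles of levels
  \<open>m - 1\<close> and \<open>l - 1\<close>, the pair used for \<open>F\<^sub>2\<close>.\<close>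

definition wtri :: "int \<Rightarrow> 'o \<Rightarrow> 'm \<times> 'm \<times> 'm \<Rightarrow> bool" where
  "wtri i X t \<longleftrightarrow> t \<in> Dist C \<and> Cod C (t_in t) = X \<and> hi t \<in> ge (i + 1) \<and> lo t \<in> le i"

lemma wtriD:
  assumes "wtri i X t"
  shows "(t_in t, t_pr t, t_bd t) \<in> Dist C" "t_in t \<in> Ar C" "Cod C (t_in t) = X" "t_pr t \<in> Ar C"
    "Dom C (t_pr t) = X" "t_bd t \<in> Ar C" "Dom C (t_bd t) = lo t"
    "Cod C (t_bd t) = sh_ob C 1 (hi t)" "X \<in> Ob C"
    "hi t \<in> ge (i + 1)" "lo t \<in> le i"
    "t_pr t \<cdot> t_in t = Zer C (hi t) (lo t)"
proof -
  show T: "(t_in t, t_pr t, t_bd t) \<in> Dist C" using assms t_collapse[of t] by (simp add: wtri_def)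
  note D = distD[OF T]
  show "t_in t \<in> Ar C" "Cod C (t_in t) = X" "t_pr t \<in> Ar C"
    "Dom C (t_pr t) = X" "t_bd t \<in> Ar C" "Dom C (t_bd t) = lo t"
    "Cod C (t_bd t) = sh_ob C 1 (hi t)"
    "hi t \<in> ge (i + 1)" "lo t \<in> le i"
    "t_pr t \<cdot> t_in t = Zer C (hi t) (lo t)"
    using D dist_comp_Zer[OF T] assms by (simp_all add: wtri_def)
  then show "X \<in> Ob C" by auto
qed

lemma wtri_shift:
  assumes "wtri i X t"
  shows "wtri (i - 1) (sh_ob C 1 X) (sh_ar C 1 (t_in t), sh_ar C 1 (t_pr t), neg C (sh_ar C 1 (t_bd t)))"
  using dist_shift[OF wtriD(1)[OF assms], of 1] wtriD[OF assms] ge_shift[of "hi t" "i + 1" 1]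
    le_shift[of "lo t" i 1]
  by (simp add: wtri_def t_in_def[abs_def] t_pr_def sgn_ar_def)

lemma weight_choice_wtri:
  assumes "weight_choice C L G D" "X \<in> Ob C"
  shows "wtri i X (w_tri C D i X)" "Cod C (w_pr C D i X) = w_le C D i X" "Dom C (w_in C D i X) = w_ge C D i X"
    "Cod C (w_bd C D i X) = sh_ob C 1 (w_ge C D (i + 1) X)"
proof -
  have *: "Xle D i X \<in> L" "Xge D (i + 1) X \<in> G" "(wda D i X, wdb D i X, wdc D i X) \<in> Dist C"
    "triangle C (sh_ob C i X) (Xle D i X) (Xge D (i + 1) X) (wda D i X, wdb D i X, wdc D i X)" for i
    using assms by (auto simp: weight_choice_def)
  have A: "wda D i X \<in> Ar C" "wdb D i X \<in> Ar C" "wdc D i X \<in> Ar C" "Dom C (wda D i X) = sh_ob C i X"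
    "Cod C (wda D i X) = Xle D i X" "Dom C (wdb D i X) = Xle D i X" "Cod C (wdb D i X) = Xge D (i + 1) X"
    "Dom C (wdc D i X) = Xge D (i + 1) X" for i
    using *(4)[of i] by (auto simp: triangle_def in_Hom_iff)
  have O: "Xle D i X \<in> Ob C" "Xge D i X \<in> Ob C" for i
    using *(1)[of i] *(2)[of "i - 1"] L_Ob G_Ob by auto
  \<comment> \<open>The sign of the shift by \<open>-i\<close> and the sign of the backward rotation
    together make the parity test of \<open>w_in\<close> at index \<open>i + 1\<close>.\<close>
  have "neg C (sh_ar C (- 1) (sgn_ar (- i) (sh_ar C (- i) (wdc D i X)))) = w_in C D (i + 1) X"
    using A by (simp add: w_in_def sgn_ar_def Let_def minus_diff_commute)
  then have "w_tri C D i X \<in> Dist C"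
    using dist_unrotate[OF dist_shift[OF *(3), of "- i" i]] by (simp add: w_tri_def w_pr_def w_bd_def)
  moreover have "w_in C D i X \<in> Ar C \<and> Cod C (w_in C D i X) = X \<and> Dom C (w_in C D i X) = w_ge C D i X" for i
    using A[of "i - 1"] *(4)[of "i - 1"] O[of i] assms(2)
    by (auto simp: w_in_def Let_def w_ge_def triangle_def in_Hom_iff)
  moreover have "Cod C (w_pr C D i X) = w_le C D i X" using A by (simp add: w_pr_def w_le_def)
  ultimately show "wtri i X (w_tri C D i X)" "Cod C (w_pr C D i X) = w_le C D i X" "Dom C (w_in C D i X) = w_ge C D i X"
    using *(1)[of i] *(2)[of i]
    by (auto simp: wtri_def w_tri_def t_in_def t_pr_def w_le_def w_ge_def ge_def le_def)
  show "Cod C (w_bd C D i X) = sh_ob C 1 (w_ge C D (i + 1) X)" using A O by (simp add: w_bd_def w_ge_def)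
qed

subsection \<open>Morphisms of weight decompositions\<close>

lemma tri_mor_iff:
  assumes "wtri m X t" "wtri l Y t'"
  shows "tri_mor C t t' d g c \<longleftrightarrow> d \<in> Hom C (hi t) (hi t') \<and> g \<in> Hom C X Y \<and>
    c \<in> Hom C (lo t) (lo t') \<and> g \<cdot> t_in t = t_in t' \<cdot> d \<and> c \<cdot> t_pr t = t_pr t' \<cdot> g \<and>
    sh_ar C 1 d \<cdot> t_bd t = t_bd t' \<cdot> c"
proof -
  obtain t1 t2 t3 t1' t2' t3' where t: "t = (t1, t2, t3)" "t' = (t1', t2', t3')" by (metis prod_cases3)
  show ?thesis
    using wtriD(3,5)[OF assms(1)] wtriD(3,5)[OF assms(2)]
    by (simp add: t tri_mor_def t_in_def t_pr_def t_bd_def)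
qed

lemma tri_morD:
  assumes "wtri m X t" "wtri l Y t'" "tri_mor C t t' d g c"
  shows "d \<in> Hom C (hi t) (hi t')" "c \<in> Hom C (lo t) (lo t')"
    "t_in t' \<cdot> d = g \<cdot> t_in t" "c \<cdot> t_pr t = t_pr t' \<cdot> g" "sh_ar C 1 d \<cdot> t_bd t = t_bd t' \<cdot> c"
  using tri_mor_iff[OF assms(1,2)] assms(3) by (blast intro: sym)+

lemma ex_tri_mor:
  assumes t: "wtri m X t" and t': "wtri l Y t'" and "l \<le> m" and g: "g \<in> Hom C X Y"
  obtains d c where "tri_mor C t t' d g c"
proof -
  note D = wtriD[OF t] and D' = wtriD[OF t']
  have A: "g \<in> Ar C" "Dom C g = X" "Cod C g = Y" using g by (auto simp: in_Hom_iff)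
  \<comment> \<open>The composite leads from level \<open>m + 1\<close> to level \<open>l\<close>,
    so \<open>l \<le> m\<close> is enough for existence; uniqueness below asks for a gap.\<close>
  have zero: "t_pr t' \<cdot> (g \<cdot> t_in t) = Zer C (hi t) (lo t')"
    by (rule orth_eq[OF D(10) D'(11)]) (use \<open>l \<le> m\<close> D D' A in auto)
  obtain d where d: "d \<in> Ar C" "Dom C d = hi t" "Cod C d = hi t'" "t_in t' \<cdot> d = g \<cdot> t_in t"
    by (rule dist_lift[OF D'(1), of "g \<cdot> t_in t"]) (use A D D' zero in simp_all)
  then obtain c where "tri_mor C (t_in t, t_pr t, t_bd t) (t_in t', t_pr t', t_bd t') d g c"
    using TR3[OF D(1) D'(1), of d g] A D D' by (auto simp: in_Hom_iff)
  then show thesis using that t_collapse by metis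
qed

text \<open>The first vertex of \<open>t\<close> drops from level \<open>m + 1\<close> to level
  \<open>m\<close> under the shift, so its maps to level \<open>l\<close> vanish once
  \<open>l < m\<close>. Hence arrows between different levels are unique, while extensions within
  one level are not.\<close>

lemma pr_cancel:
  assumes t: "wtri m X t" and V: "V \<in> le l" and "l < m"
    and c: "c \<in> Hom C (lo t) V" "c' \<in> Hom C (lo t) V" "c \<cdot> t_pr t = c' \<cdot> t_pr t"
  shows "c = c'"
  by (rule dist_extend_eq[OF wtriD(1)[OF t] c], rule orth[of _ m _ l])
    (use ge_shift[OF wtriD(10)[OF t], of 1] V \<open>l < m\<close> in auto)

text \<open>Dually, the last vertex of \<open>t\<close> rises to level \<open>l + 1\<close> under
  the inverse shift, whence the bound on \<open>m\<close>.\<close>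

lemma in_cancel:
  assumes t: "wtri l X t" and U: "U \<in> ge m" and "l + 1 < m"
    and c: "c \<in> Hom C U (hi t)" "c' \<in> Hom C U (hi t)" "t_in t \<cdot> c = t_in t \<cdot> c'"
  shows "c = c'"
  by (rule dist_lift_eq[OF wtriD(1)[OF t] c], rule orth[of _ m _ "l + 1"])
    (use le_shift[OF wtriD(11)[OF t], of "- 1"] U \<open>l + 1 < m\<close> in auto)

lemma tri_conn:
  assumes t: "wtri m X t" and t': "wtri l X t'" and "l < m"
  shows "tri_mor C t t' (fst (tri_conn C t t' X)) (Ident C X) (snd (tri_conn C t t' X))"
proof -
  note D = wtriD[OF t] and D' = wtriD[OF t']
  obtain d c where dc: "tri_mor C t t' d (Ident C X) c"
    using ex_tri_mor[OF t t' less_imp_le[OF \<open>l < m\<close>] Id_Hom[OF D(9)]] .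
  note E = tri_morD[OF t t' dc]
  have uniq: "d' = d \<and> c' = c" if "tri_mor C t t' d' (Ident C X) c'" for d' c'
  proof
    note E' = tri_morD[OF t t' that]
    show "d' = d"
      by (rule in_cancel[OF t' D(10) _ E'(1) E(1)]) (use \<open>l < m\<close> E(3) E'(3) in simp_all)
    show "c' = c"
      by (rule pr_cancel[OF t D'(11) \<open>l < m\<close> E'(2) E(2)]) (use E(4) E'(4) in simp)
  qed
  have "tri_conn C t t' X = (d, c)"
    unfolding tri_conn_def
  proof (rule the_equality)
    show "case (d, c) of (d, c) \<Rightarrow> tri_mor C t t' d (Ident C X) c" using dc by simp
    fix p assume "case p of (d, c) \<Rightarrow> tri_mor C t t' d (Ident C X) c"
    then show "p = (d, c)" using uniq[of "fst p" "snd p"] by (simp add: case_prod_beta prod_eq_iff)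
  qed
  then show ?thesis using dc by simp
qed

end

subsection \<open>Diagrams of weight decompositions\<close>

text \<open>A diagram consists of an object and of two weight decompositions of it, of levels \<open>m\<close> and \<open>l\<close>.\<close>

abbreviation upper :: "'a \<times> 'b \<times> 'c \<Rightarrow> 'b" where "upper d \<equiv> fst (snd d)"
abbreviation lower :: "'a \<times> 'b \<times> 'c \<Rightarrow> 'c" where "lower d \<equiv> snd (snd d)"

type_synonym ('o, 'm) dgm = "'o \<times> ('m \<times> 'm \<times> 'm) \<times> ('m \<times> 'm \<times> 'm)"

context weighted_category
begin

definition dgms :: "int \<Rightarrow> int \<Rightarrow> ('o, 'm) dgm set" where
  "dgms m l = {d. wtri m (fst d) (upper d) \<and> wtri l (fst d) (lower d)}"

definition con_le :: "('o, 'm) dgm \<Rightarrow> 'm" where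
  "con_le d = snd (tri_conn C (upper d) (lower d) (fst d))"

definition con_ge :: "('o, 'm) dgm \<Rightarrow> 'm" where
  "con_ge d = fst (tri_conn C (upper d) (lower d) (fst d))"

definition p_ext :: "'m \<times> 'm \<times> 'm \<Rightarrow> 'm \<times> 'm \<times> 'm \<Rightarrow> 'm \<Rightarrow> 'm \<Rightarrow> bool" where
  "p_ext t s g b \<longleftrightarrow> b \<in> Hom C (lo t) (lo s) \<and> b \<cdot> t_pr t = t_pr s \<cdot> g"

definition i_ext :: "'m \<times> 'm \<times> 'm \<Rightarrow> 'm \<times> 'm \<times> 'm \<Rightarrow> 'm \<Rightarrow> 'm \<Rightarrow> bool" where
  "i_ext t s g b \<longleftrightarrow> b \<in> Hom C (hi t) (hi s) \<and> t_in s \<cdot> b = g \<cdot> t_in t"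

lemma p_extD:
  assumes "p_ext t s g b"
  shows "b \<in> Ar C" "Dom C b = lo t" "Cod C b = lo s" "b \<cdot> t_pr t = t_pr s \<cdot> g"
  using assms by (simp_all add: p_ext_def in_Hom_iff)

lemma i_extD:
  assumes "i_ext t s g b"
  shows "b \<in> Ar C" "Dom C b = hi t" "Cod C b = hi s" "t_in s \<cdot> b = g \<cdot> t_in t"
  using assms by (simp_all add: i_ext_def in_Hom_iff)

lemma dgmsD:
  assumes "d \<in> dgms m l" shows "wtri m (fst d) (upper d)" "wtri l (fst d) (lower d)" "fst d \<in> Ob C"
  using assms wtriD(9)[of m "fst d" "upper d"] by (simp_all add: dgms_def)

lemmas upperD = wtriD[OF dgmsD(1)] and lowerD = wtriD[OF dgmsD(2)]

lemma ex_ext: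
  assumes "wtri i X t" "wtri i Y s" "g \<in> Hom C X Y"
  shows "\<exists>b. p_ext t s g b" "\<exists>b. i_ext t s g b"
proof -
  obtain d c where "tri_mor C t s d g c" using ex_tri_mor[OF assms(1,2) _ assms(3)] by blast
  then show "\<exists>b. p_ext t s g b" "\<exists>b. i_ext t s g b"
    using tri_morD(1-4)[OF assms(1,2), of d g c] by (auto simp: p_ext_def i_ext_def)
qed

lemma ext_Ident:
  assumes "wtri i X t"
  shows "p_ext t t (Ident C X) (Ident C (lo t))" "i_ext t t (Ident C X) (Ident C (hi t))"
  using wtriD[OF assms] by (simp_all add: p_ext_def i_ext_def in_Hom_iff)

lemma ext_comp:
  assumes "wtri i X t" "wtri i' Y s" "wtri i'' Z r" "g \<in> Hom C X Y" "g' \<in> Hom C Y Z"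
  shows "\<lbrakk>p_ext t s g b; p_ext s r g' b'\<rbrakk> \<Longrightarrow> p_ext t r (g' \<cdot> g) (b' \<cdot> b)"
    "\<lbrakk>i_ext t s g b; i_ext s r g' b'\<rbrakk> \<Longrightarrow> i_ext t r (g' \<cdot> g) (b' \<cdot> b)"
proof -
  note [simp] = wtriD[OF assms(1)] wtriD[OF assms(2)] wtriD[OF assms(3)]
  have [simp]: "g \<in> Ar C" "Dom C g = X" "Cod C g = Y" "g' \<in> Ar C" "Dom C g' = Y" "Cod C g' = Z"
    using assms(4,5) by (auto simp: in_Hom_iff)
  {
    assume "p_ext t s g b" "p_ext s r g' b'"
    note b = p_extD[OF this(1)] p_extD[OF this(2)] and [simp] = p_extD(1-3)[OF this(1)] p_extD(1-3)[OF this(2)]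
    have "b' \<cdot> (t_pr s \<cdot> g) = t_pr r \<cdot> (g' \<cdot> g)" by (rule comp_square[OF b(8)]) simp_all
    then show "p_ext t r (g' \<cdot> g) (b' \<cdot> b)" using b(4) by (simp add: p_ext_def in_Hom_iff)
  }
  assume "i_ext t s g b" "i_ext s r g' b'"
  note b = i_extD[OF this(1)] i_extD[OF this(2)] and [simp] = i_extD(1-3)[OF this(1)] i_extD(1-3)[OF this(2)]
  have "t_in r \<cdot> (b' \<cdot> b) = g' \<cdot> (t_in s \<cdot> b)" by (rule comp_square[OF b(8)]) simp_all
  then show "i_ext t r (g' \<cdot> g) (b' \<cdot> b)" using b(4) by (simp add: i_ext_def in_Hom_iff)
qed

lemma ext_Add:
  assumes "wtri i X t" "wtri i Y s" "g \<in> Hom C X Y" "g' \<in> Hom C X Y"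
  shows "\<lbrakk>p_ext t s g b; p_ext t s g' b'\<rbrakk> \<Longrightarrow> p_ext t s (g \<oplus> g') (b \<oplus> b')"
    "\<lbrakk>i_ext t s g b; i_ext t s g' b'\<rbrakk> \<Longrightarrow> i_ext t s (g \<oplus> g') (b \<oplus> b')"
  using wtriD[OF assms(1)] wtriD[OF assms(2)] assms(3,4)
  by (simp_all add: p_ext_def i_ext_def in_Hom_iff comp_Add Add_comp)

context
  fixes m l :: int assumes lm: "l < m"
begin

lemma con_Ar:
  assumes d: "d \<in> dgms m l"
  shows "con_le d \<in> Ar C" "Dom C (con_le d) = lo (upper d)" "Cod C (con_le d) = lo (lower d)"
    "con_ge d \<in> Ar C" "Dom C (con_ge d) = hi (upper d)" "Cod C (con_ge d) = hi (lower d)"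
    "con_le d \<cdot> t_pr (upper d) = t_pr (lower d)" "t_in (lower d) \<cdot> con_ge d = t_in (upper d)"
    "t_bd (lower d) \<cdot> con_le d = sh_ar C 1 (con_ge d) \<cdot> t_bd (upper d)"
  using tri_morD[OF dgmsD(1,2)[OF d] tri_conn[OF dgmsD(1,2)[OF d] lm]] upperD[OF d] lowerD[OF d]
  by (simp_all add: con_le_def con_ge_def in_Hom_iff)

text \<open>Both sides agree after composition with a structure map of a decomposition, and they
  join pieces separated by the gap \<open>l < m\<close>. So \<open>pr_cancel\<close> and
  \<open>in_cancel\<close> apply, whichever extensions were taken.\<close>

lemma con_natural:
  assumes d: "d \<in> dgms m l" "d' \<in> dgms m l" and g: "g \<in> Hom C (fst d) (fst d')"
  shows "\<lbrakk>p_ext (upper d) (upper d') g a; p_ext (lower d) (lower d') g b\<rbrakk> \<Longrightarrow> b \<cdot> con_le d = con_le d' \<cdot> a"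
    "\<lbrakk>i_ext (upper d) (upper d') g a; i_ext (lower d) (lower d') g b\<rbrakk> \<Longrightarrow> b \<cdot> con_ge d = con_ge d' \<cdot> a"
proof -
  note [simp] = con_Ar(1-6)[OF d(1)] con_Ar(1-6)[OF d(2)] upperD[OF d(1)] lowerD[OF d(1)]
    upperD[OF d(2)] lowerD[OF d(2)] g[unfolded in_Hom_iff]
  {
    assume ab: "p_ext (upper d) (upper d') g a" "p_ext (lower d) (lower d') g b"
    note [simp] = p_extD(1-3)[OF ab(1)] p_extD(1-3)[OF ab(2)]
    show "b \<cdot> con_le d = con_le d' \<cdot> a"
    proof (rule pr_cancel[OF dgmsD(1)[OF d(1)] lowerD(11)[OF d(2)] lm])
      have "(b \<cdot> con_le d) \<cdot> t_pr (upper d) = t_pr (lower d') \<cdot> g"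
        using con_Ar(7)[OF d(1)] ab(2) by (simp add: p_ext_def)
      also have "\<dots> = con_le d' \<cdot> (t_pr (upper d') \<cdot> g)"
        by (rule comp_reduce[OF con_Ar(7)[OF d(2)], symmetric]) simp_all
      finally show "(b \<cdot> con_le d) \<cdot> t_pr (upper d) = (con_le d' \<cdot> a) \<cdot> t_pr (upper d)"
        using ab(1) by (simp add: p_ext_def)
    qed (simp_all add: in_Hom_iff)
  }
  assume ab: "i_ext (upper d) (upper d') g a" "i_ext (lower d) (lower d') g b"
  note [simp] = i_extD(1-3)[OF ab(1)] i_extD(1-3)[OF ab(2)] and e = i_extD(4)[OF ab(1)] i_extD(4)[OF ab(2)]
  show "b \<cdot> con_ge d = con_ge d' \<cdot> a"
  proof (rule in_cancel[OF dgmsD(2)[OF d(2)] upperD(10)[OF d(1)]])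
    have "t_in (lower d') \<cdot> (b \<cdot> con_ge d) = g \<cdot> (t_in (lower d) \<cdot> con_ge d)"
      by (rule comp_square[OF e(2)]) simp_all
    also have "\<dots> = t_in (lower d') \<cdot> (con_ge d' \<cdot> a)"
      unfolding con_Ar(8)[OF d(1)] e(1)[symmetric] by (rule comp_reduce[OF con_Ar(8)[OF d(2)], symmetric]) simp_all
    finally show "t_in (lower d') \<cdot> (b \<cdot> con_ge d) = t_in (lower d') \<cdot> (con_ge d' \<cdot> a)" .
  qed (use lm in \<open>simp_all add: in_Hom_iff\<close>)
qed

end

section \<open>Shifted decompositions and the boundary map\<close>

definition sh_tri :: "'m \<times> 'm \<times> 'm \<Rightarrow> 'm \<times> 'm \<times> 'm" where
  "sh_tri t = (sh_ar C 1 (t_in t), sh_ar C 1 (t_pr t), neg C (sh_ar C 1 (t_bd t)))"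

definition sh_dgm :: "('o, 'm) dgm \<Rightarrow> ('o, 'm) dgm" where
  "sh_dgm d = (sh_ob C 1 (fst d), sh_tri (upper d), sh_tri (lower d))"

lemma sh_dgm_simps [simp]:
  "fst (sh_dgm d) = sh_ob C 1 (fst d)" "t_in (upper (sh_dgm d)) = sh_ar C 1 (t_in (upper d))"
  "t_in (lower (sh_dgm d)) = sh_ar C 1 (t_in (lower d))"
  by (simp_all add: sh_dgm_def sh_tri_def t_in_def)

lemma sh_dgm: "d \<in> dgms m l \<Longrightarrow> sh_dgm d \<in> dgms (m - 1) (l - 1)"
  using wtri_shift unfolding dgms_def sh_dgm_def sh_tri_def by auto

text \<open>Both arrows lift the same map to the shifted object, and such lifts are unique by
  \<open>in_cancel\<close>.\<close>

lemma con_ge_sh_dgm: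
  assumes "l < m" and d: "d \<in> dgms m l" shows "con_ge (sh_dgm d) = sh_ar C 1 (con_ge d)"
proof (rule in_cancel[OF dgmsD(2)[OF sh_dgm[OF d]], of _ m])
  note c = con_Ar[OF \<open>l < m\<close> d] and s = con_Ar[OF _ sh_dgm[OF d]]
  note [simp] = upperD[OF d] lowerD[OF d]
  show "sh_ob C 1 (hi (upper d)) \<in> ge m"
    using ge_shift[OF upperD(10)[OF d], of 1] by simp
  show "con_ge (sh_dgm d) \<in> Hom C (sh_ob C 1 (hi (upper d))) (hi (lower (sh_dgm d)))"
    using s \<open>l < m\<close> by (simp add: in_Hom_iff)
  show "sh_ar C 1 (con_ge d) \<in> Hom C (sh_ob C 1 (hi (upper d))) (hi (lower (sh_dgm d)))"
    using c by (simp add: in_Hom_iff)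
  have "sh_ar C 1 (t_in (lower d)) \<cdot> sh_ar C 1 (con_ge d) = sh_ar C 1 (t_in (lower d) \<cdot> con_ge d)"
    using c(4,5,6) by (intro sh_ar_comp[symmetric]) auto
  then show "t_in (lower (sh_dgm d)) \<cdot> con_ge (sh_dgm d) = t_in (lower (sh_dgm d)) \<cdot> sh_ar C 1 (con_ge d)"
    using s(8) c(8) \<open>l < m\<close> by simp
qed (use \<open>l < m\<close> in simp)

definition w_dgm :: "('o, 'm) wchoice \<Rightarrow> int \<Rightarrow> int \<Rightarrow> 'o \<Rightarrow> ('o, 'm) dgm" where
  "w_dgm D m l X = (X, w_tri C D m X, w_tri C D l X)"

lemma w_dgm_simps [simp]:
  "fst (w_dgm D m l X) = X" "upper (w_dgm D m l X) = w_tri C D m X" "lower (w_dgm D m l X) = w_tri C D l X"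
  "t_in (w_tri C D m X) = w_in C D (m + 1) X" "t_pr (w_tri C D m X) = w_pr C D m X" "t_bd (w_tri C D m X) = w_bd C D m X"
  by (simp_all add: w_dgm_def w_tri_def t_in_def t_pr_def t_bd_def)

lemma w_dgm: "\<lbrakk>weight_choice C L G D; X \<in> Ob C\<rbrakk> \<Longrightarrow> w_dgm D m l X \<in> dgms m l"
  by (simp add: dgms_def weight_choice_wtri)

lemma con_w_dgm: "con_le (w_dgm D m l X) = conn_le C D m l X"
  "con_ge (w_dgm D (m - 1) (l - 1) X) = conn_ge C D m l X"
  by (simp_all add: con_le_def con_ge_def w_dgm_def conn_le_def conn_ge_def tri_conn_def w_conn_def)

lemma t_in_sh_tri [simp]: "t_in (sh_tri t) = sh_ar C 1 (t_in t)"
  by (simp add: sh_tri_def t_in_def)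

text \<open>One morphism of decompositions over \<open>g\<close> supplies all that
  \<open>connect_natural\<close> asks for: an extension of \<open>g\<close> on the last vertices,
  one of its shift on the shifted first vertices, and the boundary square between them.\<close>

lemma i_ext_sh:
  assumes "tri_mor C t t' d g c" "wtri i X t" "wtri i' Y t'" and g: "g \<in> Hom C X Y"
  shows "i_ext (sh_tri t) (sh_tri t') (sh_ar C 1 g) (sh_ar C 1 d)" "sh_ar C 1 d \<cdot> t_bd t = t_bd t' \<cdot> c"
    "p_ext t t' g c"
proof -
  note D = tri_morD[OF assms(2,3,1)]
  note [simp] = wtriD[OF assms(2)] wtriD[OF assms(3)]
  have d: "d \<in> Ar C" "Dom C d = hi t" "Cod C d = hi t'" "g \<in> Ar C" "Dom C g = X" "Cod C g = Y"
    using D(1) g by (simp_all add: in_Hom_iff)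
  have "sh_ar C 1 (t_in t') \<cdot> sh_ar C 1 d = sh_ar C 1 (g \<cdot> t_in t)"
    unfolding D(3)[symmetric] using d by simp
  then show "i_ext (sh_tri t) (sh_tri t') (sh_ar C 1 g) (sh_ar C 1 d)"
    using d by (simp add: i_ext_def in_Hom_iff)
  show "sh_ar C 1 d \<cdot> t_bd t = t_bd t' \<cdot> c" "p_ext t t' g c" using D by (simp_all add: p_ext_def)
qed

lemma con_bd:
  assumes "l < m" "d \<in> dgms m l"
  shows "t_bd (lower d) \<cdot> con_le d = con_ge (sh_dgm d) \<cdot> t_bd (upper d)"
  using con_Ar(9)[OF assms] con_ge_sh_dgm[OF assms] by simp

lemma con_sh_Ar:
  assumes "l < m" "d \<in> dgms m l"
  shows "con_ge (sh_dgm d) \<in> Ar C" "Dom C (con_ge (sh_dgm d)) = Cod C (t_bd (upper d))"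
    "Cod C (con_ge (sh_dgm d)) = Cod C (t_bd (lower d))"
    "sh_ar C 1 (t_in (lower d)) \<cdot> con_ge (sh_dgm d) = sh_ar C 1 (t_in (upper d))"
  using con_Ar(4,5,6,8)[OF _ sh_dgm[OF assms(2)]] assms(1)
    upperD[OF assms(2)] lowerD[OF assms(2)] by simp_all

lemma upper_lower_sh_dgm [simp]: "upper (sh_dgm d) = sh_tri (upper d)" "lower (sh_dgm d) = sh_tri (lower d)"
  by (simp_all add: sh_dgm_def)

subsection \<open>Cones of maps between pieces of adjacent weights\<close>

text \<open>If \<open>X \<rightarrow> Y \<rightarrow> Z\<close> is distinguished, then the cone \<open>V\<close> of \<open>w\<^sub>\<le>\<^sub>l\<^sub>+\<^sub>1 X \<rightarrow> w\<^sub>\<le>\<^sub>l Y\<close> is orthogonal to the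
  weights above \<open>l\<close>, so that \<open>Z \<rightarrow> V\<close> factors through \<open>w\<^sub>\<le>\<^sub>l Z\<close>.\<close>

lemma le_cone:
  assumes T: "(f, g, h) \<in> Dist C" and d: "d\<^sub>1 \<in> dgms (l + 1) l" "d\<^sub>2 \<in> dgms (l + 1) l" "d\<^sub>3 \<in> dgms (l + 1) l"
    and f: "f \<in> Hom C (fst d\<^sub>1) (fst d\<^sub>2)" and g: "g \<in> Hom C (fst d\<^sub>2) (fst d\<^sub>3)"
    and a: "p_ext (upper d\<^sub>1) (upper d\<^sub>2) f a" and b: "p_ext (lower d\<^sub>2) (lower d\<^sub>3) g b"
  obtains v h' u where "(con_le d\<^sub>2 \<cdot> a, v, h') \<in> Dist C" "u \<in> Ar C" "Dom C u = lo (lower d\<^sub>3)"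
    "u \<cdot> (b \<cdot> con_le d\<^sub>2) = v \<cdot> con_le d\<^sub>2"
proof -
  have l: "l < l + 1" by simp
  let ?t = "upper d\<^sub>1" and ?s = "upper d\<^sub>2" and ?s' = "lower d\<^sub>2" and ?r = "lower d\<^sub>3"
  note t = dgmsD(1)[OF d(1)] dgmsD(1)[OF d(2)] dgmsD(2)[OF d(2)] dgmsD(2)[OF d(3)]
  note k = con_Ar(7)[OF l d(2)]
  note [simp] = wtriD[OF t(1)] wtriD[OF t(2)] wtriD[OF t(3)] wtriD[OF t(4)] distD[OF T] con_Ar(1-3)[OF l d(2)]
  note ea = p_extD(4)[OF a] and eb = p_extD(4)[OF b]
  note [simp] = f[unfolded in_Hom_iff] g[unfolded in_Hom_iff] p_extD(1-3)[OF a] p_extD(1-3)[OF b]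
  have c: "t_pr ?s' \<cdot> f = (con_le d\<^sub>2 \<cdot> a) \<cdot> t_pr ?t"
    using comp_reduce[OF k, of f] ea by simp
  obtain v h' where V: "(con_le d\<^sub>2 \<cdot> a, v, h') \<in> Dist C" using TR1_cone[of "con_le d\<^sub>2 \<cdot> a"] by auto
  have vA [simp]: "v \<in> Ar C" "Dom C v = lo ?s'" "h' \<in> Ar C" "Dom C h' = Cod C v"
    "Cod C h' = sh_ob C 1 (lo ?t)"
    using distD[OF V] by simp_all
  \<comment> \<open>The cone sits between the level \<open>l\<close> piece of \<open>Y\<close> and
    the shift of the level \<open>l + 1\<close> piece of \<open>X\<close>; that shift has level
    \<open>l\<close> because the two levels are adjacent.\<close>
  have orthV: "Hom C W (Cod C v) = {Zer C W (Cod C v)}" if W: "W \<in> ge (l + 1)" for W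
  proof
    show "Hom C W (Cod C v) \<subseteq> {Zer C W (Cod C v)}"
    proof
      fix x assume "x \<in> Hom C W (Cod C v)"
      then have x [simp]: "x \<in> Ar C" "Dom C x = W" "Cod C x = Cod C v" by (auto simp: in_Hom_iff)
      have zero: "h' \<cdot> x = Zer C W (sh_ob C 1 (lo ?t))"
        by (rule orth_eq[OF W le_shift[OF wtriD(11)[OF t(1)], of 1]]) simp_all
      obtain w where w: "w \<in> Ar C" "Dom C w = W" "Cod C w = lo ?s'" "v \<cdot> w = x"
        by (rule dist_lift[OF dist_rotate[OF V] x(1)]) (use zero in simp_all)
      have "w = Zer C W (lo ?s')"
        by (rule orth_eq[OF W wtriD(11)[OF t(3)]]) (use w in simp_all)
      then show "x \<in> {Zer C W (Cod C v)}" using w ge_Ob[OF W] by auto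
    qed
  qed (use ge_Ob[OF that] in \<open>auto simp: in_Hom_iff\<close>)
  obtain z where z: "tri_mor C (f, g, h) (con_le d\<^sub>2 \<cdot> a, v, h') (t_pr ?t) (t_pr ?s') z"
    using TR3[OF T V, of "t_pr ?t" "t_pr ?s'"] c by (auto simp: in_Hom_iff)
  then have zA [simp]: "z \<in> Ar C" "Dom C z = fst d\<^sub>3" "Cod C z = Cod C v" and zg: "z \<cdot> g = v \<cdot> t_pr ?s'"
    by (auto simp: tri_mor_def in_Hom_iff)
  have "z \<cdot> t_in ?r \<in> Hom C (hi ?r) (Cod C v)" by (simp add: in_Hom_iff)
  then have zero: "z \<cdot> t_in ?r = Zer C (hi ?r) (Cod C v)"
    using orthV[OF wtriD(10)[OF t(4)]] by auto
  obtain u where u: "u \<in> Ar C" "Dom C u = lo ?r" "Cod C u = Cod C v" "u \<cdot> t_pr ?r = z"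
    by (rule dist_extend[OF wtriD(1)[OF t(4)] zA(1)]) (use zero in simp_all)
  \<comment> \<open>Composition with \<open>con_le\<close> moves the comparison to the upper
    triangle of \<open>Y\<close>: its first vertex has shift of level \<open>l + 1\<close>, which
    \<open>orthV\<close> covers, whereas that of the lower triangle has shift of level
    \<open>l\<close>.\<close>
  have "u \<cdot> (b \<cdot> con_le d\<^sub>2) = v \<cdot> con_le d\<^sub>2"
  proof (rule dist_extend_eq[OF wtriD(1)[OF t(2)]])
    note [simp] = u(1-3)
    have "(u \<cdot> (b \<cdot> con_le d\<^sub>2)) \<cdot> t_pr ?s = u \<cdot> (t_pr ?r \<cdot> g)" using k eb by simp
    also have "\<dots> = z \<cdot> g" by (rule comp_reduce[OF u(4)]) simp_all
    also have "\<dots> = (v \<cdot> con_le d\<^sub>2) \<cdot> t_pr ?s" using k zg by simp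
    finally show "(u \<cdot> (b \<cdot> con_le d\<^sub>2)) \<cdot> t_pr ?s = (v \<cdot> con_le d\<^sub>2) \<cdot> t_pr ?s" .
    show "Hom C (sh_ob C 1 (hi ?s)) (Cod C v) = {Zer C (sh_ob C 1 (hi ?s)) (Cod C v)}"
      by (rule orthV) (use ge_shift[OF wtriD(10)[OF t(2)], of 1] in \<open>simp add: add.commute\<close>)
  qed (simp_all add: in_Hom_iff u(1-3))
  then show thesis using that[OF V] u by simp
qed

text \<open>Dually, the fibre of \<open>w\<^sub>\<ge>\<^sub>l\<^sub>+\<^sub>2 Y \<rightarrow> w\<^sub>\<ge>\<^sub>l\<^sub>+\<^sub>1 Z\<close> is orthogonal to the weights below \<open>l + 2\<close>, so that its
  map to \<open>X\<close> lifts to \<open>w\<^sub>\<ge>\<^sub>l\<^sub>+\<^sub>2 X\<close>.\<close>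

lemma ge_cone:
  assumes T: "(f, g, h) \<in> Dist C" and d: "d\<^sub>1 \<in> dgms (l + 1) l" "d\<^sub>2 \<in> dgms (l + 1) l" "d\<^sub>3 \<in> dgms (l + 1) l"
    and f: "f \<in> Hom C (fst d\<^sub>1) (fst d\<^sub>2)" and g: "g \<in> Hom C (fst d\<^sub>2) (fst d\<^sub>3)"
    and a: "i_ext (upper d\<^sub>1) (upper d\<^sub>2) f a" and b: "i_ext (upper d\<^sub>2) (upper d\<^sub>3) g b"
  obtains v h' u where "(v, con_ge d\<^sub>3 \<cdot> b, h') \<in> Dist C" "u \<in> Ar C" "Cod C u = hi (upper d\<^sub>1)"
    "con_ge d\<^sub>2 \<cdot> (a \<cdot> u) = con_ge d\<^sub>2 \<cdot> v"
proof -
  have l: "l < l + 1" by simp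
  let ?t = "upper d\<^sub>1" and ?s = "upper d\<^sub>2" and ?s' = "lower d\<^sub>2" and ?r = "lower d\<^sub>3"
  note t = dgmsD(1)[OF d(1)] dgmsD(1)[OF d(2)] dgmsD(2)[OF d(2)] dgmsD(2)[OF d(3)]
  note k = con_Ar(8)[OF l d(2)]
  note [simp] = wtriD[OF t(1)] wtriD[OF t(2)] wtriD[OF t(3)] wtriD[OF t(4)] distD[OF T]
    con_Ar(4-6)[OF l d(2)] con_Ar(4-6)[OF l d(3)]
  note ea = i_extD(4)[OF a] and eb = i_extD(4)[OF b]
  note [simp] = f[unfolded in_Hom_iff] g[unfolded in_Hom_iff] i_extD(1-3)[OF a] i_extD(1-3)[OF b]
  have c: "t_in ?r \<cdot> (con_ge d\<^sub>3 \<cdot> b) = g \<cdot> t_in ?s"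
    using comp_reduce[OF con_Ar(8)[OF l d(3)], of b] eb by simp
  obtain v h' where V: "(v, con_ge d\<^sub>3 \<cdot> b, h') \<in> Dist C" using dist_fibre[of "con_ge d\<^sub>3 \<cdot> b"] by auto
  have vA [simp]: "v \<in> Ar C" "Cod C v = hi ?s" "h' \<in> Ar C" "Dom C h' = hi ?r"
    "Cod C h' = sh_ob C 1 (Dom C v)"
    using distD[OF V] by simp_all
  \<comment> \<open>The fibre sits between \<open>hi ?s\<close>, of level \<open>l + 2\<close>, and
    the inverse shift of \<open>hi ?r\<close>, which rises from level \<open>l + 1\<close> to
    \<open>l + 2\<close>.\<close>
  have orthV: "Hom C (Dom C v) W = {Zer C (Dom C v) W}" if W: "W \<in> le (l + 1)" for W
  proof
    note [simp] = le_Ob[OF W]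
    show "Hom C (Dom C v) W \<subseteq> {Zer C (Dom C v) W}"
    proof
      fix x assume "x \<in> Hom C (Dom C v) W"
      then have x [simp]: "x \<in> Ar C" "Dom C x = Dom C v" "Cod C x = W" by (auto simp: in_Hom_iff)
      have zero: "x \<cdot> neg C (sh_ar C (- 1) h') = Zer C (sh_ob C (- 1) (hi ?r)) W"
        by (rule orth_eq[OF ge_shift[OF wtriD(10)[OF t(4)], of "- 1"] W]) simp_all
      obtain w where w: "w \<in> Ar C" "Dom C w = hi ?s" "Cod C w = W" "w \<cdot> v = x"
        by (rule dist_extend[OF dist_unrotate[OF V] x(1)]) (use zero in simp_all)
      have "w = Zer C (hi ?s) W"
        by (rule orth_eq[OF wtriD(10)[OF t(2)] W]) (use w in simp_all)
      then show "x \<in> {Zer C (Dom C v) W}" using w by auto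
    qed
  qed (use le_Ob[OF that] in \<open>auto simp: in_Hom_iff\<close>)
  obtain z where z: "tri_mor C (v, con_ge d\<^sub>3 \<cdot> b, h') (f, g, h) z (t_in ?s) (t_in ?r)"
    using TR3_left[OF V T, of "t_in ?s" "t_in ?r"] c by (auto simp: in_Hom_iff)
  then have zA [simp]: "z \<in> Ar C" "Dom C z = Dom C v" "Cod C z = fst d\<^sub>1" and zg: "t_in ?s \<cdot> v = f \<cdot> z"
    by (auto simp: tri_mor_def in_Hom_iff)
  have "t_pr ?t \<cdot> z \<in> Hom C (Dom C v) (lo ?t)" by (simp add: in_Hom_iff)
  then have zero: "t_pr ?t \<cdot> z = Zer C (Dom C v) (lo ?t)"
    using orthV[OF wtriD(11)[OF t(1)]] by auto
  obtain u where u: "u \<in> Ar C" "Dom C u = Dom C v" "Cod C u = hi ?t" "t_in ?t \<cdot> u = z"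
    by (rule dist_lift[OF wtriD(1)[OF t(1)] zA(1)]) (use zero in simp_all)
  \<comment> \<open>Composition with \<open>con_ge\<close> moves the comparison to the lower
    triangle of \<open>Y\<close>, whose last vertex has inverse shift of level \<open>l + 1\<close>,
    within reach of \<open>orthV\<close>.\<close>
  have "con_ge d\<^sub>2 \<cdot> (a \<cdot> u) = con_ge d\<^sub>2 \<cdot> v"
  proof (rule dist_lift_eq[OF wtriD(1)[OF t(3)]])
    note [simp] = u(1-3)
    have "t_in ?s' \<cdot> (con_ge d\<^sub>2 \<cdot> (a \<cdot> u)) = t_in ?s \<cdot> (a \<cdot> u)" by (rule comp_reduce[OF k]) simp_all
    also have "\<dots> = f \<cdot> (t_in ?t \<cdot> u)" by (rule comp_square[OF ea]) simp_all
    also have "\<dots> = t_in ?s \<cdot> v" using u(4) zg by simp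
    also have "\<dots> = t_in ?s' \<cdot> (con_ge d\<^sub>2 \<cdot> v)" by (rule comp_reduce[OF k, symmetric]) simp_all
    finally show "t_in ?s' \<cdot> (con_ge d\<^sub>2 \<cdot> (a \<cdot> u)) = t_in ?s' \<cdot> (con_ge d\<^sub>2 \<cdot> v)" .
    show "Hom C (Dom C v) (sh_ob C (- 1) (lo ?s')) = {Zer C (Dom C v) (sh_ob C (- 1) (lo ?s'))}"
      by (rule orthV) (use le_shift[OF wtriD(11)[OF t(3)], of "- 1"] in simp)
  qed (simp_all add: in_Hom_iff u(1-3))
  then show thesis using that[OF V] u by simp
qed

end

section \<open>The functors \<open>F\<^sub>1\<close> and \<open>F\<^sub>2\<close>\<close>

context weighted_category
begin

text \<open>Reduces a diagram system to properties of extensions between single triangles of equal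
  level, so that sources and targets are treated alike. The instances are \<open>p_ext\<close> with
  vertex \<open>lo\<close> and \<open>i_ext\<close> with vertex \<open>hi\<close>.\<close>

lemma diagram_systemI:
  assumes Id: "\<And>i X t. wtri i X t \<Longrightarrow> ext t t (Ident C X) (Ident C (piece t))"
    and ex: "\<And>i X Y t s g. \<lbrakk>wtri i X t; wtri i Y s; g \<in> Hom C X Y\<rbrakk> \<Longrightarrow> \<exists>b. ext t s g b"
    and comp: "\<And>i X Y Z t s r g g' b b'. \<lbrakk>wtri i X t; wtri i Y s; wtri i Z r; g \<in> Hom C X Y; g' \<in> Hom C Y Z;
      ext t s g b; ext s r g' b'\<rbrakk> \<Longrightarrow> ext t r (g' \<cdot> g) (b' \<cdot> b)"
    and Add: "\<And>i X Y t s g g' b b'. \<lbrakk>wtri i X t; wtri i Y s; g \<in> Hom C X Y; g' \<in> Hom C X Y;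
      ext t s g b; ext t s g' b'\<rbrakk> \<Longrightarrow> ext t s (g \<oplus> g') (b \<oplus> b')"
    and Hom: "\<And>t s g b. ext t s g b \<Longrightarrow> b \<in> Hom C (piece t) (piece s)"
    and con: "\<And>d. d \<in> dgms m l \<Longrightarrow> con d \<in> Hom C (piece (upper d)) (piece (lower d))"
    and nat: "\<And>d d' g a b. \<lbrakk>d \<in> dgms m l; d' \<in> dgms m l; g \<in> Hom C (fst d) (fst d'); ext (upper d) (upper d') g a;
      ext (lower d) (lower d') g b\<rbrakk> \<Longrightarrow> b \<cdot> con d = con d' \<cdot> a"
  shows "diagram_system C (dgms m l) fst con (\<lambda>d d'. ext (upper d) (upper d')) (\<lambda>d d'. ext (lower d) (lower d'))"
proof (intro diagram_system.intro diagram_system_axioms.intro preadditive_category_axioms)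
  fix d d' d'' g g' a a' b b'
  {
    assume d: "d \<in> dgms m l"
    note D = dgmsD[OF d] and c = con[OF d, unfolded in_Hom_iff]
    show "con d \<in> Ar C" "fst d \<in> Ob C" using c D by simp_all
    show "ext (upper d) (upper d) (Ident C (fst d)) (Ident C (Dom C (con d)))"
      "ext (lower d) (lower d) (Ident C (fst d)) (Ident C (Cod C (con d)))"
      using Id[OF D(1)] Id[OF D(2)] c by simp_all
    assume d': "d' \<in> dgms m l"
    note D' = dgmsD[OF d'] and c' = con[OF d', unfolded in_Hom_iff]
    show "ext (upper d) (upper d') g a \<Longrightarrow> a \<in> Hom C (Dom C (con d)) (Dom C (con d'))"
      "ext (lower d) (lower d') g b \<Longrightarrow> b \<in> Hom C (Cod C (con d)) (Cod C (con d'))"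
      using Hom c c' by simp_all
    assume g: "g \<in> Hom C (fst d) (fst d')"
    show "\<exists>a. ext (upper d) (upper d') g a" "\<exists>b. ext (lower d) (lower d') g b"
      using ex[OF _ _ g] D D' by blast+
    show "\<lbrakk>ext (upper d) (upper d') g a; ext (lower d) (lower d') g b\<rbrakk> \<Longrightarrow> b \<cdot> con d = con d' \<cdot> a"
      by (rule nat[OF d d' g])
    show "\<lbrakk>g' \<in> Hom C (fst d) (fst d'); ext (upper d) (upper d') g a; ext (upper d) (upper d') g' a'\<rbrakk>
        \<Longrightarrow> ext (upper d) (upper d') (g \<oplus> g') (a \<oplus> a')"
      "\<lbrakk>g' \<in> Hom C (fst d) (fst d'); ext (lower d) (lower d') g b; ext (lower d) (lower d') g' b'\<rbrakk>
        \<Longrightarrow> ext (lower d) (lower d') (g \<oplus> g') (b \<oplus> b')"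
      by (rule Add[OF D(1) D'(1) g] Add[OF D(2) D'(2) g]; assumption)+
    assume d'': "d'' \<in> dgms m l"
    note D'' = dgmsD[OF d'']
    show "\<lbrakk>g' \<in> Hom C (fst d') (fst d''); ext (upper d) (upper d') g a; ext (upper d') (upper d'') g' a'\<rbrakk>
        \<Longrightarrow> ext (upper d) (upper d'') (g' \<cdot> g) (a' \<cdot> a)"
      "\<lbrakk>g' \<in> Hom C (fst d') (fst d''); ext (lower d) (lower d') g b; ext (lower d') (lower d'') g' b'\<rbrakk>
        \<Longrightarrow> ext (lower d) (lower d'') (g' \<cdot> g) (b' \<cdot> b)"
      by (rule comp[OF D(1) D'(1) D''(1) g] comp[OF D(2) D'(2) D''(2) g]; assumption)+
  }
qed

lemma le_diagrams:
  assumes lm: "l < m"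
  shows "diagram_under C (dgms m l) fst con_le (\<lambda>d d'. p_ext (upper d) (upper d')) (\<lambda>d d'. p_ext (lower d) (lower d'))
    (\<lambda>d. t_pr (upper d))"
proof (intro diagram_under.intro diagram_under_axioms.intro
    diagram_systemI[of p_ext lo, OF ext_Ident(1) ex_ext(1) ext_comp(1) ext_Add(1) _ _ con_natural(1)[OF lm]])
qed (use con_Ar[OF lm] wtriD[OF dgmsD(1)] in \<open>auto simp: p_ext_def in_Hom_iff\<close>)

lemma ge_diagrams:
  assumes lm: "l < m"
  shows "diagram_over C (dgms m l) fst con_ge (\<lambda>d d'. i_ext (upper d) (upper d')) (\<lambda>d d'. i_ext (lower d) (lower d'))
    (\<lambda>d. t_in (lower d))"
proof (intro diagram_over.intro diagram_over_axioms.intro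
    diagram_systemI[of i_ext hi, OF ext_Ident(2) ex_ext(2) ext_comp(2) ext_Add(2) _ _ con_natural(2)[OF lm]])
qed (use con_Ar[OF lm] wtriD[OF dgmsD(2)] in \<open>auto simp: i_ext_def in_Hom_iff\<close>)

lemma le_ext_iff:
  assumes "weight_choice C L G D" "weight_choice C L G D'" "g \<in> Ar C"
  shows "le_ext C D D' i g b \<longleftrightarrow> p_ext (w_tri C D i (Dom C g)) (w_tri C D' i (Cod C g)) g b"
  using weight_choice_wtri(2)[OF assms(1), of "Dom C g" i] weight_choice_wtri(2)[OF assms(2), of "Cod C g" i] assms(3)
  by (simp add: le_ext_def p_ext_def)

lemma ge_ext_iff:
  assumes "weight_choice C L G D" "weight_choice C L G D'" "g \<in> Ar C"
  shows "ge_ext C D D' i g b \<longleftrightarrow> i_ext (w_tri C D (i - 1) (Dom C g)) (w_tri C D' (i - 1) (Cod C g)) g b"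
  using weight_choice_wtri(3)[OF assms(1), of "Dom C g" i] weight_choice_wtri(3)[OF assms(2), of "Cod C g" i] assms(3)
  by (simp add: ge_ext_def i_ext_def)

lemma sh_ext_iff:
  assumes D: "weight_choice C L G D" and X: "X \<in> Ob C"
  shows "sh_ext C D i X u \<longleftrightarrow>
    i_ext (sh_tri (w_tri C D i X)) (w_tri C D (i - 1) (sh_ob C 1 X)) (Ident C (sh_ob C 1 X)) u"
proof -
  have "w_in C D (i + 1) X \<in> Ar C" "Cod C (w_in C D (i + 1) X) = X"
    using wtriD(2,3)[OF weight_choice_wtri(1)[OF D X, of i]] by simp_all
  then show ?thesis
    using weight_choice_wtri(3)[OF D X, of "i + 1"] weight_choice_wtri(3)[OF D, of "sh_ob C 1 X" i] X
    by (simp add: sh_ext_def i_ext_def)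
qed

end

locale weight_system = weighted_category C L G + A: normal_category A
  for C :: "('o, 'm, 'y) tricategory_scheme" (structure) and L G :: "'o set"
    and A :: "('p, 'n, 'z) precategory_scheme" +
  fixes m l :: int and F :: "('o, 'm, 'p, 'n) cfunctor"
  assumes lm: "l < m"
begin

lemma lm1: "l - 1 < m - 1"
  using lm by simp

abbreviation dle :: "('o, 'm) wchoice \<Rightarrow> 'o \<Rightarrow> ('o, 'm) dgm" where "dle D \<equiv> w_dgm D m l"
abbreviation dge :: "('o, 'm) wchoice \<Rightarrow> 'o \<Rightarrow> ('o, 'm) dgm" where "dge D \<equiv> w_dgm D (m - 1) (l - 1)"

end

subsection \<open>Covariant functors\<close>

locale covariant_system = weight_system C L G A m l F
  for C :: "('o, 'm, 'y) tricategory_scheme" (structure) and L G :: "'o set"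
    and A :: "('p, 'n, 'z) precategory_scheme" and m l F +
  assumes F: "is_functor C A F"

sublocale covariant_system \<subseteq> image_pair C A F
  "dgms m l" fst con_le "\<lambda>d d'. p_ext (upper d) (upper d')" "\<lambda>d d'. p_ext (lower d) (lower d')" "\<lambda>d. t_pr (upper d)"
  "dgms (m - 1) (l - 1)" fst con_ge "\<lambda>d d'. i_ext (upper d) (upper d')" "\<lambda>d d'. i_ext (lower d) (lower d')" "\<lambda>d. t_in (lower d)"
  using le_diagrams[OF lm] ge_diagrams[OF lm1] F
  by (intro image_pair.intro image_under.intro image_over.intro image_system.intro image_system_axioms.intro
      preadditive_category_axioms A.normal_category_axioms) (auto dest: diagram_under.axioms(1) diagram_over.axioms(1))

context covariant_system
begin

text \<open>The cone triangle gives an exact pair at \<open>F\<close> of the lower piece of the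
  middle object, and \<open>half_exact_under\<close> passes it to the images.\<close>

lemma F1_homological:
  assumes H: "homological C A F" and ml: "m = l + 1" and K: "U.computes dg K"
  shows "homological C A K"
proof (rule homologicalI[OF A.normal_category_axioms])
  note add = homologicalD(1)[OF H]
  show "additive_functor C A K" by (rule U.computes_additive[OF K add])
  fix f g h assume T: "(f, g, h) \<in> Dist C"
  note X = K add dist_Hom(1,2)[OF T] dist_comp_Zer[OF T]
  note d = U.half_exact_facts(1-3)[OF X] and fg = U.half_exact_facts(4,5)[OF X]
  obtain a where a: "p_ext (upper (dg (Dom C f))) (upper (dg (Cod C f))) f a" using U.ex_EP[OF d(1,2) fg(1)] by blast
  obtain b where b: "p_ext (lower (dg (Cod C f))) (lower (dg (Cod C g))) g b" using U.ex_EQ[OF d(2,3) fg(2)] by blast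
  obtain v h' u where V: "(con_le (dg (Cod C f)) \<cdot> a, v, h') \<in> Dist C"
    and u: "u \<in> Ar C" "Dom C u = lo (lower (dg (Cod C g)))"
      "u \<cdot> (b \<cdot> con_le (dg (Cod C f))) = v \<cdot> con_le (dg (Cod C f))"
    using le_cone[OF T d[unfolded ml] fg a b] .
  show "exact A (FA K f) (FA K g)"
    by (rule U.half_exact_under[OF X a homologicalD(2)[OF H V] _ _ b u(1) _ u(3)])
      (use u distD[OF V] con_Ar[OF lm d(2)] con_Ar[OF lm d(3)] U.EP_Ar[OF d(1,2) a] in simp_all)
qed

text \<open>Here a fibre takes the place of the cone, and the exact pair sits at \<open>F\<close> of
  the upper piece of the middle object.\<close>

lemma F2_homological:
  assumes H: "homological C A F" and ml: "m = l + 1" and K: "O.computes dg K"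
  shows "homological C A K"
proof (rule homologicalI[OF A.normal_category_axioms])
  have ml': "m - 1 = (l - 1) + 1" using ml by simp
  note add = homologicalD(1)[OF H]
  show "additive_functor C A K" by (rule O.computes_additive[OF K add])
  fix f g h assume T: "(f, g, h) \<in> Dist C"
  note X = K add dist_Hom(1,2)[OF T] dist_comp_Zer[OF T]
  note d = O.half_exact_facts(1-3)[OF X] and fg = O.half_exact_facts(4,5)[OF X]
  obtain a where a: "i_ext (upper (dg (Dom C f))) (upper (dg (Cod C f))) f a" using O.ex_EP[OF d(1,2) fg(1)] by blast
  obtain b where b: "i_ext (upper (dg (Cod C f))) (upper (dg (Cod C g))) g b" using O.ex_EP[OF d(2,3) fg(2)] by blast
  obtain v h' u where V: "(v, con_ge (dg (Cod C g)) \<cdot> b, h') \<in> Dist C"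
    and u: "u \<in> Ar C" "Cod C u = hi (upper (dg (Dom C f)))"
      "con_ge (dg (Cod C f)) \<cdot> (a \<cdot> u) = con_ge (dg (Cod C f)) \<cdot> v"
    using ge_cone[OF T d[unfolded ml'] fg a b] .
  show "exact A (FA K f) (FA K g)"
    by (rule O.half_exact_over[OF X b homologicalD(2)[OF H V] _ _ a u(1) _ u(3)])
      (use u distD[OF V] con_Ar[OF lm1 d(1)] con_Ar[OF lm1 d(2)] con_Ar[OF lm1 d(3)] O.EP_Ar[OF d(2,3) b] in simp_all)
qed

text \<open>The boundary square of the connecting morphism between the two decompositions of one
  object, its shifted side read as the \<open>con_ge\<close> arrow of the shifted diagram.\<close>

lemma linked: "d \<in> dgms m l \<Longrightarrow> linked d (sh_dgm d) (t_bd (upper d)) (t_bd (lower d))"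
  unfolding linked_def using con_Ar[OF lm, of d] con_sh_Ar[OF lm, of d] con_bd[OF lm, of d] sh_dgm[of d m l]
    wtriD[OF dgmsD(1), of d m l] wtriD[OF dgmsD(2), of d m l]
  by (auto simp: in_Hom_iff)

context
  fixes j assumes j: "m = l + j"
begin

abbreviation "F1 \<equiv> F1_fun C A F l j"
abbreviation "F2 \<equiv> F2_fun C A F l j"
abbreviation "mor1 \<equiv> F1_map C A F l j"
abbreviation "mor2 \<equiv> F2_map C A F l j"
abbreviation "to1 \<equiv> to_F1 C A F l j"
abbreviation "from2 \<equiv> F2_to C A F l j"
abbreviation "bd \<equiv> delta C A F l j"

lemma F_im: "F1_im C A F l j D X = U.im (dle D X)" "F2_im C A F l j D X = O.im (dge D X)"
  by (simp_all add: F1_im_def F2_im_def U.im_def O.im_def con_w_dgm j)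

context
  fixes D D' assumes D: "weight_choice C L G D" and D': "weight_choice C L G D'"
begin

lemma F_rel:
  assumes "g \<in> Ar C"
  shows "F1_rel C A F l j D D' g u \<longleftrightarrow> U.rel (dle D (Dom C g)) (dle D' (Cod C g)) g u"
    "F2_rel C A F l j D D' g u \<longleftrightarrow> O.rel (dge D (Dom C g)) (dge D' (Cod C g)) g u"
  by (simp_all add: F1_rel_def F2_rel_def U.rel_def O.rel_def F_im le_ext_iff[OF D D' assms] ge_ext_iff[OF D D' assms])

lemma F_map:
  assumes "g \<in> Hom C X Y"
  shows "mor1 D D' g = U.imap (dle D X) (dle D' Y) g"
    "mor2 D D' g = O.imap (dge D X) (dge D' Y) g"
  using assms by (auto simp: F1_map_def F2_map_def U.imap_def O.imap_def F_rel in_Hom_iff)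

end

context
  fixes D assumes D: "weight_choice C L G D"
begin

lemma F_computes: "U.computes (dle D) (F1 D)" "O.computes (dge D) (F2 D)"
  unfolding U.computes_def O.computes_def
  by (simp_all add: w_dgm[OF D] F1_fun_def F2_fun_def F_im F_map[OF D D] in_Hom_iff)

lemma F2_to_eq: "from2 D X = O.from_im (dge D X)"
  by (simp add: F2_to_def O.from_im_def F_im)

lemma to_F1_rel_iff:
  assumes "X \<in> Ob C"
  shows "to_F1_rel C A F l j D X u \<longleftrightarrow> factors A (FA F (con_le (dle D X) \<cdot> t_pr (upper (dle D X)))) (U.im (dle D X)) u"
  using con_Ar(7)[OF lm w_dgm[OF D assms]] by (simp add: to_F1_rel_def F_im)

lemma to_F1_eq: "X \<in> Ob C \<Longrightarrow> to1 D X = U.to_im (dle D X)"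
  by (simp add: to_F1_def U.to_im_def to_F1_rel_iff)

abbreviation conn :: "'o \<Rightarrow> 'n" where
  "conn X \<equiv> connect (dle D X) (dle D X) (sh_dgm (dle D X)) (dge D (sh_ob C 1 X)) (w_bd C D l X)"

text \<open>The arrows \<open>u\<close> of \<open>sh_ext\<close> are the extensions of the identity
  of \<open>X[1]\<close> from the shifted decomposition to the chosen one, so
  \<open>connect_unique\<close> yields the same map for each of them.\<close>

lemma delta_rel_iff:
  assumes X: "X \<in> Ob C"
  shows "delta_rel C A F l j D X k \<longleftrightarrow> k = conn X"
proof -
  note d = w_dgm[OF D X, of m l] and L = linked[OF w_dgm[OF D X]]
  have e: "dge D (sh_ob C 1 X) \<in> dgms (m - 1) (l - 1)" using w_dgm[OF D] X by simp
  have "factors A (FA F (u \<cdot> w_bd C D l X) \<cdot>\<^bsub>A\<^esub> F1_im C A F l j D X) (F2_im C A F l j D (sh_ob C 1 X)) k \<longleftrightarrow> k = conn X"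
    if "sh_ext C D l X u" for u
    using connect_unique[OF L d refl e _ U.EQ_Ident[OF d], of u k] that lowerD[OF d] con_Ar[OF lm d]
    by (simp add: sh_ext_iff[OF D X] F_im)
  moreover have "\<exists>u. sh_ext C D l X u"
    using O.ex_EQ[OF sh_dgm[OF d] e Ident_Hom(3)[OF L d refl e]] by (simp add: sh_ext_iff[OF D X])
  ultimately show ?thesis unfolding delta_rel_def by blast
qed

lemma delta_eq: "X \<in> Ob C \<Longrightarrow> bd D X = conn X"
  by (simp add: delta_def delta_rel_iff)

end

lemma covariant_functors:
  assumes D: "weight_choice C L G D" and D': "weight_choice C L G D'"
  shows "(\<forall>g \<in> Ar C. \<exists>!u. F1_rel C A F l j D D' g u) \<and>
        (\<forall>g \<in> Ar C. \<exists>!u. F2_rel C A F l j D D' g u) \<and>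
        is_functor C A (F1 D) \<and>
        is_functor C A (F2 D) \<and>
        nat_iso C A (F1 D) (F1 D')
          (\<lambda>X. mor1 D D' (Ident C X)) \<and>
        nat_iso C A (F2 D) (F2 D')
          (\<lambda>X. mor2 D D' (Ident C X)) \<and>
        (\<forall>X \<in> Ob C. \<exists>!u. to_F1_rel C A F l j D X u) \<and>
        nat_trans C A (F2 D) F (from2 D) \<and>
        nat_trans C A F (F1 D) (to1 D) \<and>
        (\<forall>X \<in> Ob C.
          from2 D' X \<cdot>\<^bsub>A\<^esub> mor2 D D' (Ident C X) = from2 D X \<and>
          mor1 D D' (Ident C X) \<cdot>\<^bsub>A\<^esub> to1 D X = to1 D' X)"
proof (intro conjI ballI, goal_cases)
  note w = w_dgm[OF D] w_dgm[OF D'] and c = F_computes[OF D] and c' = F_computes[OF D'] and Id = F_map[OF D D' Id_Hom]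
  {
    case (1 g)
    then show ?case unfolding F_rel[OF D D' 1] by (intro U.rel_unique w) (simp_all add: in_Hom_iff)
  next
    case (2 g)
    then show ?case unfolding F_rel[OF D D' 2] by (intro O.rel_unique w) (simp_all add: in_Hom_iff)
  next
    case 3
    show ?case by (rule U.computes_functor[OF c(1)])
  next
    case 4
    show ?case by (rule O.computes_functor[OF c(2)])
  next
    case 5
    show ?case by (rule U.computes_iso[OF c(1) c'(1) Id(1)])
  next
    case 6
    show ?case by (rule O.computes_iso[OF c(2) c'(2) Id(2)])
  next
    case (7 X)
    then show ?case unfolding to_F1_rel_iff[OF D 7] by (intro U.to_im_unique w)
  next
    case 8
    show ?case by (rule O.computes_from_im[OF c(2)]) (rule F2_to_eq[OF D])
  next
    case 9
    show ?case by (rule U.computes_to_im[OF c(1)]) (rule to_F1_eq[OF D])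
  next
    case (10 X)
    then show ?case
      using O.from_im_natural[OF w(1)[OF 10] w(2)[OF 10], of "Ident C X"] O.from_im_Hom[OF w(1)[OF 10]]
      by (simp add: F2_to_eq[OF D] F2_to_eq[OF D'] Id in_Hom_iff)
  next
    case (11 X)
    then show ?case
      using U.to_im_natural[OF w(1)[OF 11] w(2)[OF 11], of "Ident C X"] U.to_im(1)[OF w(2)[OF 11]]
      by (simp add: to_F1_eq[OF D] to_F1_eq[OF D'] Id in_Hom_iff)
  }
qed

lemma homological_functors:
  assumes D: "weight_choice C L G D" and D': "weight_choice C L G D'" and H: "homological C A F" and j1: "j = 1"
  shows "homological C A (F1 D) \<and>
        homological C A (F2 D) \<and>
        (\<forall>X \<in> Ob C. \<exists>!v. delta_rel C A F l j D X v) \<and>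
        nat_trans C A (F1 D) (comp_functor (F2 D) (sh C 1))
          (bd D) \<and>
        (\<forall>X \<in> Ob C. mor2 D D' (Ident C (sh_ob C 1 X)) \<cdot>\<^bsub>A\<^esub> bd D X
          = bd D' X \<cdot>\<^bsub>A\<^esub> mor1 D D' (Ident C X)) \<and>
        (\<forall>X \<in> Ob C. long_exact A
          (\<lambda>n. from2 D (sh_ob C n X))
          (\<lambda>n. to1 D (sh_ob C n X))
          (\<lambda>n. bd D (sh_ob C n X)))"
proof (intro conjI ballI)
  note w = w_dgm[OF D] w_dgm[OF D']
  note c = F_computes[OF D]
  have ml: "m = l + 1" using j j1 by simp
  show "homological C A (F1 D)" "homological C A (F2 D)"
    by (rule F1_homological[OF H ml c(1)], rule F2_homological[OF H ml c(2)])
  \<comment> \<open>The second choice \<open>D''\<close> makes this serve twice: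
    \<open>D'' = D\<close> gives naturality, and \<open>g\<close> an identity gives compatibility
    with a change of choice.\<close>
  have nat: "mor2 D D'' (sh_ar C 1 g) \<cdot>\<^bsub>A\<^esub> bd D X = bd D'' Y \<cdot>\<^bsub>A\<^esub> mor1 D D'' g"
    if D'': "weight_choice C L G D''" and g: "g \<in> Hom C X Y" for D'' X Y g
  proof -
    have X: "X \<in> Ob C" "Y \<in> Ob C" using Hom_Ob[OF g] by auto
    then have X1: "sh_ob C 1 X \<in> Ob C" "sh_ob C 1 Y \<in> Ob C" by simp_all
    note d = w(1)[OF X(1), of m l] w_dgm[OF D'' X(2), of m l] w(1)[OF X1(1), of "m - 1" "l - 1"] w_dgm[OF D'' X1(2), of "m - 1" "l - 1"]
    note t = weight_choice_wtri(1)[OF D X(1)] weight_choice_wtri(1)[OF D'' X(2)]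
    obtain e c where "tri_mor C (w_tri C D l X) (w_tri C D'' l Y) e g c"
      using ex_tri_mor[OF t order_refl g] by blast
    note T = i_ext_sh[OF this t g]
    show ?thesis
      using connect_natural[OF linked[OF d(1)] linked[OF d(2)] d(1) _ d(3) _ d(2) _ d(4), of g "sh_ar C 1 g" c "sh_ar C 1 e"]
        T g sh_ar_Hom[OF g, of 1]
      by (simp add: delta_eq[OF D X(1)] delta_eq[OF D'' X(2)] F_map[OF D D'' g] F_map[OF D D'' sh_ar_Hom[OF g]])
  qed
  show "nat_trans C A (F1 D) (comp_functor (F2 D) (sh C 1)) (bd D)"
    unfolding nat_trans_def
  proof (intro conjI ballI allI)
    fix X assume X: "X \<in> Ob C"
    then have X1: "sh_ob C 1 X \<in> Ob C" by simp
    show "bd D X \<in> Hom A (FO (F1 D) X) (FO (comp_functor (F2 D) (sh C 1)) X)"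
      using connect_simps[OF linked[OF w(1)[OF X]] w(1)[OF X] refl w(1)[OF X1]]
      by (simp add: in_Hom_iff delta_eq[OF D X] comp_functor_def sh_def U.computesD(3)[OF c(1) X] O.computesD(3)[OF c(2) X1])
  next
    fix X Y f assume f: "f \<in> Hom C X Y"
    show "bd D Y \<cdot>\<^bsub>A\<^esub> FA (F1 D) f
        = FA (comp_functor (F2 D) (sh C 1)) f \<cdot>\<^bsub>A\<^esub> bd D X"
      using nat[OF D f] by (simp add: comp_functor_def sh_def F1_fun_def F2_fun_def)
  qed
  fix X assume X: "X \<in> Ob C"
  show "\<exists>!v. delta_rel C A F l j D X v" by (simp add: delta_rel_iff[OF D X])
  show "mor2 D D' (Ident C (sh_ob C 1 X)) \<cdot>\<^bsub>A\<^esub> bd D X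
      = bd D' X \<cdot>\<^bsub>A\<^esub> mor1 D D' (Ident C X)"
    using nat[OF D' Id_Hom[OF X]] X by simp
  show "long_exact A (\<lambda>n. from2 D (sh_ob C n X)) (\<lambda>n. to1 D (sh_ob C n X))
      (\<lambda>n. bd D (sh_ob C n X))"
    unfolding long_exact_def
  proof (intro allI conjI)
    fix n
    have Y: "sh_ob C n X \<in> Ob C" and Y1: "sh_ob C (n + 1) X \<in> Ob C" using X by simp_all
    have sh: "sh_ob C 1 (sh_ob C n X) = sh_ob C (n + 1) X" using X by (simp add: add.commute)
    note d = w(1)[OF Y, of m l] and e = w(1)[OF Y, of "m - 1" "l - 1"] and e1 = w(1)[OF Y1, of "m - 1" "l - 1"]
    note W = upperD(1)[OF d] lowerD(1)[OF d]
    \<comment> \<open>For \<open>m = l + 1\<close> the upper triangle of \<open>dge\<close> is the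
      lower triangle of \<open>dle\<close>, and \<open>exact_from_to\<close> needs just its
      exactness at the middle vertex.\<close>
    show "exact A (from2 D (sh_ob C n X)) (to1 D (sh_ob C n X))"
      unfolding F2_to_eq[OF D] to_F1_eq[OF D Y]
      using exact_from_to[OF d e] homologicalD(2)[OF H W(2)] con_Ar(7)[OF lm d] con_Ar(8)[OF lm1 e] ml by simp
    \<comment> \<open>The lower triangle gives the row of targets, up to the boundary map; the upper
      one gives the row of sources, from the boundary map to the shifted object.\<close>
    have "exact A (U.to_im (dle D (sh_ob C n X))) (conn D (sh_ob C n X))"
      "exact A (conn D (sh_ob C n X)) (O.from_im (dge D (sh_ob C (n + 1) X)))"
      using connect_exact[OF linked[OF d] d refl e1] homologicalD(3)[OF H W(2)] homologicalD(4)[OF H W(1)]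
        con_Ar(7)[OF lm d] con_sh_Ar(4)[OF lm d] sh by simp_all
    then show "exact A (to1 D (sh_ob C n X)) (bd D (sh_ob C n X))"
      "exact A (bd D (sh_ob C n X)) (from2 D (sh_ob C (n + 1) X))"
      unfolding F2_to_eq[OF D] to_F1_eq[OF D Y] delta_eq[OF D Y] by simp_all
  qed
qed

end

end

subsection \<open>Contravariant functors\<close>

locale contravariant_system = weight_system C L G A m l F
  for C :: "('o, 'm, 'y) tricategory_scheme" (structure) and L G :: "'o set"
    and A :: "('p, 'n, 'z) precategory_scheme" and m l F +
  assumes F: "is_functor (opp C) A F"

text \<open>On \<open>opp C\<close> the \<open>w_ge\<close> diagrams lie under their objects and the
  \<open>w_le\<close> diagrams over them. This turns the transformations into
  \<open>F\<^sub>1 \<rightarrow> F \<rightarrow> F\<^sub>2\<close> and makes the connecting map run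
  from the shifted object to the original one.\<close>

sublocale contravariant_system \<subseteq> image_pair "opp C" A F
  "dgms (m - 1) (l - 1)" fst con_ge "\<lambda>d d'. i_ext (lower d') (lower d)" "\<lambda>d d'. i_ext (upper d') (upper d)" "\<lambda>d. t_in (lower d)"
  "dgms m l" fst con_le "\<lambda>d d'. p_ext (lower d') (lower d)" "\<lambda>d d'. p_ext (upper d') (upper d)" "\<lambda>d. t_pr (upper d)"
  using diagram_under.diagram_over_opp[OF le_diagrams[OF lm]] diagram_over.diagram_under_opp[OF ge_diagrams[OF lm1]] F
  by (intro image_pair.intro image_under.intro image_over.intro image_system.intro image_system_axioms.intro
      preadditive_opp A.normal_category_axioms) (auto dest: diagram_under.axioms(1) diagram_over.axioms(1))

context contravariant_system
begin

lemma FA_Ident_opp [simp]: "X \<in> Ob C \<Longrightarrow> FA F (Ident C X) = Ident A (FO F X)"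
  using O.FA_Ident[of X] by simp

lemma dist_opp:
  assumes "(f, g, h) \<in> Dist C"
  shows "g \<in> Hom (opp C) (Cod C g) (Cod C f)" "f \<in> Hom (opp C) (Cod C f) (Dom C f)"
    "f \<cdot>\<^bsub>opp C\<^esub> g = Zer (opp C) (Cod C g) (Dom C f)"
  using dist_Hom[OF assms] dist_comp_Zer[OF assms] by simp_all

lemma coF1_cohomological:
  assumes H: "cohomological C A F" and ml: "m = l + 1" and K: "O.computes dg K"
  shows "cohomological C A K"
proof (rule cohomologicalI[OF A.normal_category_axioms])
  note add = cohomologicalD(1)[OF H]
  show "additive_functor (opp C) A K" by (rule O.computes_additive[OF K add])
  fix f g h assume T: "(f, g, h) \<in> Dist C"
  note X = K add dist_opp[OF T]
  note d = O.half_exact_facts(3,2,1)[OF X] and fg' = O.half_exact_facts(4,5)[OF X]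
  note fg = fg'(2,1)[unfolded Hom_opp]
  obtain a where a: "p_ext (upper (dg (Dom C f))) (upper (dg (Cod C f))) f a" using O.ex_EQ[OF d(2,1) fg'(2)] by blast
  obtain b' where b': "p_ext (lower (dg (Dom C f))) (lower (dg (Cod C f))) f b'" using O.ex_EP[OF d(2,1) fg'(2)] by blast
  obtain b where b: "p_ext (lower (dg (Cod C f))) (lower (dg (Cod C g))) g b" using O.ex_EP[OF d(3,2) fg'(1)] by blast
  \<comment> \<open>\<open>half_exact_over\<close> works with the composite through the lower
    pieces, \<open>le_cone\<close> with the one through the upper pieces; naturality of
    \<open>con_le\<close> identifies them.\<close>
  have nat: "b' \<cdot> con_le (dg (Dom C f)) = con_le (dg (Cod C f)) \<cdot> a" by (rule con_natural(1)[OF lm d(1,2) fg(1) a b'])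
  obtain v h' u where V: "(con_le (dg (Cod C f)) \<cdot> a, v, h') \<in> Dist C"
    and u: "u \<in> Ar C" "Dom C u = lo (lower (dg (Cod C g)))"
      "u \<cdot> (b \<cdot> con_le (dg (Cod C f))) = v \<cdot> con_le (dg (Cod C f))"
    using le_cone[OF T d[unfolded ml] fg a b] .
  have ex: "exact A (FA F v) (FA F (con_le (dg (Dom C f)) \<cdot>\<^bsub>opp C\<^esub> b'))"
    using cohomologicalD(2)[OF H V] nat by simp
  show "exact A (FA K g) (FA K f)"
    by (rule O.half_exact_over[OF X b' ex _ _ b, where s = u])
      (use u distD[OF V] con_Ar[OF lm d(2)] con_Ar[OF lm d(3)] a b in \<open>simp_all add: p_ext_def in_Hom_iff\<close>)
qed

lemma coF2_cohomological:
  assumes H: "cohomological C A F" and ml: "m = l + 1" and K: "U.computes dg K"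
  shows "cohomological C A K"
proof (rule cohomologicalI[OF A.normal_category_axioms])
  have ml': "m - 1 = (l - 1) + 1" using ml by simp
  note add = cohomologicalD(1)[OF H]
  show "additive_functor (opp C) A K" by (rule U.computes_additive[OF K add])
  fix f g h assume T: "(f, g, h) \<in> Dist C"
  note X = K add dist_opp[OF T]
  note d = U.half_exact_facts(3,2,1)[OF X] and fg' = U.half_exact_facts(4,5)[OF X]
  note fg = fg'(2,1)[unfolded Hom_opp]
  obtain a where a: "i_ext (upper (dg (Dom C f))) (upper (dg (Cod C f))) f a" using U.ex_EQ[OF d(2,1) fg'(2)] by blast
  obtain b where b: "i_ext (upper (dg (Cod C f))) (upper (dg (Cod C g))) g b" using U.ex_EQ[OF d(3,2) fg'(1)] by blast
  obtain b' where b': "i_ext (lower (dg (Cod C f))) (lower (dg (Cod C g))) g b'" using U.ex_EP[OF d(3,2) fg'(1)] by blast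
  have nat: "b' \<cdot> con_ge (dg (Cod C f)) = con_ge (dg (Cod C g)) \<cdot> b" by (rule con_natural(2)[OF lm1 d(2,3) fg(2) b b'])
  obtain v h' u where V: "(v, con_ge (dg (Cod C g)) \<cdot> b, h') \<in> Dist C"
    and u: "u \<in> Ar C" "Cod C u = hi (upper (dg (Dom C f)))"
      "con_ge (dg (Cod C f)) \<cdot> (a \<cdot> u) = con_ge (dg (Cod C f)) \<cdot> v"
    using ge_cone[OF T d[unfolded ml'] fg a b] .
  have ex: "exact A (FA F (con_ge (dg (Cod C f)) \<cdot>\<^bsub>opp C\<^esub> b')) (FA F v)"
    using cohomologicalD(2)[OF H V] nat by simp
  show "exact A (FA K g) (FA K f)"
    by (rule U.half_exact_under[OF X b' ex _ _ a, where s = u])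
      (use u distD[OF V] con_Ar[OF lm1 d(1)] con_Ar[OF lm1 d(2)] con_Ar[OF lm1 d(3)] a b in \<open>simp_all add: i_ext_def in_Hom_iff\<close>)
qed

lemma linked: "d \<in> dgms m l \<Longrightarrow> linked (sh_dgm d) d (t_bd (lower d)) (t_bd (upper d))"
  unfolding linked_def using con_Ar[OF lm, of d] con_sh_Ar[OF lm, of d] con_bd[OF lm, of d] sh_dgm[of d m l]
    wtriD[OF dgmsD(1), of d m l] wtriD[OF dgmsD(2), of d m l]
  by (auto simp: in_Hom_iff)

context
  fixes j assumes j: "m = l + j"
begin

abbreviation "F1 \<equiv> coF1_fun C A F l j"
abbreviation "F2 \<equiv> coF2_fun C A F l j"
abbreviation "mor1 \<equiv> coF1_map C A F l j"
abbreviation "mor2 \<equiv> coF2_map C A F l j"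
abbreviation "from1 \<equiv> coF1_to C A F l j"
abbreviation "to2 \<equiv> to_coF2 C A F l j"
abbreviation "bd \<equiv> codelta C A F l j"

lemma F_im: "F1_im C A F l j D X = O.im (dle D X)" "F2_im C A F l j D X = U.im (dge D X)"
  by (simp_all add: F1_im_def F2_im_def O.im_def U.im_def con_w_dgm j)

context
  fixes D D' assumes D: "weight_choice C L G D" and D': "weight_choice C L G D'"
begin

lemma coF_rel:
  assumes "g \<in> Ar C"
  shows "coF1_rel C A F l j D D' g u \<longleftrightarrow> O.rel (dle D' (Cod C g)) (dle D (Dom C g)) g u"
    "coF2_rel C A F l j D D' g u \<longleftrightarrow> U.rel (dge D' (Cod C g)) (dge D (Dom C g)) g u"
  by (simp_all add: coF1_rel_def coF2_rel_def O.rel_def U.rel_def F_im j[symmetric]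
      le_ext_iff[OF D D' assms] ge_ext_iff[OF D D' assms])

lemma coF_map:
  assumes "g \<in> Hom C X Y"
  shows "mor1 D D' g = O.imap (dle D' Y) (dle D X) g"
    "mor2 D D' g = U.imap (dge D' Y) (dge D X) g"
  using assms by (auto simp: coF1_map_def coF2_map_def O.imap_def U.imap_def coF_rel in_Hom_iff)

end

context
  fixes D assumes D: "weight_choice C L G D"
begin

lemma coF_computes: "O.computes (dle D) (F1 D)" "U.computes (dge D) (F2 D)"
  unfolding O.computes_def U.computes_def
  by (simp_all add: w_dgm[OF D] coF1_fun_def coF2_fun_def F_im coF_map[OF D D] in_Hom_iff)

lemma coF1_to_eq: "from1 D X = O.from_im (dle D X)"
  by (simp add: coF1_to_def O.from_im_def F_im j[symmetric])

lemma to_coF2_rel_iff: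
  assumes "X \<in> Ob C"
  shows "to_coF2_rel C A F l j D X u \<longleftrightarrow>
    factors A (FA F (con_ge (dge D X) \<cdot>\<^bsub>opp C\<^esub> t_in (lower (dge D X)))) (U.im (dge D X)) u"
  using con_Ar(8)[OF lm1 w_dgm[OF D assms]] by (simp add: to_coF2_rel_def F_im j[symmetric])

lemma to_coF2_eq: "X \<in> Ob C \<Longrightarrow> to2 D X = U.to_im (dge D X)"
  unfolding to_coF2_def U.to_im_def by (rule arg_cong[of _ _ The]) (rule ext, rule to_coF2_rel_iff)

abbreviation conn :: "'o \<Rightarrow> 'n" where
  "conn X \<equiv> connect (dge D (sh_ob C 1 X)) (sh_dgm (dle D X)) (dle D X) (dle D X) (w_bd C D m X)"

lemma codelta_rel_iff:
  assumes X: "X \<in> Ob C"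
  shows "codelta_rel C A F l j D X k \<longleftrightarrow> k = conn X"
proof -
  note d = w_dgm[OF D X, of m l] and L = linked[OF w_dgm[OF D X]]
  have e: "dge D (sh_ob C 1 X) \<in> dgms (m - 1) (l - 1)" using w_dgm[OF D] X by simp
  have "factors A (FA F (u \<cdot> w_bd C D m X) \<cdot>\<^bsub>A\<^esub> F2_im C A F l j D (sh_ob C 1 X)) (F1_im C A F l j D X) k \<longleftrightarrow> k = conn X"
    if u: "sh_ext C D m X u" for u
  proof -
    have i: "i_ext (sh_tri (w_tri C D m X)) (w_tri C D (m - 1) (sh_ob C 1 X)) (Ident C (sh_ob C 1 X)) u"
      using u by (simp add: sh_ext_iff[OF D X])
    have "u \<in> Ar C" "Dom C u = Cod C (w_bd C D m X)" "w_bd C D m X \<in> Ar C" "Dom C (w_bd C D m X) = Cod C (w_pr C D m X)"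
      using i upperD[OF d] by (simp_all add: i_ext_def in_Hom_iff)
    then show ?thesis
      using connect_unique[OF L e _ d refl _ O.EQ_Ident[OF d], of u k] i con_Ar[OF lm d] by (simp add: F_im)
  qed
  moreover have "\<exists>u. sh_ext C D m X u"
    using U.ex_EQ[OF e sh_dgm[OF d] Ident_Hom(1)[OF L e _ d refl]] by (simp add: sh_ext_iff[OF D X])
  ultimately show ?thesis unfolding codelta_rel_def j[symmetric] by blast
qed

lemma codelta_eq: "X \<in> Ob C \<Longrightarrow> bd D X = conn X"
  by (simp add: codelta_def codelta_rel_iff)

end

lemma contravariant_functors:
  assumes D: "weight_choice C L G D" and D': "weight_choice C L G D'"
  shows "(\<forall>g \<in> Ar C. \<exists>!u. coF1_rel C A F l j D D' g u) \<and>
        (\<forall>g \<in> Ar C. \<exists>!u. coF2_rel C A F l j D D' g u) \<and>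
        is_functor (opp C) A (F1 D) \<and>
        is_functor (opp C) A (F2 D) \<and>
        nat_iso (opp C) A (F1 D') (F1 D)
          (\<lambda>X. mor1 D D' (Ident C X)) \<and>
        nat_iso (opp C) A (F2 D') (F2 D)
          (\<lambda>X. mor2 D D' (Ident C X)) \<and>
        (\<forall>X \<in> Ob C. \<exists>!u. to_coF2_rel C A F l j D X u) \<and>
        nat_trans (opp C) A (F1 D) F (from1 D) \<and>
        nat_trans (opp C) A F (F2 D) (to2 D) \<and>
        (\<forall>X \<in> Ob C.
          from1 D X \<cdot>\<^bsub>A\<^esub> mor1 D D' (Ident C X) = from1 D' X \<and>
          mor2 D D' (Ident C X) \<cdot>\<^bsub>A\<^esub> to2 D' X = to2 D X)"
proof (intro conjI ballI, goal_cases)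
  note w = w_dgm[OF D] w_dgm[OF D'] and c = coF_computes[OF D] and c' = coF_computes[OF D'] and Id = coF_map[OF D D' Id_Hom]
  {
    case (1 g)
    then show ?case unfolding coF_rel[OF D D' 1] by (intro O.rel_unique w) (simp_all add: in_Hom_iff)
  next
    case (2 g)
    then show ?case unfolding coF_rel[OF D D' 2] by (intro U.rel_unique w) (simp_all add: in_Hom_iff)
  next
    case 3
    show ?case by (rule O.computes_functor[OF c(1)])
  next
    case 4
    show ?case by (rule U.computes_functor[OF c(2)])
  next
    case 5
    show ?case by (rule O.computes_iso[OF c'(1) c(1)]) (simp add: Id)
  next
    case 6
    show ?case by (rule U.computes_iso[OF c'(2) c(2)]) (simp add: Id)
  next
    case (7 X)
    then show ?case unfolding to_coF2_rel_iff[OF D 7] by (intro U.to_im_unique w)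
  next
    case 8
    show ?case by (rule O.computes_from_im[OF c(1)]) (rule coF1_to_eq[OF D])
  next
    case 9
    show ?case by (rule U.computes_to_im[OF c(2)]) (simp add: to_coF2_eq[OF D])
  next
    case (10 X)
    then show ?case
      using O.from_im_natural[OF w(2)[OF 10] w(1)[OF 10], of "Ident C X"] O.from_im_Hom[OF w(2)[OF 10]]
      by (simp add: coF1_to_eq[OF D] coF1_to_eq[OF D'] Id in_Hom_iff)
  next
    case (11 X)
    then show ?case
      using U.to_im_natural[OF w(2)[OF 11] w(1)[OF 11], of "Ident C X"] U.to_im(1)[OF w(1)[OF 11]]
      by (simp add: to_coF2_eq[OF D] to_coF2_eq[OF D'] Id in_Hom_iff)
  }
qed

lemma cohomological_functors:
  assumes D: "weight_choice C L G D" and D': "weight_choice C L G D'" and H: "cohomological C A F" and j1: "j = 1"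
  shows "cohomological C A (F1 D) \<and>
        cohomological C A (F2 D) \<and>
        (\<forall>X \<in> Ob C. \<exists>!v. codelta_rel C A F l j D X v) \<and>
        nat_trans (opp C) A (comp_functor (F2 D) (sh C 1)) (F1 D)
          (bd D) \<and>
        (\<forall>X \<in> Ob C. bd D X \<cdot>\<^bsub>A\<^esub> mor2 D D' (Ident C (sh_ob C 1 X))
          = mor1 D D' (Ident C X) \<cdot>\<^bsub>A\<^esub> bd D' X) \<and>
        (\<forall>X \<in> Ob C. long_exact A
          (\<lambda>n. from1 D (sh_ob C (- n) X))
          (\<lambda>n. to2 D (sh_ob C (- n) X))
          (\<lambda>n. bd D (sh_ob C (- n - 1) X)))"
proof (intro conjI ballI)
  note w = w_dgm[OF D] w_dgm[OF D']
  note c = coF_computes[OF D]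
  have ml: "m = l + 1" using j j1 by simp
  show "cohomological C A (F1 D)" "cohomological C A (F2 D)"
    by (rule coF1_cohomological[OF H ml c(1)], rule coF2_cohomological[OF H ml c(2)])
  have nat: "bd D X \<cdot>\<^bsub>A\<^esub> mor2 D D'' (sh_ar C 1 g)
      = mor1 D D'' g \<cdot>\<^bsub>A\<^esub> bd D'' Y"
    if D'': "weight_choice C L G D''" and g: "g \<in> Hom C X Y" for D'' X Y g
  proof -
    have X: "X \<in> Ob C" "Y \<in> Ob C" using Hom_Ob[OF g] by auto
    then have X1: "sh_ob C 1 X \<in> Ob C" "sh_ob C 1 Y \<in> Ob C" by simp_all
    note d = w(1)[OF X(1), of m l] w_dgm[OF D'' X(2), of m l] w(1)[OF X1(1), of "m - 1" "l - 1"] w_dgm[OF D'' X1(2), of "m - 1" "l - 1"]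
    note t = weight_choice_wtri(1)[OF D X(1)] weight_choice_wtri(1)[OF D'' X(2)]
    \<comment> \<open>Level \<open>m\<close> instead of \<open>l\<close>: reversing arrows makes the
      upper pieces the targets, so the connecting map is read off the upper boundary map.\<close>
    obtain e c where "tri_mor C (w_tri C D m X) (w_tri C D'' m Y) e g c"
      using ex_tri_mor[OF t order_refl g] by blast
    note T = i_ext_sh[OF this t g]
    show ?thesis
      using connect_natural[OF linked[OF d(2)] linked[OF d(1)] d(4) _ d(2) _ d(3) _ d(1), of "sh_ar C 1 g" g "sh_ar C 1 e" c]
        T g sh_ar_Hom[OF g, of 1]
      by (simp add: codelta_eq[OF D X(1)] codelta_eq[OF D'' X(2)] coF_map[OF D D'' g] coF_map[OF D D'' sh_ar_Hom[OF g]])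
  qed
  show "nat_trans (opp C) A (comp_functor (F2 D) (sh C 1)) (F1 D) (bd D)"
    unfolding nat_trans_def
  proof (intro conjI ballI allI)
    fix X assume "X \<in> Ob (opp C)"
    then have X: "X \<in> Ob C" and X1: "sh_ob C 1 X \<in> Ob C" by simp_all
    show "bd D X \<in> Hom A (FO (comp_functor (F2 D) (sh C 1)) X) (FO (F1 D) X)"
      using connect_simps[OF linked[OF w(1)[OF X]] w(1)[OF X1] _ w(1)[OF X] refl] X X1
      by (simp add: in_Hom_iff codelta_eq[OF D X] comp_functor_def sh_def O.computesD(3)[OF c(1)] U.computesD(3)[OF c(2)])
  next
    fix Y X f assume "f \<in> Hom (opp C) Y X"
    then have f: "f \<in> Hom C X Y" by simp
    show "bd D X \<cdot>\<^bsub>A\<^esub> FA (comp_functor (F2 D) (sh C 1)) f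
        = FA (F1 D) f \<cdot>\<^bsub>A\<^esub> bd D Y"
      using nat[OF D f] by (simp add: comp_functor_def sh_def coF1_fun_def coF2_fun_def)
  qed
  fix X assume X: "X \<in> Ob C"
  show "\<exists>!v. codelta_rel C A F l j D X v" by (simp add: codelta_rel_iff[OF D X])
  show "bd D X \<cdot>\<^bsub>A\<^esub> mor2 D D' (Ident C (sh_ob C 1 X))
      = mor1 D D' (Ident C X) \<cdot>\<^bsub>A\<^esub> bd D' X"
    using nat[OF D' Id_Hom[OF X]] X by simp
  show "long_exact A (\<lambda>n. from1 D (sh_ob C (- n) X)) (\<lambda>n. to2 D (sh_ob C (- n) X))
      (\<lambda>n. bd D (sh_ob C (- n - 1) X))"
    unfolding long_exact_def
  proof (intro allI conjI)
    fix n
    have Y: "sh_ob C (- n) X \<in> Ob C" and Y1: "sh_ob C (- n - 1) X \<in> Ob C" using X by simp_all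
    \<comment> \<open>The sequence descends, so the connecting map out of the term at
      \<open>- n\<close> is the one belonging to the object with shift
      \<open>- n - 1\<close>.\<close>
    have sh: "sh_ob C 1 (sh_ob C (- n - 1) X) = sh_ob C (- n) X" using X by simp
    have n: "- (n + 1) = - n - 1" by simp
    note d = w(1)[OF Y, of m l] and e = w(1)[OF Y, of "m - 1" "l - 1"] and d1 = w(1)[OF Y1, of m l]
    note W = lowerD(1)[OF d] upperD(1)[OF d1] lowerD(1)[OF d1]
    show "exact A (from1 D (sh_ob C (- n) X)) (to2 D (sh_ob C (- n) X))"
      unfolding coF1_to_eq[OF D] to_coF2_eq[OF D Y]
      using exact_from_to[OF e d] cohomologicalD(2)[OF H W(1)] con_Ar(7)[OF lm d] con_Ar(8)[OF lm1 e] ml by simp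
    have "exact A (U.to_im (dge D (sh_ob C (- n) X))) (conn D (sh_ob C (- n - 1) X))"
      "exact A (conn D (sh_ob C (- n - 1) X)) (O.from_im (dle D (sh_ob C (- n - 1) X)))"
      using connect_exact[OF linked[OF d1] e _ d1 refl] cohomologicalD(3)[OF H W(3)] cohomologicalD(4)[OF H W(2)]
        con_Ar(7)[OF lm d1] con_sh_Ar(4)[OF lm d1] sh by simp_all
    then show "exact A (to2 D (sh_ob C (- n) X)) (bd D (sh_ob C (- n - 1) X))"
      "exact A (bd D (sh_ob C (- n - 1) X)) (from1 D (sh_ob C (- (n + 1)) X))"
      unfolding n coF1_to_eq[OF D] to_coF2_eq[OF D Y] codelta_eq[OF D Y1] by simp_all
  qed
qed

end

end

theorem proposition2p5p1:
  fixes C :: "('o, 'm, 'y) tricategory_scheme"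
    and A :: "('p, 'n, 'z) precategory_scheme"
    and L G :: "'o set"
    and D D' :: "('o, 'm) wchoice"
    and j k :: int
  assumes "triangulated_category C"
    and "weight_structure C L G"
    and "abelian_category A"
    and "0 < j"
    and "weight_choice C L G D"
    and "weight_choice C L G D'"
  shows
    "(\<forall>F. is_functor C A F \<longrightarrow>
        (\<forall>g \<in> Ar C. \<exists>!u. F1_rel C A F k j D D' g u) \<and>
        (\<forall>g \<in> Ar C. \<exists>!u. F2_rel C A F k j D D' g u) \<and>
        is_functor C A (F1_fun C A F k j D) \<and>
        is_functor C A (F2_fun C A F k j D) \<and>
        nat_iso C A (F1_fun C A F k j D) (F1_fun C A F k j D')
          (\<lambda>X. F1_map C A F k j D D' (Ident C X)) \<and>
        nat_iso C A (F2_fun C A F k j D) (F2_fun C A F k j D')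
          (\<lambda>X. F2_map C A F k j D D' (Ident C X)) \<and>
        (\<forall>X \<in> Ob C. \<exists>!u. to_F1_rel C A F k j D X u) \<and>
        nat_trans C A (F2_fun C A F k j D) F (F2_to C A F k j D) \<and>
        nat_trans C A F (F1_fun C A F k j D) (to_F1 C A F k j D) \<and>
        (\<forall>X \<in> Ob C.
          F2_to C A F k j D' X \<cdot>\<^bsub>A\<^esub> F2_map C A F k j D D' (Ident C X) = F2_to C A F k j D X \<and>
          F1_map C A F k j D D' (Ident C X) \<cdot>\<^bsub>A\<^esub> to_F1 C A F k j D X = to_F1 C A F k j D' X)) \<and>
     (\<forall>F. homological C A F \<and> j = 1 \<longrightarrow>
        homological C A (F1_fun C A F k j D) \<and>
        homological C A (F2_fun C A F k j D) \<and>
        (\<forall>X \<in> Ob C. \<exists>!v. delta_rel C A F k j D X v) \<and>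
        nat_trans C A (F1_fun C A F k j D) (comp_functor (F2_fun C A F k j D) (sh C 1))
          (delta C A F k j D) \<and>
        (\<forall>X \<in> Ob C. F2_map C A F k j D D' (Ident C (sh_ob C 1 X)) \<cdot>\<^bsub>A\<^esub> delta C A F k j D X
          = delta C A F k j D' X \<cdot>\<^bsub>A\<^esub> F1_map C A F k j D D' (Ident C X)) \<and>
        (\<forall>X \<in> Ob C. long_exact A
          (\<lambda>n. F2_to C A F k j D (sh_ob C n X))
          (\<lambda>n. to_F1 C A F k j D (sh_ob C n X))
          (\<lambda>n. delta C A F k j D (sh_ob C n X)))) \<and>
     (\<forall>F. is_functor (opp C) A F \<longrightarrow>
        (\<forall>g \<in> Ar C. \<exists>!u. coF1_rel C A F k j D D' g u) \<and>
        (\<forall>g \<in> Ar C. \<exists>!u. coF2_rel C A F k j D D' g u) \<and>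
        is_functor (opp C) A (coF1_fun C A F k j D) \<and>
        is_functor (opp C) A (coF2_fun C A F k j D) \<and>
        nat_iso (opp C) A (coF1_fun C A F k j D') (coF1_fun C A F k j D)
          (\<lambda>X. coF1_map C A F k j D D' (Ident C X)) \<and>
        nat_iso (opp C) A (coF2_fun C A F k j D') (coF2_fun C A F k j D)
          (\<lambda>X. coF2_map C A F k j D D' (Ident C X)) \<and>
        (\<forall>X \<in> Ob C. \<exists>!u. to_coF2_rel C A F k j D X u) \<and>
        nat_trans (opp C) A (coF1_fun C A F k j D) F (coF1_to C A F k j D) \<and>
        nat_trans (opp C) A F (coF2_fun C A F k j D) (to_coF2 C A F k j D) \<and>
        (\<forall>X \<in> Ob C.
          coF1_to C A F k j D X \<cdot>\<^bsub>A\<^esub> coF1_map C A F k j D D' (Ident C X) = coF1_to C A F k j D' X \<and>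
          coF2_map C A F k j D D' (Ident C X) \<cdot>\<^bsub>A\<^esub> to_coF2 C A F k j D' X = to_coF2 C A F k j D X)) \<and>
     (\<forall>F. cohomological C A F \<and> j = 1 \<longrightarrow>
        cohomological C A (coF1_fun C A F k j D) \<and>
        cohomological C A (coF2_fun C A F k j D) \<and>
        (\<forall>X \<in> Ob C. \<exists>!v. codelta_rel C A F k j D X v) \<and>
        nat_trans (opp C) A (comp_functor (coF2_fun C A F k j D) (sh C 1)) (coF1_fun C A F k j D)
          (codelta C A F k j D) \<and>
        (\<forall>X \<in> Ob C. codelta C A F k j D X \<cdot>\<^bsub>A\<^esub> coF2_map C A F k j D D' (Ident C (sh_ob C 1 X))
          = coF1_map C A F k j D D' (Ident C X) \<cdot>\<^bsub>A\<^esub> codelta C A F k j D' X) \<and>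
        (\<forall>X \<in> Ob C. long_exact A
          (\<lambda>n. coF1_to C A F k j D (sh_ob C (- n) X))
          (\<lambda>n. to_coF2 C A F k j D (sh_ob C (- n) X))
          (\<lambda>n. codelta C A F k j D (sh_ob C (- n - 1) X))))"
proof -
  interpret C: weighted_category C L G
    using assms(1,2) by (simp add: weighted_category_def weighted_category_axioms_def)
  interpret A: abelian_category A by (rule assms(3))
  \<comment> \<open>The levels are \<open>l = k\<close> and \<open>m = k + j\<close>;
    \<open>0 < j\<close> provides the gap between them.\<close>
  have cov: "covariant_system C L G A (k + j) k F" if "is_functor C A F" for F
    using that assms(4)
    by (intro covariant_system.intro weight_system.intro C.weighted_category_axioms A.normal_category_axioms
        covariant_system_axioms.intro weight_system_axioms.intro) simp_all
  have con: "contravariant_system C L G A (k + j) k F" if "is_functor (opp C) A F" for F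
    using that assms(4)
    by (intro contravariant_system.intro weight_system.intro C.weighted_category_axioms A.normal_category_axioms
        contravariant_system_axioms.intro weight_system_axioms.intro) simp_all
  note I = covariant_system.covariant_functors[OF cov refl assms(5,6)]
    and II = covariant_system.homological_functors[OF cov refl assms(5,6)]
    and III = contravariant_system.contravariant_functors[OF con refl assms(5,6)]
    and IV = contravariant_system.cohomological_functors[OF con refl assms(5,6)]
  have homD: "is_functor C A F" if "homological C A F" for F
    using that by (simp add: homological_def additive_functor_def)
  have cohomD: "is_functor (opp C) A F" if "cohomological C A F" for F
    using that by (simp add: cohomological_def additive_functor_def)
  show ?thesis
    by (intro conjI)
      ((intro allI impI, rule I, assumption),
       (intro allI impI, elim conjE, rule II, rule homD, assumption+),
       (intro allI impI, rule III, assumption),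
       (intro allI impI, elim conjE, rule IV, rule cohomD, assumption+))
qed

end
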